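(* Let $\Bbbk$ be an algebraically closed field of characteristic $0$, $V$ an $n$-dimensional $\Bbbk$-vector space, and $U\subset\mathrm{Alg}(V)$ the open separable locus. For $x\in U$, the moduli stack tangent vanishes: $$T_{[V_x]}[\mathrm{Alg}(V)/\mathrm{GL}(V)]\cong HH^2(V_x,V_x)=0.$$ Consequently, each isomorphism class $[V_x]$ is an isolated point of the coarse moduli space $\mathrm{Alg}(V)/\!/\mathrm{GL}(V)$ in any neighborhood that meets the separable locus.
   Context: Fix a basis $(e_i)_{i=1}^n$ of $V$. $V^{2,1}=\mathrm{Hom}(V\otimes V,V)\cong\Bbbk^{n^3}$; each $x\in V^{2,1}$ determines a bilinear product $\mu_x$ on $V$, and $V_x=(V,\mu_x)$. $\mathrm{Alg}(V)$ is the closed subscheme of $V^{2,1}$ of associative products, cut out by the $n^4$ quadratic polynomials in the structure constants expressing associativity. $\mathrm{GL}(V)$ acts by $(g\cdot\mu)(a,b)=g\,\mu(g^{-1}a,g^{-1}b)$. For $x\in\mathrm{Alg}(V)$ let $L_z$ be left multiplication by $z$ in $V_x$ and $\Delta(x)=\det(\mathrm{Tr}(L_{e_ie_j}))_{i,j}$. The separable locus is $U=\{x\in\mathrm{Alg}(V):\Delta(x)\neq0\}$; it consists precisely of the separable algebras. $[\mathrm{Alg}(V)/\mathrm{GL}(V)]$ is the quotient stack; its tangent space at $[V_x]$ is the space of first-order deformations of $x$ in $\mathrm{Alg}(V)$ modulo those induced by the group action, i.e. $T_x\mathrm{Alg}(V)/T_x(\mathrm{GL}(V)\cdot x)$. $HH^2(V_x,V_x)$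 is Hochschild cohomology. $\mathrm{Alg}(V)/\!/\mathrm{GL}(V)$ is the coarse GIT quotient. *)

theory Defs
  imports
    "HOL-Analysis.Analysis"
    "HOL-Library.Poly_Mapping"
    "HOL-Algebra.QuotRing"
    "HOL-Algebra.Module"
    "HOL-Algebra.Algebraic_Closure_Type"
begin

section \<open>Structure constants\<close>

text \<open>
  The space $V$ is $k^n$ with its standard basis $(e_i)$.  A point of $V^{2,1}$ is the tensor of
  structure constants: \<open>x $ i $ j\<close> is the vector $\mu_x(e_i, e_j)$.  The operations below are over
  an arbitrary commutative ring, because they are also applied to tensors over $k[t]$ (to obtain
  points over the dual numbers) and over the polynomial ring in the structure constants.
\<close>

type_synonym ('a, 'n) tensor = "(('a^'n)^'n)^'n"

definition alg_prod :: "('a::comm_ring_1, 'n::finite) tensor \<Rightarrow> 'a^'n \<Rightarrow> 'a^'n \<Rightarrow> 'a^'n" where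
  "alg_prod x a b = (\<chi> k. \<Sum>i\<in>UNIV. \<Sum>j\<in>UNIV. a $ i * b $ j * x $ i $ j $ k)"

definition associator :: "('a::comm_ring_1, 'n::finite) tensor \<Rightarrow> 'n \<Rightarrow> 'n \<Rightarrow> 'n \<Rightarrow> 'n \<Rightarrow> 'a" where
  "associator x i j l m =
     (alg_prod x (alg_prod x (axis i 1) (axis j 1)) (axis l 1)
      - alg_prod x (axis i 1) (alg_prod x (axis j 1) (axis l 1))) $ m"

definition alg_points :: "('k::field, 'n::finite) tensor set" where
  "alg_points = {x. \<forall>i j l m. associator x i j l m = 0}"

definition left_mult :: "('k::field, 'n::finite) tensor \<Rightarrow> 'k^'n \<Rightarrow> 'k^'n^'n" where
  "left_mult x z = matrix (alg_prod x z)"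

definition discriminant :: "('k::field, 'n::finite) tensor \<Rightarrow> 'k" where
  "discriminant x =
     det (\<chi> i j. trace (left_mult x (alg_prod x (axis i 1) (axis j 1))))"

definition separable_locus :: "('k::field, 'n::finite) tensor set" where
  "separable_locus = {x \<in> alg_points. discriminant x \<noteq> 0}"

text \<open>\<open>transport g h x\<close> is the product $(a,b) \mapsto g\,\mu_x(ha, hb)$; the action of $g$ is the
  case $h = g^{-1}$.\<close>

definition transport ::
    "'a^'n^'n \<Rightarrow> 'a^'n^'n \<Rightarrow> ('a::comm_ring_1, 'n::finite) tensor \<Rightarrow> ('a, 'n) tensor" where
  "transport g h x = (\<chi> i j. g *v alg_prod x (h *v axis i 1) (h *v axis j 1))"

definition gl_act :: "'k^'n^'n \<Rightarrow> ('k::field, 'n::finite) tensor \<Rightarrow> ('k, 'n) tensor" where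
  "gl_act g x = transport g (matrix_inv g) x"

definition gl_orbit :: "('k::field, 'n::finite) tensor \<Rightarrow> ('k, 'n) tensor set" where
  "gl_orbit x = {gl_act g x | g. invertible g}"


section \<open>Quotient vector spaces\<close>

text \<open>Vector spaces are records of type \<open>module\<close>; their ring-multiplication fields \<open>mult\<close> and
  \<open>one\<close> play no role.\<close>

definition quotient_space :: "('k, 'v) module \<Rightarrow> 'v set \<Rightarrow> ('k, 'v set) module" where
  "quotient_space M N =
     \<lparr>carrier = a_rcosets\<^bsub>M\<^esub> N, monoid.mult = undefined, one = undefined,
      zero = N, add = set_add M,
      smult = (\<lambda>c Q. \<Union>u\<in>Q. N +>\<^bsub>M\<^esub> (c \<odot>\<^bsub>M\<^esub> u))\<rparr>"

definition linear_iso :: "('k, 'v) module \<Rightarrow> ('k, 'w) module \<Rightarrow> ('v \<Rightarrow> 'w) \<Rightarrow> bool" where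
  "linear_iso M N h \<longleftrightarrow>
     bij_betw h (carrier M) (carrier N) \<and>
     (\<forall>u\<in>carrier M. \<forall>v\<in>carrier M. h (u \<oplus>\<^bsub>M\<^esub> v) = h u \<oplus>\<^bsub>N\<^esub> h v) \<and>
     (\<forall>c. \<forall>u\<in>carrier M. h (c \<odot>\<^bsub>M\<^esub> u) = c \<odot>\<^bsub>N\<^esub> h u)"


section \<open>The tangent space of the quotient stack\<close>

text \<open>Dual numbers are represented by $k[t]$ modulo $t^2$.\<close>

definition deform :: "('k::field, 'n::finite) tensor \<Rightarrow> ('k, 'n) tensor \<Rightarrow> ('k poly, 'n) tensor" where
  "deform x \<xi> = (\<chi> i j k. [: x $ i $ j $ k, \<xi> $ i $ j $ k :])"

definition deform_matrix :: "'k::field^'n^'n \<Rightarrow> 'k poly^'n^'n" where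
  "deform_matrix D = (\<chi> i j. [: mat 1 $ i $ j, D $ i $ j :])"

text \<open>The tangent space at $x$ of the scheme defined by the associativity equations (which need
  not be reduced).\<close>

definition alg_tangent :: "('k::field, 'n::finite) tensor \<Rightarrow> ('k, 'n) tensor set" where
  "alg_tangent x = {\<xi>. \<forall>i j l m. [:0, 1:]^2 dvd associator (deform x \<xi>) i j l m}"

text \<open>First-order deformations $(1 + tD) \cdot x$ with $D \in \mathrm{End}(V)$; modulo $t^2$ the
  inverse of $1 + tD$ is $1 - tD$.\<close>

definition orbit_tangent :: "('k::field, 'n::finite) tensor \<Rightarrow> ('k, 'n) tensor set" where
  "orbit_tangent x =
     {\<xi>. \<exists>D. \<forall>i j k. [:0, 1:]^2 dvd
        (transport (deform_matrix D) (deform_matrix (- D)) (deform x 0) - deform x \<xi>) $ i $ j $ k}"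

definition stack_tangent :: "('k::field, 'n::finite) tensor \<Rightarrow> ('k, ('k, 'n) tensor set) module" where
  "stack_tangent x =
     quotient_space
       \<lparr>carrier = alg_tangent x, monoid.mult = undefined, one = undefined, zero = 0, add = (+),
        smult = (\<lambda>c \<xi>. \<chi> i j. c *s \<xi> $ i $ j)\<rparr>
       (orbit_tangent x)"


section \<open>Second Hochschild cohomology\<close>

definition is_linear :: "('k::field^'n \<Rightarrow> 'k^'n) \<Rightarrow> bool" where
  "is_linear f \<longleftrightarrow> Vector_Spaces.linear (*s) (*s) f"

definition is_bilinear :: "('k::field^'n \<Rightarrow> 'k^'n \<Rightarrow> 'k^'n) \<Rightarrow> bool" where
  "is_bilinear f \<longleftrightarrow> (\<forall>a. is_linear (f a)) \<and> (\<forall>b. is_linear (\<lambda>a. f a b))"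

text \<open>Differentials of the Hochschild cochain complex $C^m(A,A) = \mathrm{Hom}(A^{\otimes m}, A)$ out
  of degrees 1 and 2, for the algebra $A$ with product \<open>p\<close>.\<close>

definition hochschild_d1 ::
    "('k::field^'n \<Rightarrow> 'k^'n \<Rightarrow> 'k^'n) \<Rightarrow> ('k^'n \<Rightarrow> 'k^'n) \<Rightarrow> ('k^'n \<Rightarrow> 'k^'n \<Rightarrow> 'k^'n)" where
  "hochschild_d1 p f = (\<lambda>a b. p a (f b) - f (p a b) + p (f a) b)"

definition hochschild_d2 ::
    "('k::field^'n \<Rightarrow> 'k^'n \<Rightarrow> 'k^'n) \<Rightarrow> ('k^'n \<Rightarrow> 'k^'n \<Rightarrow> 'k^'n)
      \<Rightarrow> ('k^'n \<Rightarrow> 'k^'n \<Rightarrow> 'k^'n \<Rightarrow> 'k^'n)" where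
  "hochschild_d2 p f = (\<lambda>a b c. p a (f b c) - f (p a b) c + f a (p b c) - p (f a b) c)"

definition HH2 :: "('k::field, 'n::finite) tensor \<Rightarrow> ('k, ('k^'n \<Rightarrow> 'k^'n \<Rightarrow> 'k^'n) set) module" where
  "HH2 x =
     quotient_space
       \<lparr>carrier = {f. is_bilinear f \<and> hochschild_d2 (alg_prod x) f = (\<lambda>a b c. 0)},
        monoid.mult = undefined, one = undefined, zero = (\<lambda>a b. 0),
        add = (\<lambda>f g a b. f a b + g a b), smult = (\<lambda>c f a b. c *s f a b)\<rparr>
       {hochschild_d1 (alg_prod x) f | f. is_linear f}"


section \<open>The GIT quotient\<close>

text \<open>Polynomials over $k$ in the $n^3$ structure constants.\<close>

type_synonym ('k, 'n) coord_poly = "('n \<times> 'n \<times> 'n \<Rightarrow>\<^sub>0 nat) \<Rightarrow>\<^sub>0 'k"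

definition const_poly :: "'k::field \<Rightarrow> ('k, 'n) coord_poly" where
  "const_poly c = Poly_Mapping.single 0 c"

definition generic_tensor :: "(('k::field, 'n::finite) coord_poly, 'n) tensor" where
  "generic_tensor = (\<chi> i j k. Poly_Mapping.single (Poly_Mapping.single (i, j, k) 1) 1)"

text \<open>Evaluation of a polynomial at a tensor over a $k$-algebra with structure map \<open>\<phi>\<close>.\<close>

definition poly_eval ::
    "('k::field \<Rightarrow> 'a::comm_ring_1) \<Rightarrow> ('a, 'n::finite) tensor \<Rightarrow> ('k, 'n) coord_poly \<Rightarrow> 'a" where
  "poly_eval \<phi> x f =
     (\<Sum>m\<in>Poly_Mapping.keys f.
        \<phi> (Poly_Mapping.lookup f m) *
        (\<Prod>(i, j, k)\<in>UNIV. (x $ i $ j $ k) ^ Poly_Mapping.lookup m (i, j, k)))"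

definition assoc_ideal :: "('k::field, 'n::finite) coord_poly set" where
  "assoc_ideal =
     genideal ring_of_type_algebra {associator generic_tensor i j l m | i j l m. True}"

definition coord_ring :: "('k::field, 'n::finite) coord_poly set ring" where
  "coord_ring = ring_of_type_algebra Quot assoc_ideal"

text \<open>The polynomial $y \mapsto f(g \cdot y)$.\<close>

definition gl_subst :: "'k^'n^'n \<Rightarrow> ('k::field, 'n::finite) coord_poly \<Rightarrow> ('k, 'n) coord_poly" where
  "gl_subst g f =
     poly_eval const_poly
       (transport (\<chi> i j. const_poly (g $ i $ j)) (\<chi> i j. const_poly (matrix_inv g $ i $ j))
          generic_tensor) f"

text \<open>Elements of the coordinate ring are cosets of the associativity ideal; the ideal is stable
  under the group, which therefore acts on cosets by taking images.\<close>

definition invariant_ring :: "('k::field, 'n::finite) coord_poly set ring" where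
  "invariant_ring =
     coord_ring\<lparr>carrier :=
       {Q \<in> carrier coord_ring. \<forall>g. invertible g \<longrightarrow> gl_subst g ` Q = Q}\<rparr>"

definition prime_spectrum :: "'a ring \<Rightarrow> 'a set topology" where
  "prime_spectrum R = topology_generated_by {{P. primeideal P R \<and> f \<notin> P} | f. f \<in> carrier R}"

definition git_quotient :: "('k::field, 'n::finite) coord_poly set set topology" where
  "git_quotient = prime_spectrum invariant_ring"

definition git_point :: "('k::field, 'n::finite) tensor \<Rightarrow> ('k, 'n) coord_poly set set" where
  "git_point x = {Q \<in> carrier invariant_ring. \<forall>f\<in>Q. poly_eval id x f = 0}"


section \<open>The space of isomorphism classes\<close>

text \<open>
  The scalars in $\mathrm{GL}(V)$ contract every product to zero, so the affine quotient above
  does not separate isomorphism classes.  The set of isomorphism classes (orbits) itself carries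
  the quotient of the Zariski topology.
\<close>

definition alg_zariski :: "('k::field, 'n::finite) tensor topology" where
  "alg_zariski = topology_generated_by {{x \<in> alg_points. poly_eval id x f \<noteq> 0} | f. True}"

definition orbit_space :: "('k::field, 'n::finite) tensor set topology" where
  "orbit_space =
     topology (\<lambda>W. W \<subseteq> gl_orbit ` alg_points \<and> openin alg_zariski {x \<in> alg_points. gl_orbit x \<in> W})"

lemma openin_orbit_space:
  fixes W :: "('k::field, 'n::finite) tensor set set"
  shows "openin orbit_space W \<longleftrightarrow>
     W \<subseteq> gl_orbit ` alg_points \<and> openin alg_zariski {x \<in> alg_points. gl_orbit x \<in> W}"
proof -
  have "istopology (\<lambda>W :: ('k, 'n) tensor set set. W \<subseteq> gl_orbit ` alg_points \<and>
          openin alg_zariski {x \<in> alg_points. gl_orbit x \<in> W})"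
    unfolding istopology_def
  proof (intro conjI allI impI)
    fix S T :: "('k, 'n) tensor set set"
    assume S: "S \<subseteq> gl_orbit ` alg_points \<and> openin alg_zariski {x \<in> alg_points. gl_orbit x \<in> S}"
      and T: "T \<subseteq> gl_orbit ` alg_points \<and> openin alg_zariski {x \<in> alg_points. gl_orbit x \<in> T}"
    then show "S \<inter> T \<subseteq> gl_orbit ` alg_points" by blast
    have "{x \<in> alg_points. gl_orbit x \<in> S \<inter> T} =
        {x \<in> alg_points. gl_orbit x \<in> S} \<inter> {x \<in> alg_points. gl_orbit x \<in> T}" by blast
    with S T show "openin alg_zariski {x \<in> alg_points. gl_orbit x \<in> S \<inter> T}"
      by (simp add: openin_Int)
  next
    fix K :: "('k, 'n) tensor set set set"
    assume K: "\<forall>S\<in>K. S \<subseteq> gl_orbit ` alg_points \<and>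
                 openin alg_zariski {x \<in> alg_points. gl_orbit x \<in> S}"
    then show "\<Union>K \<subseteq> gl_orbit ` alg_points" by blast
    have "{x \<in> alg_points. gl_orbit x \<in> \<Union>K} = (\<Union>S\<in>K. {x \<in> alg_points. gl_orbit x \<in> S})" by blast
    with K show "openin alg_zariski {x \<in> alg_points. gl_orbit x \<in> \<Union>K}"
      by auto
  qed
  then show ?thesis
    unfolding orbit_space_def by (simp add: topology_inverse')
qed


section \<open>Isolated points\<close>

text \<open>The point \<open>p\<close> is isolated in each of its open neighbourhoods that meets \<open>S\<close>.\<close>

definition isolated_in_nbhds_meeting :: "'a topology \<Rightarrow> 'a set \<Rightarrow> 'a \<Rightarrow> bool" where
  "isolated_in_nbhds_meeting T S p \<longleftrightarrow>
     p \<in> topspace T \<and>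
     (\<forall>N. openin T N \<and> p \<in> N \<and> N \<inter> S \<noteq> {} \<longrightarrow> openin (subtopology T N) {p})"

end

theory Submission
  imports Defs
begin

text \<open>
  The trace form of a separable algebra is the trace of the regular representation, so its Casimir
  element $\sum e_i \otimes e^i$ is a separability idempotent, and a 2-cocycle $f$ is the coboundary of
  $b \mapsto \sum e_i f(e^i, b)$.  Tangent vectors of $\mathrm{Alg}(V)$ are 2-cocycles and tangent
  vectors of the orbit are coboundaries.

  The scalars act on structure constants by rescaling, so every invariant is constant modulo the
  associativity ideal and the affine quotient is a single point.

  For the orbit space one shows that the orbit of a separable algebra is open.  Such an algebra has
  a basis of matrix units.  The element $\omega = \sum e_i e_j e^i e^j$ acts on the block of
  $d \times d$ matrices by $d^{-2}$, so the traces of the powers of left multiplication by $\omega$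
  are rational functions on the separable locus with denominators powers of the discriminant. They
  take finitely many values and determine the block sizes, hence the orbit.
\<close>

no_notation fps_nth (infixl \<open>$\<close> 75)
hide_const (open) up_ring.coeff up_ring.monom

section \<open>The product of a tensor of structure constants\<close>

text \<open>Neither a unit nor a block structure is given: points of \<open>alg_points\<close> are
  just associative products, so both are extracted from the nondegenerate trace form. The element
  representing the trace functional turns out to be the unit, and algebraic closedness enters
  through an eigenvector argument that reduces each corner fAf of a minimal idempotent to scalars.
  Passing from vanishing tangent spaces to open orbits would require smoothness and dimension
  arguments. Finiteness replaces them: a regular function with finitely many values has open level
  sets, and regularity needs a formula for the invariants that chooses no blocks. This dictates the
  word e_i e_j e^i e^j: the sums of e_i e^i, of e_i e^i e_j e^j and of e_i e_j e^j e^i all give the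
  unit, whereas the interlaced word sees the block size. The numbers d^(-2) are distinct in
  characteristic 0, so a Vandermonde argument recovers the multiplicities from the powers 0 to
  n.\<close>

lemma alg_prod_nth: "alg_prod x a b $ k = (\<Sum>i\<in>UNIV. \<Sum>j\<in>UNIV. a $ i * b $ j * x $ i $ j $ k)"
  by (simp add: alg_prod_def)

lemma alg_prod_add_left: "alg_prod x (a + a') b = alg_prod x a b + alg_prod x a' b"
  by (simp add: vec_eq_iff alg_prod_nth algebra_simps sum.distrib)

lemma alg_prod_add_right: "alg_prod x a (b + b') = alg_prod x a b + alg_prod x a b'"
  by (simp add: vec_eq_iff alg_prod_nth algebra_simps sum.distrib)

lemma alg_prod_diff_left: "alg_prod x (a - a') b = alg_prod x a b - alg_prod x a' b"
  by (simp add: vec_eq_iff alg_prod_nth algebra_simps sum_subtractf)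

lemma alg_prod_diff_right: "alg_prod x a (b - b') = alg_prod x a b - alg_prod x a b'"
  by (simp add: vec_eq_iff alg_prod_nth algebra_simps sum_subtractf)

lemma alg_prod_scale_left: "alg_prod x (c *s a) b = c *s alg_prod x a b"
  by (simp add: vec_eq_iff alg_prod_nth sum_distrib_left mult_ac)

lemma alg_prod_scale_right: "alg_prod x a (c *s b) = c *s alg_prod x a b"
  by (simp add: vec_eq_iff alg_prod_nth sum_distrib_left mult_ac)

lemma alg_prod_zero_left [simp]: "alg_prod x 0 b = 0"
  by (simp add: vec_eq_iff alg_prod_nth)

lemma alg_prod_zero_right [simp]: "alg_prod x a 0 = 0"
  by (simp add: vec_eq_iff alg_prod_nth)

lemma alg_prod_sum_left: "alg_prod x (\<Sum>s\<in>S. f s) b = (\<Sum>s\<in>S. alg_prod x (f s) b)"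
  by (induction S rule: infinite_finite_induct) (simp_all add: alg_prod_add_left)

lemma alg_prod_sum_right: "alg_prod x a (\<Sum>s\<in>S. f s) = (\<Sum>s\<in>S. alg_prod x a (f s))"
  by (induction S rule: infinite_finite_induct) (simp_all add: alg_prod_add_right)

lemma alg_prod_minus: "alg_prod x (- a) b = - alg_prod x a b" "alg_prod x a (- b) = - alg_prod x a b"
  by (simp_all add: vec_eq_iff alg_prod_nth sum_negf)

lemmas alg_prod_bilin = alg_prod_add_left alg_prod_add_right alg_prod_diff_left alg_prod_diff_right
  alg_prod_scale_left alg_prod_scale_right alg_prod_sum_left alg_prod_sum_right

lemma alg_prod_axis [simp]: "alg_prod x (axis i 1) (axis j 1) = x $ i $ j"
proof -
  have "(\<Sum>i'\<in>UNIV. \<Sum>j'\<in>UNIV. axis i (1::'a) $ i' * axis j 1 $ j' * x $ i' $ j' $ k) = x $ i $ j $ k" for k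
  proof -
    have "(\<Sum>i'\<in>UNIV. \<Sum>j'\<in>UNIV. axis i (1::'a) $ i' * axis j 1 $ j' * x $ i' $ j' $ k)
        = (\<Sum>i'\<in>UNIV. \<Sum>j'\<in>UNIV. if j' = j then if i' = i then x $ i' $ j' $ k else 0 else 0)"
      by (intro sum.cong) (auto simp: axis_def)
    then show ?thesis by simp
  qed
  then show ?thesis by (simp add: vec_eq_iff alg_prod_nth)
qed

lemma alg_prod_expand: "alg_prod x a b = (\<Sum>i\<in>UNIV. \<Sum>j\<in>UNIV. (a $ i * b $ j) *s x $ i $ j)"
  by (simp add: vec_eq_iff alg_prod_nth)

lemma vec_scale_sum: "c *s (\<Sum>s\<in>S. f s) = (\<Sum>s\<in>S. c *s (f s :: 'a::comm_ring_1^'n))"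
  by (simp add: vec_eq_iff sum_distrib_left)

text \<open>Trilinearity over any commutative ring. Besides giving associativity on all vectors, the
  explicit coefficients later show that over the polynomial ring every such difference lies in the
  ideal generated by the basis associators.\<close>

lemma associator_alg_prod:
  "alg_prod x (alg_prod x a b) c - alg_prod x a (alg_prod x b c) =
    (\<Sum>i\<in>UNIV. \<Sum>j\<in>UNIV. \<Sum>l\<in>UNIV. (a $ i * b $ j * c $ l) *s (\<chi> m. associator x i j l m))"
proof -
  have a: "a = (\<Sum>i\<in>UNIV. a $ i *s axis i 1)" and c: "c = (\<Sum>i\<in>UNIV. c $ i *s axis i 1)"
    by (simp_all add: basis_expansion)
  have 1: "alg_prod x (alg_prod x a b) c =
    (\<Sum>i\<in>UNIV. \<Sum>j\<in>UNIV. \<Sum>l\<in>UNIV. (a $ i * b $ j * c $ l) *s alg_prod x (x $ i $ j) (axis l 1))"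
    unfolding alg_prod_expand[of x a b]
    apply (subst c)
    apply (simp only: alg_prod_scale_left alg_prod_sum_left)
    apply (simp only: alg_prod_scale_right alg_prod_sum_right vec_scale_sum vector_smult_assoc)
    done
  have "alg_prod x a (alg_prod x b c) =
    (\<Sum>i\<in>UNIV. \<Sum>j\<in>UNIV. \<Sum>l\<in>UNIV. (a $ i * b $ j * c $ l) *s alg_prod x (axis i 1) (x $ j $ l))"
    unfolding alg_prod_expand[of x b c]
    apply (subst a)
    apply (simp only: alg_prod_scale_left alg_prod_sum_left)
    apply (simp only: alg_prod_scale_right alg_prod_sum_right vec_scale_sum vector_smult_assoc mult.assoc)
    done
  then show ?thesis unfolding 1 sum_subtractf[symmetric] associator_def
    by (simp add: vec_eq_iff sum_subtractf[symmetric] right_diff_distrib)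
qed

lemma associator_nth:
  "associator x i j l m =
    (\<Sum>p\<in>UNIV. x $ i $ j $ p * x $ p $ l $ m) - (\<Sum>p\<in>UNIV. x $ j $ l $ p * x $ i $ p $ m)"
proof -
  have "(\<Sum>p\<in>UNIV. \<Sum>q\<in>UNIV. x $ i $ j $ p * axis l 1 $ q * x $ p $ q $ m) =
        (\<Sum>p\<in>UNIV. x $ i $ j $ p * x $ p $ l $ m)"
    by (simp add: axis_def if_distrib[of "\<lambda>u. _ * u"] if_distrib[of "\<lambda>u. u * _"] cong: if_cong)
  moreover have "(\<Sum>p\<in>UNIV. \<Sum>q\<in>UNIV. axis i 1 $ p * x $ j $ l $ q * x $ p $ q $ m) =
        (\<Sum>q\<in>UNIV. x $ j $ l $ q * x $ i $ q $ m)"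
    by (subst sum.swap) (simp add: axis_def if_distrib[of "\<lambda>u. _ * u"] if_distrib[of "\<lambda>u. u * _"] cong: if_cong)
  ultimately show ?thesis
    by (simp add: associator_def alg_prod_nth)
qed

lemma alg_points_iff_assoc:
  "x \<in> alg_points \<longleftrightarrow> (\<forall>a b c. alg_prod x (alg_prod x a b) c = alg_prod x a (alg_prod x b c))"
proof
  assume "x \<in> alg_points"
  then have "associator x i j l m = 0" for i j l m by (simp add: alg_points_def)
  then have "alg_prod x (alg_prod x a b) c - alg_prod x a (alg_prod x b c) = 0" for a b c
    by (simp add: associator_alg_prod vec_eq_iff)
  then show "\<forall>a b c. alg_prod x (alg_prod x a b) c = alg_prod x a (alg_prod x b c)" by simp
qed (simp add: alg_points_def associator_def del: alg_prod_axis)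

lemma linear_alg_prod_left: "Vector_Spaces.linear (*s) (*s) (alg_prod (x :: ('k::field, 'n::finite) tensor) a)"
  by unfold_locales (simp_all add: alg_prod_bilin)

lemma linear_alg_prod_right: "Vector_Spaces.linear (*s) (*s) (\<lambda>a. alg_prod (x :: ('k::field, 'n::finite) tensor) a b)"
  by unfold_locales (simp_all add: alg_prod_bilin)

lemma left_mult_mult: "left_mult x z *v a = alg_prod x z a"
  unfolding left_mult_def by (rule matrix_works[OF linear_alg_prod_left])

section \<open>The Casimir element of a separable algebra\<close>

lemma matrix_inv_mult:
  assumes "invertible A" shows "matrix_inv A ** A = mat 1" "A ** matrix_inv A = mat 1"
proof -
  have "A ** matrix_inv A = mat 1 \<and> matrix_inv A ** A = mat 1"
    unfolding matrix_inv_def by (rule someI_ex) (rule assms[unfolded invertible_def])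
  then show "matrix_inv A ** A = mat 1" "A ** matrix_inv A = mat 1" by (rule conjunct2, rule conjunct1)
qed

lemma bilinear_sum_left:
  fixes B :: "'k::field^'n \<Rightarrow> 'k^'n \<Rightarrow> 'k^'n"
  assumes "is_bilinear B" shows "B (\<Sum>s\<in>S. c s *s f s) b = (\<Sum>s\<in>S. c s *s B (f s) b)"
proof -
  have lin: "Vector_Spaces.linear (*s) (*s) (\<lambda>a. B a b)"
    using assms unfolding is_bilinear_def is_linear_def by blast
  have "B (\<Sum>s\<in>S. c s *s f s) b = (\<Sum>s\<in>S. B (c s *s f s) b)"
    using vec.linear_sum[OF lin, of "\<lambda>s. c s *s f s" S] .
  also have "\<dots> = (\<Sum>s\<in>S. c s *s B (f s) b)" 
  proof (rule sum.cong[OF refl])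
    fix s show "B (c s *s f s) b = c s *s B (f s) b"  using vec.linear_scale[OF lin, of "c s" "f s"] .
  qed
  finally show ?thesis .
qed

lemma bilinear_sum_right:
  fixes B :: "'k::field^'n \<Rightarrow> 'k^'n \<Rightarrow> 'k^'n"
  assumes "is_bilinear B" shows "B a (\<Sum>s\<in>S. c s *s f s) = (\<Sum>s\<in>S. c s *s B a (f s))"
proof -
  have lin: "Vector_Spaces.linear (*s) (*s) (B a)"
    using assms unfolding is_bilinear_def is_linear_def by blast
  show ?thesis using vec.linear_sum[OF lin, of "\<lambda>s. c s *s f s" S] vec.linear_scale[OF lin] by simp
qed

locale separable_algebra =
  fixes x :: "('k::field, 'n::finite) tensor"
  assumes separable: "x \<in> separable_locus"
begin

abbreviation mult_x (infixl \<open>\<star>\<close> 70) where "a \<star> b \<equiv> alg_prod x a b"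

definition tr :: "'k^'n \<Rightarrow> 'k" where "tr a = trace (left_mult x a)"

definition trace_form :: "'k^'n^'n" where
  "trace_form = (\<chi> i j. tr (axis i 1 \<star> axis j 1))"

text \<open>The vector e^j of the overview: column j of the inverse Gram matrix of the trace form,
  hence rational in the structure constants with the discriminant as denominator.\<close>

definition dual :: "'n \<Rightarrow> 'k^'n" where "dual j = matrix_inv trace_form *v axis j 1"

lemma assoc: "a \<star> b \<star> c = a \<star> (b \<star> c)"
  using separable by (simp add: separable_locus_def alg_points_iff_assoc)

lemma left_mult_prod: "left_mult x (a \<star> b) = left_mult x a ** left_mult x b"
  by (simp add: matrix_eq left_mult_mult assoc flip: matrix_vector_mul_assoc)

lemma tr_commute: "tr (a \<star> b) = tr (b \<star> a)"
  unfolding tr_def left_mult_prod by (rule trace_mul_sym)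

lemma tr_eq: "tr a = (\<Sum>i\<in>UNIV. (a \<star> axis i 1) $ i)"
  by (simp add: tr_def trace_def left_mult_def matrix_def)

lemma tr_add: "tr (a + b) = tr a + tr b"
  by (simp add: tr_eq alg_prod_bilin sum.distrib)

lemma tr_diff: "tr (a - b) = tr a - tr b"
  by (simp add: tr_eq alg_prod_bilin sum_subtractf)

lemma tr_scale: "tr (c *s a) = c * tr a"
  by (simp add: tr_eq alg_prod_bilin sum_distrib_left)

lemma tr_zero [simp]: "tr 0 = 0"
  by (simp add: tr_eq)

lemma tr_sum: "tr (\<Sum>s\<in>S. f s) = (\<Sum>s\<in>S. tr (f s))"
  by (induction S rule: infinite_finite_induct) (simp_all add: tr_add)

lemma det_trace_form: "det trace_form \<noteq> 0"
  using separable by (simp add: separable_locus_def discriminant_def trace_form_def tr_def)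

lemma trace_form_inverse:
  "matrix_inv trace_form ** trace_form = mat 1" "trace_form ** matrix_inv trace_form = mat 1"
  by (rule matrix_inv_mult, unfold invertible_det_nz, rule det_trace_form)+

lemma trace_form_mult: "trace_form *v a = (\<chi> i. tr (axis i 1 \<star> a))"
proof -
  have a: "a = (\<Sum>j\<in>UNIV. a $ j *s axis j 1)" by (simp add: basis_expansion)
  have "tr (axis i 1 \<star> a) = (trace_form *v a) $ i" for i
    by (subst a) (simp add: alg_prod_bilin tr_sum tr_scale trace_form_def matrix_vector_mult_def mult.commute)
  then show ?thesis by (simp add: vec_eq_iff)
qed

lemma trace_form_nondegenerate:
  assumes "\<And>b. tr (a \<star> b) = 0" shows "a = 0"
proof -
  have "trace_form *v a = 0"
    using assms by (simp add: trace_form_mult vec_eq_iff tr_commute[of _ a])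
  then have "matrix_inv trace_form *v (trace_form *v a) = 0" by simp
  then show ?thesis by (simp add: matrix_vector_mul_assoc trace_form_inverse)
qed

lemma eq_if_tr_eq:
  assumes "\<And>b. tr (a \<star> b) = tr (a' \<star> b)" shows "a = a'"
  using trace_form_nondegenerate[of "a - a'"] assms by (simp add: alg_prod_bilin tr_diff)

text \<open>A nondegenerate form represents every functional; applied to the trace itself it yields
  the candidate for the unit, whose existence is not part of \<open>alg_points\<close>.\<close>

lemma tr_represented: "\<exists>u. \<forall>b. tr (u \<star> b) = tr b"
proof
  define u where "u = matrix_inv trace_form *v (\<chi> i. tr (axis i 1))"
  show "\<forall>b. tr (u \<star> b) = tr b"
  proof
    fix b :: "'k^'n"
    have b: "b = (\<Sum>j\<in>UNIV. b $ j *s axis j 1)" by (simp add: basis_expansion)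
    have "trace_form *v u = (\<chi> i. tr (axis i 1))"
      by (simp add: u_def matrix_vector_mul_assoc trace_form_inverse)
    then have "tr (u \<star> axis i 1) = tr (axis i 1)" for i
      by (simp add: trace_form_mult vec_eq_iff tr_commute[of u])
    then show "tr (u \<star> b) = tr b"
      by (subst (1 2) b) (simp add: alg_prod_bilin tr_sum tr_scale)
  qed
qed

text \<open>Associativity turns tr(uab) into tr(ab), and testing against all b gives ua = a. For au,
  cyclicity of the trace first moves u to the front.\<close>

lemma ex_unit: "\<exists>u. (\<forall>a. u \<star> a = a) \<and> (\<forall>a. a \<star> u = a)"
proof -
  obtain u where u: "tr (u \<star> b) = tr b" for b using tr_represented by blast
  have "u \<star> a = a" for a
    by (rule eq_if_tr_eq) (simp add: assoc u)
  moreover have "a \<star> u = a" for a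
  proof (rule eq_if_tr_eq)
    fix b
    have "tr (a \<star> u \<star> b) = tr (u \<star> (b \<star> a))" by (metis assoc tr_commute)
    then show "tr (a \<star> u \<star> b) = tr (a \<star> b)" by (simp add: u tr_commute)
  qed
  ultimately show ?thesis by blast
qed

definition unit :: "'k^'n" where "unit = (SOME u. (\<forall>a. u \<star> a = a) \<and> (\<forall>a. a \<star> u = a))"

lemma unit_mult [simp]: "unit \<star> a = a" "a \<star> unit = a"
  using someI_ex[OF ex_unit] by (simp_all add: unit_def)

lemma tr_axis_dual: "tr (axis i 1 \<star> dual j) = (if i = j then 1 else 0)"
proof -
  have "trace_form *v dual j = axis j 1"
    by (simp add: dual_def matrix_vector_mul_assoc trace_form_inverse)
  then have "tr (axis i 1 \<star> dual j) = axis j 1 $ i" by (simp add: trace_form_mult vec_eq_iff)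
  then show ?thesis by (simp add: axis_def)
qed

lemma tr_dual: "tr (a \<star> dual j) = a $ j"
proof -
  have a: "a = (\<Sum>j\<in>UNIV. a $ j *s axis j 1)" by (simp add: basis_expansion)
  show ?thesis
    by (subst a)
      (simp add: alg_prod_bilin tr_sum tr_scale tr_axis_dual if_distrib[of "\<lambda>u. _ * u"] cong: if_cong)
qed

lemma dual_expansion: "(\<Sum>i\<in>UNIV. tr (a \<star> axis i 1) *s dual i) = a"
proof (rule eq_if_tr_eq)
  fix b :: "'k^'n"
  have b: "b = (\<Sum>j\<in>UNIV. b $ j *s axis j 1)" by (simp add: basis_expansion)
  have "tr ((\<Sum>i\<in>UNIV. tr (a \<star> axis i 1) *s dual i) \<star> b) = (\<Sum>i\<in>UNIV. tr (a \<star> axis i 1) * b $ i)"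
    by (simp add: alg_prod_bilin tr_sum tr_scale tr_commute[of _ b] tr_dual)
  also have "\<dots> = tr (a \<star> b)"
    by (subst (2) b) (simp add: alg_prod_bilin tr_sum tr_scale mult.commute)
  finally show "tr ((\<Sum>i\<in>UNIV. tr (a \<star> axis i 1) *s dual i) \<star> b) = tr (a \<star> b)" .
qed

text \<open>The Casimir tensor is central in the bimodule A \<otimes> A; an arbitrary bilinear
  \<open>B\<close> stands in for the tensor product. Both sides expand with the same coefficients
  tr(a e_i e^l), read once as coordinates of a e_i and once as coordinates of e^l a in the dual
  basis.\<close>

lemma casimir_commute:
  assumes B: "is_bilinear B"
  shows "(\<Sum>i\<in>UNIV. B (a \<star> axis i 1) (dual i)) = (\<Sum>i\<in>UNIV. B (axis i 1) (dual i \<star> a))"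
proof -
  have 1: "a \<star> axis i 1 = (\<Sum>l\<in>UNIV. tr (a \<star> axis i 1 \<star> dual l) *s axis l 1)" for i
    by (simp add: tr_dual basis_expansion)
  have 2: "dual l \<star> a = (\<Sum>i\<in>UNIV. tr (a \<star> axis i 1 \<star> dual l) *s dual i)" for l
    using dual_expansion[of "dual l \<star> a"] by (simp add: assoc tr_commute[of "dual l"])
  have "(\<Sum>i\<in>UNIV. B (a \<star> axis i 1) (dual i)) =
      (\<Sum>i\<in>UNIV. \<Sum>l\<in>UNIV. tr (a \<star> axis i 1 \<star> dual l) *s B (axis l 1) (dual i))"
    by (subst 1) (simp add: bilinear_sum_left[OF B])
  also have "\<dots> = (\<Sum>l\<in>UNIV. \<Sum>i\<in>UNIV. tr (a \<star> axis i 1 \<star> dual l) *s B (axis l 1) (dual i))"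
    by (rule sum.swap)
  also have "\<dots> = (\<Sum>i\<in>UNIV. B (axis i 1) (dual i \<star> a))"
    by (subst 2) (simp add: bilinear_sum_right[OF B])
  finally show ?thesis .
qed

text \<open>The Casimir tensor does not depend on the basis. Only the reconstruction formula ties
  \<open>u'\<close> to \<open>u\<close>, so matrix units and their rescaled transposes can be
  inserted directly.\<close>

lemma casimir_change_basis:
  assumes B: "is_bilinear B" and u: "\<And>a. a = (\<Sum>s\<in>S. tr (a \<star> u' s) *s u s)"
  shows "(\<Sum>i\<in>UNIV. B (axis i 1) (dual i)) = (\<Sum>s\<in>S. B (u s) (u' s))"
proof -
  have "(\<Sum>i\<in>UNIV. B (axis i 1) (dual i)) =
      (\<Sum>i\<in>UNIV. \<Sum>s\<in>S. tr (axis i 1 \<star> u' s) *s B (u s) (dual i))"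
  proof (rule sum.cong[OF refl])
    fix i :: 'n
    show "B (axis i 1) (dual i) = (\<Sum>s\<in>S. tr (axis i 1 \<star> u' s) *s B (u s) (dual i))"
      by (subst u[of "axis i 1"]) (rule bilinear_sum_left[OF B])
  qed
  also have "\<dots> = (\<Sum>s\<in>S. \<Sum>i\<in>UNIV. tr (u' s \<star> axis i 1) *s B (u s) (dual i))"
    by (subst sum.swap) (simp add: tr_commute)
  also have "\<dots> = (\<Sum>s\<in>S. B (u s) (u' s))"
    by (simp add: dual_expansion flip: bilinear_sum_right[OF B])
  finally show ?thesis .
qed

text \<open>The trace form is the trace of the regular representation, so its Casimir element is
  already the separability idempotent.\<close>

lemma casimir_unit: "(\<Sum>i\<in>UNIV. axis i 1 \<star> dual i) = unit"
proof (rule eq_if_tr_eq)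
  fix a
  have "tr ((\<Sum>i\<in>UNIV. axis i 1 \<star> dual i) \<star> a) = (\<Sum>i\<in>UNIV. tr (a \<star> axis i 1 \<star> dual i))"
    by (simp add: alg_prod_bilin tr_sum assoc tr_commute[of _ a])
      (simp add: tr_commute[of a] assoc)
  then show "tr ((\<Sum>i\<in>UNIV. axis i 1 \<star> dual i) \<star> a) = tr (unit \<star> a)"
    by (simp add: tr_dual flip: tr_eq)
qed

text \<open>The separability idempotent acts as a contracting homotopy: multiply the cocycle
  identity at (e^i, b, c) by e_i and sum over i. The term e_i e^i f(b, c) sums to f(b, c), and the
  other three form the coboundary.\<close>

lemma hochschild_cocycle_imp_coboundary:
  assumes f: "is_bilinear f" and d: "hochschild_d2 (alg_prod x) f = (\<lambda>a b c. 0)"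
  shows "\<exists>g. is_linear g \<and> f = hochschild_d1 (alg_prod x) g"
proof (intro exI conjI)
  define g where "g b = (\<Sum>i\<in>UNIV. axis i 1 \<star> f (dual i) b)" for b
  have lf: "Vector_Spaces.linear (*s) (*s) (f a)" "Vector_Spaces.linear (*s) (*s) (\<lambda>a. f a b)" for a b
    using f by (simp_all add: is_bilinear_def is_linear_def)
  note lin = vec.linear_add[OF lf(1)] vec.linear_add[OF lf(2)] vec.linear_scale[OF lf(1)] vec.linear_scale[OF lf(2)]
  show "is_linear g"
    unfolding is_linear_def g_def
    by unfold_locales (simp_all add: lin alg_prod_bilin sum.distrib vec_scale_sum)
  have coc: "a \<star> f b c - f (a \<star> b) c + f a (b \<star> c) - f a b \<star> c = 0" for a b c
    using d by (simp add: hochschild_d2_def fun_eq_iff)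
  show "f = hochschild_d1 (alg_prod x) g"
  proof (intro ext)
    fix b c
    \<comment> \<open>Centrality of the Casimir tensor moves \<open>b\<close> from in front of e_i
      to behind e^i, inside the first argument of \<open>f\<close>.\<close>
    have "is_bilinear (\<lambda>u v. u \<star> f v c)"
      unfolding is_bilinear_def is_linear_def
      by (intro conjI allI; unfold_locales) (simp_all add: lin alg_prod_bilin)
    from casimir_commute[OF this, of b]
    have 1: "b \<star> g c = (\<Sum>i\<in>UNIV. axis i 1 \<star> f (dual i \<star> b) c)"
      by (simp add: g_def alg_prod_bilin assoc)
    have "hochschild_d1 (alg_prod x) g b c =
      (\<Sum>i\<in>UNIV. axis i 1 \<star> (f (dual i \<star> b) c - f (dual i) (b \<star> c) + f (dual i) b \<star> c))"
      by (simp add: hochschild_d1_def 1) (simp add: g_def alg_prod_bilin sum.distrib sum_subtractf assoc)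
    also have "\<dots> = (\<Sum>i\<in>UNIV. axis i 1 \<star> (dual i \<star> f b c))"
    proof (rule sum.cong[OF refl])
      fix i :: 'n
      have "f (dual i \<star> b) c - f (dual i) (b \<star> c) + f (dual i) b \<star> c = dual i \<star> f b c"
        using coc[of "dual i" b c] by (simp add: algebra_simps)
      then show "axis i 1 \<star> (f (dual i \<star> b) c - f (dual i) (b \<star> c) + f (dual i) b \<star> c) = axis i 1 \<star> (dual i \<star> f b c)"
        by simp
    qed
    also have "\<dots> = (\<Sum>i\<in>UNIV. axis i 1 \<star> dual i) \<star> f b c"
      by (simp add: alg_prod_bilin assoc)
    also have "\<dots> = f b c" by (simp add: casimir_unit)
    finally show "f b c = hochschild_d1 (alg_prod x) g b c" ..
  qed
qed

end

section \<open>First-order deformations and Hochschild cocycles\<close>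

lemma sq_dvd_iff: "[:0, 1:]^2 dvd p \<longleftrightarrow> coeff p 0 = 0 \<and> coeff p 1 = (0::'a::field)"
proof -
  have "[:0, 1:]^2 = monom (1::'a) 2" by (simp add: monom_altdef)
  moreover have "(\<forall>k<2. coeff p k = 0) \<longleftrightarrow> coeff p 0 = 0 \<and> coeff p 1 = 0"
    by (auto simp: numeral_2_eq_2 less_Suc_eq)
  ultimately show ?thesis by (simp add: monom_1_dvd_iff')
qed

lemma alg_prod_add_tensor: "alg_prod (x + y) a b = alg_prod x a b + alg_prod y a b"
  by (simp add: vec_eq_iff alg_prod_nth algebra_simps sum.distrib)

lemma alg_prod_scale_tensor: "alg_prod (\<chi> i j. c *s x $ i $ j) a b = c *s alg_prod x a b"
  by (simp add: vec_eq_iff alg_prod_nth sum_distrib_left mult_ac)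

lemma alg_prod_zero_tensor: "alg_prod 0 a b = 0"
  by (simp add: vec_eq_iff alg_prod_nth)

lemma is_bilinear_alg_prod: "is_bilinear (alg_prod x)"
  by (simp add: is_bilinear_def is_linear_def linear_alg_prod_left linear_alg_prod_right)

lemma bilinear_eq_alg_prod:
  fixes f :: "'a::field^'b \<Rightarrow> 'a^'b \<Rightarrow> 'a^'b"
  assumes f: "is_bilinear f" shows "alg_prod (\<chi> i j. f (axis i 1) (axis j 1)) = f"
proof (intro ext)
  fix a b :: "'a^'b"
  have a: "a = (\<Sum>i\<in>UNIV. a $ i *s axis i 1)" and b: "b = (\<Sum>i\<in>UNIV. b $ i *s axis i 1)"
    by (simp_all add: basis_expansion)
  have "f a b = (\<Sum>i\<in>UNIV. a $ i *s f (axis i 1) b)"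
    by (subst a) (rule bilinear_sum_left[OF f])
  also have "\<dots> = (\<Sum>i\<in>UNIV. a $ i *s (\<Sum>j\<in>UNIV. b $ j *s f (axis i 1) (axis j 1)))"
    by (subst b) (simp only: bilinear_sum_right[OF f])
  finally show "alg_prod (\<chi> i j. f (axis i 1) (axis j 1)) a b = f a b"
    by (simp add: alg_prod_expand vec_scale_sum)
qed

text \<open>The associator is quadratic in the tensor, so its coefficient of t along x + t\<xi> is
  the polarization. Written with three associators, it is accessible to the trilinear
  expansion.\<close>

lemma associator_deform_coeff:
  fixes x :: "('k::field, 'n::finite) tensor"
  shows "coeff (associator (deform x \<xi>) i j l m) 0 = associator x i j l m"
    and "coeff (associator (deform x \<xi>) i j l m) 1 =
      associator (x + \<xi>) i j l m - associator x i j l m - associator \<xi> i j l m"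
  by (simp_all add: associator_nth deform_def coeff_sum coeff_mult_0
      sum.distrib sum_subtractf algebra_simps)

text \<open>The minus sign arises because the associator is (ab)c - a(bc), while the Hochschild
  differential begins with +a f(b, c).\<close>

lemma hochschild_d2_alg_prod:
  fixes x :: "('k::field, 'n::finite) tensor"
  shows "hochschild_d2 (alg_prod x) (alg_prod \<xi>) a b c =
    (\<Sum>i\<in>UNIV. \<Sum>j\<in>UNIV. \<Sum>l\<in>UNIV. (a $ i * b $ j * c $ l) *s
      (\<chi> m. - coeff (associator (deform x \<xi>) i j l m) 1))"
proof -
  let ?A = "\<lambda>y. alg_prod y (alg_prod y a b) c - alg_prod y a (alg_prod y b c)"
  have "hochschild_d2 (alg_prod x) (alg_prod \<xi>) a b c = ?A x + ?A \<xi> - ?A (x + \<xi>)"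
    by (simp add: hochschild_d2_def alg_prod_add_tensor alg_prod_bilin algebra_simps)
  then show ?thesis
    unfolding associator_alg_prod associator_deform_coeff
    by (simp add: vec_eq_iff algebra_simps flip: sum.distrib sum_subtractf)
qed

lemma alg_tangent_iff_cocycle:
  assumes x: "x \<in> alg_points"
  shows "\<xi> \<in> alg_tangent x \<longleftrightarrow> hochschild_d2 (alg_prod x) (alg_prod \<xi>) = (\<lambda>a b c. 0)"
proof -
  \<comment> \<open>Associativity of \<open>x\<close> kills the constant coefficient, so
    divisibility by t^2 is a condition on the linear one.\<close>
  have t: "\<xi> \<in> alg_tangent x \<longleftrightarrow> (\<forall>i j l m. coeff (associator (deform x \<xi>) i j l m) 1 = 0)"
    using x unfolding alg_tangent_def sq_dvd_iff associator_deform_coeff(1) alg_points_def by simp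
  show ?thesis
  proof
    assume "\<xi> \<in> alg_tangent x"
    then show "hochschild_d2 (alg_prod x) (alg_prod \<xi>) = (\<lambda>a b c. 0)"
      unfolding t by (simp add: fun_eq_iff hochschild_d2_alg_prod vec_eq_iff)
  next
    assume d: "hochschild_d2 (alg_prod x) (alg_prod \<xi>) = (\<lambda>a b c. 0)"
    have "coeff (associator (deform x \<xi>) i j l m) 1 = 0" for i j l m
    proof -
      have "hochschild_d2 (alg_prod x) (alg_prod \<xi>) (axis i 1) (axis j 1) (axis l 1) $ m =
          - coeff (associator (deform x \<xi>) i j l m) 1"
        unfolding hochschild_d2_def associator_deform_coeff
        unfolding associator_def
        by (simp add: alg_prod_add_tensor alg_prod_bilin del: alg_prod_axis)
      with d show ?thesis by simp
    qed
    then show "\<xi> \<in> alg_tangent x" unfolding t by simp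
  qed
qed

section \<open>The derivative of the group action\<close>

lemma transport_nth:
  "transport g h x $ i $ j $ k =
    (\<Sum>p\<in>UNIV. g $ k $ p * (\<Sum>q\<in>UNIV. \<Sum>r\<in>UNIV. h $ q $ i * h $ r $ j * x $ q $ r $ p))"
  by (simp add: transport_def matrix_vector_mult_def alg_prod_nth axis_def
      if_distrib[of "\<lambda>u. _ * u"] cong: if_cong)

lemma alg_prod_axis_left: "alg_prod x (axis i 1) b $ k = (\<Sum>r\<in>UNIV. b $ r * x $ i $ r $ k)"
  by (simp add: alg_prod_nth axis_def if_distrib[of "\<lambda>u. u * _"] cong: if_cong)
    (subst sum.swap, simp)

lemma alg_prod_axis_right: "alg_prod x a (axis j 1) $ k = (\<Sum>q\<in>UNIV. a $ q * x $ q $ j $ k)"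
  by (simp add: alg_prod_nth axis_def if_distrib[of "\<lambda>u. _ * u"] if_distrib[of "\<lambda>u. u * _"] cong: if_cong)

text \<open>Along 1 + tD the product ab changes to first order by D(ab) - (Da)b - a(Db), which is
  minus the Hochschild coboundary of D.\<close>

lemma deform_transport_coeff:
  fixes x :: "('k::field, 'n::finite) tensor" and D :: "'k^'n^'n"
  defines "y \<equiv> transport (deform_matrix D) (deform_matrix (- D)) (deform x 0)"
  shows "coeff (y $ i $ j $ k) 0 = x $ i $ j $ k"
    and "coeff (y $ i $ j $ k) 1 = - hochschild_d1 (alg_prod x) ((*v) D) (axis i 1) (axis j 1) $ k"
proof -
  have sum_if: "(\<Sum>r\<in>S. if P then f r else 0) = (if P then \<Sum>r\<in>S. f r else 0)"
    for S :: "'n set" and P and f :: "'n \<Rightarrow> 'k" by simp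
  \<comment> \<open>\<open>s p\<close> is coordinate p of the product of (1 - tD)e_i and (1 -
    tD)e_j, before 1 + tD is applied.\<close>
  define s where "s p = (\<Sum>q\<in>UNIV. \<Sum>r\<in>UNIV.
      deform_matrix (- D) $ q $ i * deform_matrix (- D) $ r $ j * deform x 0 $ q $ r $ p)" for p
  have s0: "coeff (s p) 0 = x $ i $ j $ p" for p
    by (simp add: s_def deform_matrix_def deform_def coeff_sum coeff_mult_0 mat_def
        mult_delta_left mult_delta_right sum_if)
  have s1: "coeff (s p) (Suc 0) = - (\<Sum>r\<in>UNIV. D $ r $ j * x $ i $ r $ p) - (\<Sum>q\<in>UNIV. D $ q $ i * x $ q $ j $ p)" for p
  proof -
    have "coeff (s p) (Suc 0) = (\<Sum>q\<in>UNIV. \<Sum>r\<in>UNIV.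
        (if q = i then - D $ r $ j * x $ q $ r $ p else 0) + (if r = j then - D $ q $ i * x $ q $ r $ p else 0))"
      unfolding s_def deform_matrix_def deform_def coeff_sum
      by (intro sum.cong refl) (auto simp: coeff_mult_0 mat_def algebra_simps)
    then show ?thesis by (simp add: sum.distrib sum_subtractf sum_if sum_negf)
  qed
  have y: "y $ i $ j $ k = (\<Sum>p\<in>UNIV. deform_matrix D $ k $ p * s p)"
    by (simp add: y_def transport_nth s_def)
  show "coeff (y $ i $ j $ k) 0 = x $ i $ j $ k"
    by (simp add: y coeff_sum coeff_mult_0 s0 deform_matrix_def mat_def mult_delta_left)
  have "coeff (y $ i $ j $ k) 1 = (\<Sum>p\<in>UNIV. D $ k $ p * x $ i $ j $ p) + coeff (s k) (Suc 0)"
    by (simp add: y coeff_sum s0 deform_matrix_def mat_def mult_delta_left sum.distrib)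
  also have "\<dots> = - hochschild_d1 (alg_prod x) ((*v) D) (axis i 1) (axis j 1) $ k"
    unfolding hochschild_d1_def vector_add_component vector_minus_component alg_prod_axis
      alg_prod_axis_left alg_prod_axis_right s1
    by (simp add: matrix_vector_mult_def axis_def mult_delta_right
        if_distrib[of "\<lambda>u. _ * u"] cong: if_cong)
  finally show "coeff (y $ i $ j $ k) 1 = - hochschild_d1 (alg_prod x) ((*v) D) (axis i 1) (axis j 1) $ k" .
qed

lemma minus_matrix_vector_mult: "(- A) *v a = - (A *v (a :: 'a::ring_1^'n))"
  by (simp add: vec_eq_iff matrix_vector_mult_def sum_negf)

lemma is_bilinear_hochschild_d1:
  assumes "is_linear f" shows "is_bilinear (hochschild_d1 (alg_prod x) f)"
proof -
  have lf: "Vector_Spaces.linear (*s) (*s) f" using assms by (simp add: is_linear_def)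
  show ?thesis
    unfolding is_bilinear_def is_linear_def hochschild_d1_def
    by (intro conjI allI; unfold_locales)
      (simp_all add: vec.linear_add[OF lf] vec.linear_scale[OF lf] alg_prod_bilin vec_eq_iff algebra_simps)
qed

lemma orbit_tangent_iff_coboundary:
  "\<xi> \<in> orbit_tangent x \<longleftrightarrow> (\<exists>f. is_linear f \<and> alg_prod \<xi> = hochschild_d1 (alg_prod x) f)"
proof
  assume "\<xi> \<in> orbit_tangent x"
  then obtain D where D: "[:0, 1:]^2 dvd
        (transport (deform_matrix D) (deform_matrix (- D)) (deform x 0) - deform x \<xi>) $ i $ j $ k" for i j k
    unfolding orbit_tangent_def by blast
  \<comment> \<open>By the sign of the derivative, it is -D rather than D whose coboundary is
    \<xi>.\<close>
  have lin: "is_linear ((*v) (- D))" by (simp add: is_linear_def)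
  have "\<xi> $ i $ j $ k = hochschild_d1 (alg_prod x) ((*v) (- D)) (axis i 1) (axis j 1) $ k" for i j k
    using D[of i j k] deform_transport_coeff(2)[of D x i j k]
    by (simp add: sq_dvd_iff deform_def hochschild_d1_def minus_matrix_vector_mult alg_prod_minus)
  then have "\<xi> = (\<chi> i j. hochschild_d1 (alg_prod x) ((*v) (- D)) (axis i 1) (axis j 1))"
    by (simp add: vec_eq_iff)
  then have "alg_prod \<xi> = hochschild_d1 (alg_prod x) ((*v) (- D))"
    using bilinear_eq_alg_prod[OF is_bilinear_hochschild_d1[OF lin, of x]] by simp
  with lin show "\<exists>f. is_linear f \<and> alg_prod \<xi> = hochschild_d1 (alg_prod x) f" by blast
next
  assume "\<exists>f. is_linear f \<and> alg_prod \<xi> = hochschild_d1 (alg_prod x) f"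
  then obtain f where f: "is_linear f" "alg_prod \<xi> = hochschild_d1 (alg_prod x) f" by blast
  define D where "D = matrix (\<lambda>a. - f a)"
  have lin: "Vector_Spaces.linear (*s) (*s) (\<lambda>a. - f a)"
    using f(1) unfolding is_linear_def by (rule vec.linear_compose_neg)
  have D: "D *v a = - f a" for a unfolding D_def by (rule matrix_works[OF lin])
  have "\<xi> $ i $ j = hochschild_d1 (alg_prod x) f (axis i 1) (axis j 1)" for i j
    using f(2) by (metis alg_prod_axis)
  then have "[:0, 1:]^2 dvd
        (transport (deform_matrix D) (deform_matrix (- D)) (deform x 0) - deform x \<xi>) $ i $ j $ k" for i j k
    using deform_transport_coeff[of D x i j k]
    by (simp add: sq_dvd_iff deform_def hochschild_d1_def D alg_prod_minus)
  then show "\<xi> \<in> orbit_tangent x" unfolding orbit_tangent_def by blast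
qed

text \<open>Modulo the whole space there is one coset. Both the deformation quotient and the
  cohomology quotient collapse in this way; invariance under translations and closure under scalars
  make sums and multiples of that coset equal to it.\<close>

lemma quotient_space_self:
  assumes ne: "carrier M \<noteq> {}"
    and t: "\<And>u. u \<in> carrier M \<Longrightarrow> (\<lambda>h. h \<oplus>\<^bsub>M\<^esub> u) ` carrier M = carrier M"
    and s: "\<And>c u. u \<in> carrier M \<Longrightarrow> c \<odot>\<^bsub>M\<^esub> u \<in> carrier M"
  shows "carrier (quotient_space M (carrier M)) = {carrier M}"
    "zero (quotient_space M (carrier M)) = carrier M"
    "carrier M \<oplus>\<^bsub>quotient_space M (carrier M)\<^esub> carrier M = carrier M"
    "c \<odot>\<^bsub>quotient_space M (carrier M)\<^esub> carrier M = carrier M"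
proof -
  have c: "carrier M +>\<^bsub>M\<^esub> u = carrier M" if "u \<in> carrier M" for u
    using t[OF that] by (auto simp: a_r_coset_def')
  show "carrier (quotient_space M (carrier M)) = {carrier M}"
    using ne c by (auto simp: quotient_space_def A_RCOSETS_def')
  show "zero (quotient_space M (carrier M)) = carrier M"
    by (simp add: quotient_space_def)
  have "carrier M <+>\<^bsub>M\<^esub> carrier M = (\<Union>u\<in>carrier M. (\<lambda>h. h \<oplus>\<^bsub>M\<^esub> u) ` carrier M)"
    by (auto simp: set_add_def')
  then show "carrier M \<oplus>\<^bsub>quotient_space M (carrier M)\<^esub> carrier M = carrier M"
    using ne t by (simp add: quotient_space_def)
  show "c \<odot>\<^bsub>quotient_space M (carrier M)\<^esub> carrier M = carrier M"
    using ne s c by (simp add: quotient_space_def)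
qed

section \<open>Comparison of the two quotient spaces\<close>

context separable_algebra
begin

lemma x_in_alg_points: "x \<in> alg_points"
  using separable by (simp add: separable_locus_def)

lemma cocycle_iff_coboundary:
  "is_bilinear f \<and> hochschild_d2 (alg_prod x) f = (\<lambda>a b c. 0) \<longleftrightarrow>
    (\<exists>g. is_linear g \<and> f = hochschild_d1 (alg_prod x) g)"
proof
  assume "\<exists>g. is_linear g \<and> f = hochschild_d1 (alg_prod x) g"
  then obtain g where g: "is_linear g" "f = hochschild_d1 (alg_prod x) g" by blast
  then have lg: "Vector_Spaces.linear (*s) (*s) g" by (simp add: is_linear_def)
  show "is_bilinear f \<and> hochschild_d2 (alg_prod x) f = (\<lambda>a b c. 0)"
    using is_bilinear_hochschild_d1[OF g(1)]
    by (simp add: g(2) fun_eq_iff hochschild_d2_def hochschild_d1_def assoc alg_prod_bilin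
        vec.linear_add[OF lg])
qed (blast intro: hochschild_cocycle_imp_coboundary)

text \<open>\<open>alg_prod\<close> identifies tensors with bilinear maps, tangent vectors with
  cocycles and orbit directions with coboundaries. Since coboundaries exhaust the cocycles, both
  quotients consist of one coset, and taking images sends one to the other.\<close>

theorem tangent_and_HH2_vanish:
  "linear_iso (stack_tangent x) (HH2 x) (\<lambda>Q. alg_prod ` Q)"
  "carrier (HH2 x) = {\<zero>\<^bsub>HH2 x\<^esub>}"
  "carrier (stack_tangent x) = {\<zero>\<^bsub>stack_tangent x\<^esub>}"
proof -
  define T :: "('k, ('k, 'n) tensor) module" where "T = \<lparr>carrier = alg_tangent x, monoid.mult = undefined, one = undefined, zero = 0, add = (+),
        smult = (\<lambda>c \<xi>. \<chi> i j. c *s \<xi> $ i $ j)\<rparr>"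
  define Z :: "('k, 'k^'n \<Rightarrow> 'k^'n \<Rightarrow> 'k^'n) module" where "Z = \<lparr>carrier = {f. is_bilinear f \<and> hochschild_d2 (alg_prod x) f = (\<lambda>a b c. 0)},
        monoid.mult = undefined, one = undefined, zero = (\<lambda>a b. 0),
        add = (\<lambda>f g a b. f a b + g a b), smult = (\<lambda>c f a b. c *s f a b)\<rparr>"
  have Tc: "alg_tangent x = carrier T" by (simp add: T_def)
  have iT: "\<xi> \<in> carrier T \<longleftrightarrow> hochschild_d2 (alg_prod x) (alg_prod \<xi>) = (\<lambda>a b c. 0)" for \<xi>
    by (simp add: T_def alg_tangent_iff_cocycle[OF x_in_alg_points])
  have "\<xi> \<in> orbit_tangent x \<longleftrightarrow> \<xi> \<in> carrier T" for \<xi>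
    using cocycle_iff_coboundary[of "alg_prod \<xi>"] is_bilinear_alg_prod[of \<xi>]
    by (simp add: iT orbit_tangent_iff_coboundary)
  then have oT: "orbit_tangent x = carrier T" by blast
  \<comment> \<open>A cocycle is bilinear, hence recovered from its values on basis vectors; so
    \<open>alg_prod\<close> maps onto the cocycles, and their closure properties follow from those
    of \<open>T\<close>.\<close>
  have ZT: "carrier Z = alg_prod ` carrier T"
  proof (intro equalityI subsetI)
    fix f assume f: "f \<in> carrier Z"
    then have "f = alg_prod (\<chi> i j. f (axis i 1) (axis j 1))"
      by (simp add: Z_def bilinear_eq_alg_prod)
    moreover from this f have "(\<chi> i j. f (axis i 1) (axis j 1)) \<in> carrier T"
      by (simp add: iT Z_def)
    ultimately show "f \<in> alg_prod ` carrier T" by blast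
  next
    fix f assume "f \<in> alg_prod ` carrier T"
    then show "f \<in> carrier Z" by (auto simp: iT Z_def is_bilinear_alg_prod)
  qed
  have oZ: "{hochschild_d1 (alg_prod x) f | f. is_linear f} = carrier Z"
    unfolding Z_def using cocycle_iff_coboundary by auto
  have addT: "\<xi> + \<eta> \<in> carrier T" if "\<xi> \<in> carrier T" "\<eta> \<in> carrier T" for \<xi> \<eta>
    using that by (simp add: iT fun_eq_iff hochschild_d2_def alg_prod_add_tensor alg_prod_bilin algebra_simps)
  have scaleT: "(\<chi> i j. c *s \<xi> $ i $ j) \<in> carrier T" if "\<xi> \<in> carrier T" for c \<xi>
    using that by (simp add: iT fun_eq_iff hochschild_d2_def alg_prod_scale_tensor alg_prod_bilin
        flip: vector_sub_rdistrib vector_add_ldistrib vector_ssub_ldistrib)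
  have minusT: "- \<xi> \<in> carrier T" if "\<xi> \<in> carrier T" for \<xi>
  proof -
    have "(\<chi> i j. (- 1) *s \<xi> $ i $ j) = - \<xi>" by (simp add: vec_eq_iff)
    then show ?thesis using scaleT[OF that, of "- 1"] by simp
  qed
  have zeroT: "0 \<in> carrier T"
    by (simp add: iT fun_eq_iff hochschild_d2_def alg_prod_zero_tensor)
  have qT: "stack_tangent x = quotient_space T (carrier T)"
    unfolding stack_tangent_def oT by (simp add: T_def)
  have qZ: "HH2 x = quotient_space Z (carrier Z)"
    unfolding HH2_def oZ by (simp add: Z_def)
  have trT: "(\<lambda>h. h \<oplus>\<^bsub>T\<^esub> u) ` carrier T = carrier T" if "u \<in> carrier T" for u
  proof (intro equalityI subsetI)
    fix h assume "h \<in> carrier T"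
    then have "h + - u \<in> carrier T" using that by (intro addT minusT)
    moreover have "h = (h + - u) \<oplus>\<^bsub>T\<^esub> u" by (simp add: T_def)
    ultimately show "h \<in> (\<lambda>h. h \<oplus>\<^bsub>T\<^esub> u) ` carrier T" by blast
  qed (use that addT in \<open>auto simp: T_def\<close>)
  have addZ: "alg_prod \<xi> \<oplus>\<^bsub>Z\<^esub> alg_prod \<eta> = alg_prod (\<xi> \<oplus>\<^bsub>T\<^esub> \<eta>)" for \<xi> \<eta>
    by (simp add: T_def Z_def fun_eq_iff alg_prod_add_tensor)
  have trZ: "(\<lambda>h. h \<oplus>\<^bsub>Z\<^esub> u) ` carrier Z = carrier Z" if "u \<in> carrier Z" for u
  proof -
    from that obtain \<xi> where \<xi>: "\<xi> \<in> carrier T" "u = alg_prod \<xi>" unfolding ZT by blast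
    have "(\<lambda>h. h \<oplus>\<^bsub>Z\<^esub> u) ` carrier Z = alg_prod ` (\<lambda>h. h \<oplus>\<^bsub>T\<^esub> \<xi>) ` carrier T"
      by (simp add: ZT \<xi>(2) image_image addZ)
    then show ?thesis by (simp add: trT[OF \<xi>(1)] ZT)
  qed
  have smT: "c \<odot>\<^bsub>T\<^esub> u \<in> carrier T" if "u \<in> carrier T" for c u
    using scaleT[OF that] by (simp add: T_def)
  have smZ: "c \<odot>\<^bsub>Z\<^esub> u \<in> carrier Z" if "u \<in> carrier Z" for c u
  proof -
    from that obtain \<xi> where \<xi>: "\<xi> \<in> carrier T" "u = alg_prod \<xi>" unfolding ZT by blast
    have "c \<odot>\<^bsub>Z\<^esub> u = alg_prod (c \<odot>\<^bsub>T\<^esub> \<xi>)"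
      by (simp add: T_def Z_def \<xi>(2) fun_eq_iff alg_prod_scale_tensor)
    then show ?thesis using smT[OF \<xi>(1)] by (simp add: ZT)
  qed
  have neT: "carrier T \<noteq> {}" and neZ: "carrier Z \<noteq> {}" using zeroT by (auto simp: ZT)
  note quT = quotient_space_self[of T, OF neT trT smT] and quZ = quotient_space_self[of Z, OF neZ trZ smZ]
  show "carrier (HH2 x) = {\<zero>\<^bsub>HH2 x\<^esub>}" by (simp add: qZ quZ)
  show "carrier (stack_tangent x) = {\<zero>\<^bsub>stack_tangent x\<^esub>}" by (simp add: qT quT)
  show "linear_iso (stack_tangent x) (HH2 x) (\<lambda>Q. alg_prod ` Q)"
    by (simp add: linear_iso_def qT qZ quT quZ bij_betw_def flip: ZT)
qed

end

section \<open>Matrix units\<close>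

text \<open>Take p of least degree with p(g)v = 0 and split off a root c. The cofactor q has smaller
  degree, so q(g)v is nonzero, and g - c kills it. It lies in \<open>M\<close> because
  \<open>g\<close> preserves \<open>M\<close>.\<close>

lemma ex_eigenvector:
  fixes g :: "'k::alg_closed_field^'n \<Rightarrow> 'k^'n"
  assumes lin: "Vector_Spaces.linear (*s) (*s) g" and M: "vec.subspace M"
    and inv: "\<And>v. v \<in> M \<Longrightarrow> g v \<in> M" and v: "v \<in> M" "v \<noteq> 0"
  shows "\<exists>w c. w \<in> M \<and> w \<noteq> 0 \<and> g w = c *s w"
proof -
  \<comment> \<open>\<open>ev p\<close> is p(g)v in Horner form, so its laws follow by induction on
    the coefficients.\<close>
  define ev where "ev p = fold_coeffs (\<lambda>a w. a *s v + g w) p 0" for p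
  have g0: "g 0 = 0" using vec.linear_0[OF lin] .
  have ev0: "ev 0 = 0" by (simp add: ev_def)
  have evC: "ev (pCons a p) = a *s v + g (ev p)" for a p
    by (cases "a = 0 \<and> p = 0") (auto simp: ev_def g0)
  have evA: "ev (p + q) = ev p + ev q" for p q
    by (induction p q rule: poly_induct2) (simp_all add: ev0 evC vec.linear_add[OF lin] vec.scale_left_distrib algebra_simps)
  have evS: "ev (Polynomial.smult c p) = c *s ev p" for c p
    by (induction p) (simp_all add: ev0 evC vec.linear_scale[OF lin] vec.scale_right_distrib vector_smult_assoc)
  have evM: "ev p \<in> M" for p
    by (induction p) (auto simp: ev0 evC intro!: vec.subspace_0 vec.subspace_add vec.subspace_scale M v inv)
  have evm: "ev (monom c i) = c *s (g ^^ i) v" for c i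
    by (induction i) (simp_all add: monom_0 monom_Suc ev0 evC g0 vec.linear_scale[OF lin])
  have ev_sum: "ev (\<Sum>i\<in>A. f i) = (\<Sum>i\<in>A. ev (f i))" for A :: "nat set" and f
    by (induction A rule: infinite_finite_induct) (simp_all add: ev0 evA)
  have "\<exists>p. p \<noteq> 0 \<and> ev p = 0"
  \<comment> \<open>The n + 1 iterates v, ..., g^n v either repeat or are dependent. A repetition is
    treated apart, since the set of iterates would hide it.\<close>
  proof (cases "inj_on (\<lambda>i. (g ^^ i) v) {..CARD('n)}")
    case False
    then obtain i j where ij: "i \<noteq> j" "(g ^^ i) v = (g ^^ j) v" by (auto simp: inj_on_def)
    have "ev (monom 1 i + Polynomial.smult (- 1) (monom 1 j)) = 0"
      by (simp only: evA evS evm ij) simp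
    moreover have "coeff (monom 1 i + Polynomial.smult (- 1) (monom (1::'k) j)) i \<noteq> 0" using ij by simp
    ultimately show ?thesis by (metis coeff_0)
  next
    case True
    let ?B = "(\<lambda>i. (g ^^ i) v) ` {..CARD('n)}"
    have "card ?B = Suc CARD('n)" by (simp add: card_image[OF True])
    then have "\<not> card ?B \<le> vec.dim (UNIV :: ('k^'n) set)" unfolding vec_dim_card by simp
    then have "vec.dependent ?B" using vec.independent_card_le_dim[OF subset_UNIV] by blast
    then obtain w b where w: "(\<Sum>b\<in>?B. w b *s b) = 0" "b \<in> ?B" "w b \<noteq> 0"
      using vec.dependent_finite[of ?B] by auto
    define p where "p = (\<Sum>i\<le>CARD('n). monom (w ((g ^^ i) v)) i)"
    have "ev p = 0"
      using w(1) by (simp add: p_def ev_sum evm sum.reindex[OF True])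
    moreover from w(2) obtain i where i: "i \<le> CARD('n)" "b = (g ^^ i) v" by auto
    then have "coeff p i \<noteq> 0"
      using w(3) by (simp add: p_def coeff_sum)
    ultimately show ?thesis by (metis coeff_0)
  qed
  then obtain p where p: "p \<noteq> 0" "ev p = 0" and least: "\<And>q. q \<noteq> 0 \<Longrightarrow> ev q = 0 \<Longrightarrow> Polynomial.degree p \<le> Polynomial.degree q"
    using ex_has_least_nat[of "\<lambda>p. p \<noteq> 0 \<and> ev p = 0" _ Polynomial.degree] by blast
  have "Polynomial.degree p > 0"
  proof (rule ccontr)
    assume "\<not> Polynomial.degree p > 0"
    then obtain a where "p = [:a:]" by (metis degree_eq_zeroE not_gr0)
    then show False using p v by (simp add: evC ev0 g0)
  qed
  then obtain c where "poly p c = 0" using alg_closed_imp_poly_has_root by blast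
  then obtain q where q: "p = [:- c, 1:] * q" by (auto simp: poly_eq_0_iff_dvd)
  have q0: "q \<noteq> 0" using p q by auto
  then have "Polynomial.degree p = Suc (Polynomial.degree q)" unfolding q by (subst degree_mult_eq) auto
  then have "ev q \<noteq> 0" using least[OF q0] by auto
  moreover have "g (ev q) = c *s ev q"
  proof -
    have "p = Polynomial.smult (- c) q + pCons 0 q" by (simp add: q)
    then have "ev p = - c *s ev q + g (ev q)" by (simp only: evA evS evC) simp
    then show ?thesis using p(2) by (simp add: vector_smult_lneg)
  qed
  ultimately show ?thesis using evM by blast
qed

section \<open>Right ideals and minimal idempotents\<close>

context separable_algebra
begin

definition right_ideal :: "('k^'n) set \<Rightarrow> bool" where
  "right_ideal M \<longleftrightarrow> vec.subspace M \<and> (\<forall>m\<in>M. \<forall>a. m \<star> a \<in> M)"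

text \<open>Minimality is expressed by the corner fAf being the line kf, which is the form that all
  corner computations use.\<close>

definition min_idem :: "'k^'n \<Rightarrow> bool" where
  "min_idem f \<longleftrightarrow> f \<noteq> 0 \<and> f \<star> f = f \<and> (\<forall>a. \<exists>c. f \<star> a \<star> f = c *s f)"

definition orth_system :: "('k^'n) set \<Rightarrow> bool" where
  "orth_system F \<longleftrightarrow> finite F \<and> (\<forall>f\<in>F. min_idem f) \<and> (\<forall>f\<in>F. \<forall>g\<in>F. f \<noteq> g \<longrightarrow> f \<star> g = 0)"

lemma right_ideal_image:
  assumes M: "right_ideal M" shows "right_ideal ((\<lambda>a. m \<star> a) ` M)"
  unfolding right_ideal_def
proof (intro conjI ballI allI)
  show "vec.subspace ((\<lambda>a. m \<star> a) ` M)"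
    using M by (intro vec.linear_subspace_image linear_alg_prod_left) (simp add: right_ideal_def)
  show "a \<star> b \<in> (\<lambda>a. m \<star> a) ` M" if "a \<in> (\<lambda>a. m \<star> a) ` M" for a b
    using that M by (auto simp: right_ideal_def assoc)
qed

text \<open>Left multiplication by \<open>m\<close> commutes with all right multiplications. With
  minimality this gives Schur's lemma; the case c = 0 gives annihilators.\<close>

lemma right_ideal_eigenspace:
  assumes M: "right_ideal M" shows "right_ideal {v \<in> M. m \<star> v = c *s v}"
  using M unfolding right_ideal_def vec.subspace_def
  by (auto simp: alg_prod_bilin vec.scale_right_distrib vector_smult_assoc mult.commute simp flip: assoc)

text \<open>Multiplication by an element of a right ideal of square zero factors through a projection
  onto the ideal, which it annihilates; so its trace vanishes.\<close>

lemma right_ideal_square_nonzero: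
  assumes M: "right_ideal M" and ne: "M \<noteq> {0}"
  shows "\<exists>m\<in>M. \<exists>m'\<in>M. m \<star> m' \<noteq> 0"
proof (rule ccontr)
  assume "\<not> (\<exists>m\<in>M. \<exists>m'\<in>M. m \<star> m' \<noteq> 0)"
  then have z: "m \<star> m' = 0" if "m \<in> M" "m' \<in> M" for m m' using that by blast
  have sM: "vec.subspace M" using M by (simp add: right_ideal_def)
  obtain P where P: "range P \<subseteq> M" "Vector_Spaces.linear (*s) (*s) P" "\<And>v. v \<in> M \<Longrightarrow> P v = v"
    using vec.linear_exists_left_inverse_on[OF vec.linear_ident sM] by auto
  have "m = 0" if m: "m \<in> M" for m
  proof (rule trace_form_nondegenerate)
    fix b
    have c: "m \<star> b \<in> M" using M m by (auto simp: right_ideal_def)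
    let ?L = "left_mult x (m \<star> b)"
    have "?L = matrix P ** ?L"
      using M c by (auto simp: matrix_eq matrix_works[OF P(2)] left_mult_mult right_ideal_def P(3)
          simp flip: matrix_vector_mul_assoc)
    moreover have "m \<star> b \<star> P v = 0" for v
      using z[OF c, of "P v"] P(1) by blast
    then have "?L ** matrix P = 0"
      by (simp add: matrix_eq matrix_works[OF P(2)] left_mult_mult flip: matrix_vector_mul_assoc)
    ultimately have "trace ?L = trace (0 :: 'k^'n^'n)" by (metis trace_mul_sym)
    then show "tr (m \<star> b) = 0" by (simp add: tr_def trace_def)
  qed
  moreover have "0 \<in> M" using sM by (rule vec.subspace_0)
  ultimately show False using ne by blast
qed

end

locale split_separable_algebra = separable_algebra x
  for x :: "('k::{alg_closed_field, field_char_0}, 'n::finite) tensor"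
begin

text \<open>Brauer's lemma: the idempotent generates a minimal right ideal.\<close>

lemma ex_min_idem:
  assumes I: "right_ideal I" and ne: "I \<noteq> {0}"
  shows "\<exists>f\<in>I. min_idem f"
proof -
  obtain M where M: "right_ideal M" "M \<subseteq> I" "M \<noteq> {0}"
    and least: "\<And>N. right_ideal N \<Longrightarrow> N \<subseteq> I \<Longrightarrow> N \<noteq> {0} \<Longrightarrow> vec.dim M \<le> vec.dim N"
    using ex_has_least_nat[of "\<lambda>M. right_ideal M \<and> M \<subseteq> I \<and> M \<noteq> {0}" I vec.dim] I ne by blast
  have min: "N = M" if "right_ideal N" "N \<subseteq> M" "N \<noteq> {0}" for N
    using vec.subspace_dim_equal[of N M] least[of N] that M by (auto simp: right_ideal_def)
  have sM: "vec.subspace M" and ri: "\<And>m a. m \<in> M \<Longrightarrow> m \<star> a \<in> M"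
    using M(1) by (simp_all add: right_ideal_def)
  obtain m m' where m: "m \<in> M" "m' \<in> M" "m \<star> m' \<noteq> 0"
    using right_ideal_square_nonzero[OF M(1,3)] by blast
  \<comment> \<open>The image mM is a nonzero right ideal inside \<open>M\<close>, so it is all of
    \<open>M\<close> and m = mf is solvable in \<open>M\<close>.\<close>
  have "(\<lambda>a. m \<star> a) ` M = M"
    using m ri by (intro min right_ideal_image M) auto
  then obtain f where f: "f \<in> M" "m \<star> f = m" using m(1) by (metis imageE)
  \<comment> \<open>The annihilator of \<open>m\<close> in \<open>M\<close> is a right ideal missing
    \<open>m'\<close>, hence zero. It contains ff - f because mf = m, so \<open>f\<close> is
    idempotent.\<close>
  have "{v \<in> M. m \<star> v = 0 *s v} = {0}"
    using min[OF right_ideal_eigenspace[OF M(1), of m 0]] m by auto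
  moreover have "f \<star> f - f \<in> {v \<in> M. m \<star> v = 0 *s v}"
    using f ri sM by (simp add: alg_prod_bilin vec.subspace_diff flip: assoc)
  ultimately have ff: "f \<star> f = f" by simp
  have f0: "f \<noteq> 0" using f m by auto
  have "\<exists>c. f \<star> a \<star> f = c *s f" for a
  proof -
    \<comment> \<open>Schur's lemma: an eigenspace of left multiplication by faf on \<open>M\<close>
      is a nonzero right ideal, so it is \<open>M\<close>; evaluating at \<open>f\<close> makes faf
      a multiple of \<open>f\<close>.\<close>
    have "\<exists>w c. w \<in> M \<and> w \<noteq> 0 \<and> f \<star> a \<star> f \<star> w = c *s w"
    proof (rule ex_eigenvector[OF linear_alg_prod_left sM])
      show "f \<star> a \<star> f \<star> v \<in> M" for v using ri f(1) by (simp add: assoc)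
    qed (use f f0 in auto)
    then obtain w c where w: "w \<in> M" "w \<noteq> 0" "f \<star> a \<star> f \<star> w = c *s w" by blast
    then have "{v \<in> M. f \<star> a \<star> f \<star> v = c *s v} = M"
      by (intro min right_ideal_eigenspace M) auto
    then have "f \<star> a \<star> f \<star> f = c *s f" using f(1) by blast
    then show ?thesis using ff by (auto simp: assoc)
  qed
  with ff f0 f M(2) show ?thesis by (auto simp: min_idem_def)
qed

text \<open>Multiplying a linear relation by one member isolates its coefficient, so the members are
  independent. The bound makes a system of greatest size available.\<close>

lemma orth_system_card:
  assumes F: "orth_system F" shows "card F \<le> CARD('n)"
proof -
  have "vec.independent F"
  proof (rule ccontr)
    assume "\<not> vec.independent F"
    then obtain w f where w: "(\<Sum>b\<in>F. w b *s b) = 0" "f \<in> F" "w f \<noteq> 0"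
      using vec.dependent_finite[of F] F by (auto simp: orth_system_def)
    have "f \<star> (\<Sum>b\<in>F. w b *s b) = (\<Sum>b\<in>F. if b = f then w f *s f else 0)"
      unfolding alg_prod_bilin
      using F w(2) by (intro sum.cong) (auto simp: orth_system_def min_idem_def)
    also have "\<dots> = w f *s f" using F w(2) by (simp add: orth_system_def)
    finally have "w f *s f = 0" using w(1) by simp
    moreover have "f \<noteq> 0" using F w(2) by (auto simp: orth_system_def min_idem_def)
    ultimately show False using w(3) by (simp add: vector_mul_eq_0)
  qed
  from vec.independent_card_le_dim[OF subset_UNIV this] show ?thesis unfolding vec_dim_card .
qed

text \<open>Take a system of greatest size. If its complement g = 1 - \<Sum>F were nonzero, the
  right ideal gA would contain a minimal idempotent from which the system could be enlarged.\<close>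

lemma ex_complete_orth_system: "\<exists>F. orth_system F \<and> \<Sum>F = unit"
proof -
  have "orth_system {}" by (simp add: orth_system_def)
  then obtain F where F: "orth_system F" and greatest: "\<And>G. orth_system G \<Longrightarrow> card G \<le> card F"
    using ex_has_greatest_nat[of orth_system "{}" card "Suc CARD('n)"] orth_system_card
    by (metis le_imp_less_Suc)
  have fin: "finite F" and mi: "\<And>h. h \<in> F \<Longrightarrow> min_idem h"
    and orth: "\<And>h h'. h \<in> F \<Longrightarrow> h' \<in> F \<Longrightarrow> h \<noteq> h' \<Longrightarrow> h \<star> h' = 0"
    using F by (auto simp: orth_system_def)
  define g where "g = unit - \<Sum>F"
  have F1: "h \<star> \<Sum>F = h" "\<Sum>F \<star> h = h" if h: "h \<in> F" for h
  proof -
    have "h \<star> \<Sum>F = (\<Sum>b\<in>F. if b = h then h else 0)" unfolding alg_prod_bilin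
      using h mi orth by (intro sum.cong) (auto simp: min_idem_def)
    then show "h \<star> \<Sum>F = h" using fin h by simp
    have "\<Sum>F \<star> h = (\<Sum>b\<in>F. if b = h then h else 0)" unfolding alg_prod_bilin
      using h mi orth by (intro sum.cong) (auto simp: min_idem_def)
    then show "\<Sum>F \<star> h = h" using fin h by simp
  qed
  have g1: "h \<star> g = 0" "g \<star> h = 0" if "h \<in> F" for h
    by (simp_all add: g_def alg_prod_diff_left alg_prod_diff_right F1[OF that])
  have gg: "g \<star> g = g"
  proof -
    have "\<Sum>F \<star> g = 0" by (simp add: alg_prod_sum_left g1)
    moreover have "g \<star> g = unit \<star> g - \<Sum>F \<star> g" by (simp only: g_def alg_prod_diff_left)
    ultimately show ?thesis by simp
  qed
  have "g = 0"
  proof (rule ccontr)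
    assume g0: "g \<noteq> 0"
    have "right_ideal UNIV" by (simp add: right_ideal_def vec.subspace_UNIV)
    from right_ideal_image[OF this, of g] have "right_ideal (range (\<lambda>a. g \<star> a))" .
    moreover have "range (\<lambda>a. g \<star> a) \<noteq> {0}" using g0 gg by (metis rangeI singletonD)
    ultimately obtain f where f: "f \<in> range (\<lambda>a. g \<star> a)" "min_idem f" using ex_min_idem by blast
    have gf: "g \<star> f = f" using f(1) gg by (auto simp flip: assoc)
    have ff: "f \<star> f = f" "f \<noteq> 0" using f(2) by (auto simp: min_idem_def)
    \<comment> \<open>\<open>f\<close> satisfies gf = f and is thus annihilated by \<open>F\<close>
      from the left only; passing to fg adds annihilation from the right and keeps
      minimality.\<close>
    define f' where "f' = f \<star> g"
    have "f' \<star> f = f" by (simp add: f'_def assoc gf ff)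
    then have f'0: "f' \<noteq> 0" using ff by auto
    have f'f': "f' \<star> f' = f'"
      using \<open>f' \<star> f = f\<close> by (simp add: f'_def flip: assoc)
    have "\<exists>c. f' \<star> a \<star> f' = c *s f'" for a
    proof -
      obtain c where "f \<star> (g \<star> a) \<star> f = c *s f" using f(2) by (auto simp: min_idem_def)
      then have "f \<star> (g \<star> a) \<star> f \<star> g = c *s f'" by (simp add: f'_def alg_prod_bilin)
      then show ?thesis by (auto simp: f'_def assoc)
    qed
    then have "min_idem f'" using f'0 f'f' by (simp add: min_idem_def)
    moreover have o: "h \<star> f' = 0" "f' \<star> h = 0" if "h \<in> F" for h
    proof -
      have "h \<star> f' = h \<star> g \<star> (f \<star> g)" by (metis f'_def assoc gf)
      then show "h \<star> f' = 0" by (simp add: g1[OF that])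
      show "f' \<star> h = 0" by (simp add: f'_def assoc g1[OF that])
    qed
    moreover have "f' \<notin> F" using o(1) f'0 f'f' by metis
    ultimately have "orth_system (insert f' F)" using fin mi orth by (auto simp: orth_system_def)
    from greatest[OF this] show False using \<open>f' \<notin> F\<close> fin by simp
  qed
  then have "\<Sum>F = unit" by (simp add: g_def)
  with F show ?thesis by blast
qed

text \<open>The trace form pairs \<open>a\<close> nontrivially with some b0, and compressing b0 into
  gAf keeps that pairing. Then ab lies in fAf = kf and ba in gAg = kg, with the same scalar because
  (ab)a = a(ba); rescaling gives the inverse.\<close>

lemma peirce_inverse:
  assumes f: "min_idem f" and g: "min_idem g" and a: "f \<star> a = a" "a \<star> g = a" "a \<noteq> 0"
  shows "\<exists>b. g \<star> b = b \<and> b \<star> f = b \<and> a \<star> b = f \<and> b \<star> a = g"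
proof -
  obtain b0 where b0: "tr (a \<star> b0) \<noteq> 0" using trace_form_nondegenerate a(3) by blast
  define b1 where "b1 = g \<star> b0 \<star> f"
  have ff: "f \<star> f = f" and gg: "g \<star> g = g" using f g by (auto simp: min_idem_def)
  have b1: "g \<star> b1 = b1" "b1 \<star> f = b1"
    by (simp_all add: b1_def assoc ff) (simp add: gg flip: assoc)
  \<comment> \<open>Since fa = a and ag = a, cyclicity of the trace absorbs both compressing
    idempotents.\<close>
  have "tr (a \<star> b1) = tr (a \<star> b0)"
  proof -
    have "a \<star> b1 = a \<star> b0 \<star> f" by (metis b1_def assoc a(2))
    then have "tr (a \<star> b1) = tr (f \<star> (a \<star> b0))" by (simp add: tr_commute)
    then show ?thesis by (simp add: a(1) flip: assoc)
  qed
  then have ab0: "a \<star> b1 \<noteq> 0" using b0 by auto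
  obtain s where s: "f \<star> (a \<star> b1) \<star> f = s *s f" using f by (auto simp: min_idem_def)
  then have s: "a \<star> b1 = s *s f" by (simp add: assoc b1) (simp add: a flip: assoc)
  obtain t where t: "g \<star> (b1 \<star> a) \<star> g = t *s g" using g by (auto simp: min_idem_def)
  then have t: "b1 \<star> a = t *s g" by (simp add: assoc a) (simp add: b1 flip: assoc)
  have s0: "s \<noteq> 0" using ab0 s by auto
  have "s *s a = a \<star> b1 \<star> a" by (simp add: s alg_prod_bilin a)
  also have "\<dots> = t *s a" by (simp add: assoc t alg_prod_bilin a)
  finally have "s = t" using a(3) by simp
  then show ?thesis
    using s0 by (intro exI[of _ "inverse s *s b1"]) (simp add: alg_prod_bilin b1 s t vector_smult_assoc)
qed

text \<open>Inserting a'a = g turns fbg into (f(ba')f)a, and the bracket is a scalar multiple of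
  \<open>f\<close>.\<close>

lemma peirce_dim_1:
  assumes f: "min_idem f" and g: "min_idem g" and a: "f \<star> a = a" "a \<star> g = a" "a \<noteq> 0"
  shows "\<exists>c. f \<star> b \<star> g = c *s a"
proof -
  obtain a' where a': "a' \<star> f = a'" "a' \<star> a = g" using peirce_inverse[OF assms] by blast
  obtain c where c: "f \<star> (b \<star> a') \<star> f = c *s f" using f by (auto simp: min_idem_def)
  have "f \<star> b \<star> g = f \<star> (b \<star> a') \<star> f \<star> a" by (simp add: assoc a a')
  also have "\<dots> = c *s a" by (simp add: c alg_prod_bilin a)
  finally show ?thesis by blast
qed

end

text \<open>All blocks share one index set: the classes of \<open>R\<close> are the blocks, and
  \<open>E i j\<close> is a matrix unit when i and j lie in the same class. Independence is not
  demanded, as it follows from the multiplication rule.\<close>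

definition matrix_units ::
  "('k::field, 'n::finite) tensor \<Rightarrow> 'i set \<Rightarrow> ('i \<times> 'i) set \<Rightarrow> ('i \<Rightarrow> 'i \<Rightarrow> 'k^'n) \<Rightarrow> bool" where
  "matrix_units x I R E \<longleftrightarrow> finite I \<and> equiv I R \<and>
    (\<forall>(i, j)\<in>R. E i j \<noteq> 0) \<and>
    (\<forall>(i, j)\<in>R. \<forall>(k, l)\<in>R. alg_prod x (E i j) (E k l) = (if j = k then E i l else 0)) \<and>
    (\<forall>a. \<exists>c. a = (\<Sum>(i, j)\<in>R. c i j *s E i j))"

context split_separable_algebra
begin

text \<open>Fix a representative r(f) in each class of idempotents and mutually inverse u_f in the
  corner from f to r(f) and v_f back. The products E_fg = u_f v_g multiply correctly because v_g u_g
  = r(g) depends on the class only.\<close>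

theorem ex_matrix_units: "\<exists>(I :: ('k^'n) set) R E. matrix_units x I R E"
proof -
  obtain F where F: "orth_system F" "\<Sum>F = unit" using ex_complete_orth_system by blast
  have fin: "finite F" and mi: "\<And>h. h \<in> F \<Longrightarrow> min_idem h"
    and orth: "\<And>h h'. h \<in> F \<Longrightarrow> h' \<in> F \<Longrightarrow> h \<noteq> h' \<Longrightarrow> h \<star> h' = 0"
    using F by (auto simp: orth_system_def)
  have idem: "h \<star> h = h" "h \<noteq> 0" if "h \<in> F" for h using mi[OF that] by (auto simp: min_idem_def)
  define P where "P f g a \<longleftrightarrow> f \<star> a = a \<and> a \<star> g = a \<and> a \<noteq> 0" for f g a
  \<comment> \<open>Two idempotents belong to the same block when the corner fAg is nonzero.\<close>
  define R where "R = {(f, g). f \<in> F \<and> g \<in> F \<and> (\<exists>a. P f g a)}"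
  have RF: "f \<in> F" "g \<in> F" if "(f, g) \<in> R" for f g using that by (auto simp: R_def)
  have "P f f f" if "f \<in> F" for f using idem[OF that] by (simp add: P_def)
  then have reflR: "refl_on F R" by (auto simp: refl_on_def R_def)
  have symR: "sym R"
  proof (rule symI)
    fix f g assume "(f, g) \<in> R"
    then obtain a where fg: "f \<in> F" "g \<in> F" and a: "P f g a" by (auto simp: R_def)
    then obtain b where "g \<star> b = b \<and> b \<star> f = b \<and> a \<star> b = f \<and> b \<star> a = g"
      using peirce_inverse[OF mi mi, of f g a] by (auto simp: P_def)
    then have "P g f b" using idem(2)[OF fg(1)] by (auto simp: P_def)
    then show "(g, f) \<in> R" using fg by (auto simp: R_def)
  qed
  have transR: "trans R"
  proof (rule transI)
    fix f g h assume "(f, g) \<in> R" "(g, h) \<in> R"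
    then obtain a c where F3: "f \<in> F" "g \<in> F" "h \<in> F" and a: "P f g a" and c: "P g h c" by (auto simp: R_def)
    then obtain b where b: "b \<star> a = g" using peirce_inverse[OF mi mi, of f g a] by (auto simp: P_def)
    have "b \<star> (a \<star> c) = c" using b c by (simp add: P_def flip: assoc)
    then have "a \<star> c \<noteq> 0" using c by (auto simp: P_def)
    moreover have "f \<star> (a \<star> c) = a \<star> c" using a by (simp add: P_def flip: assoc)
    moreover have "a \<star> c \<star> h = a \<star> c" using c by (simp add: P_def assoc)
    ultimately have "P f h (a \<star> c)" by (simp add: P_def)
    then show "(f, h) \<in> R" using F3 by (auto simp: R_def)
  qed
  have equiv: "equiv F R" using RF by (intro equivI reflR symR transR) auto
  \<comment> \<open>The choice depends only on the predicate describing the class, so related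
    idempotents receive the same representative.\<close>
  define r where "r f = (SOME g. (f, g) \<in> R)" for f
  have r: "(f, r f) \<in> R" if "f \<in> F" for f
    unfolding r_def by (rule someI) (rule refl_onD[OF reflR that])
  have r_eq: "r f = r g" if "(f, g) \<in> R" for f g
  proof -
    have "(\<lambda>h. (f, h) \<in> R) = (\<lambda>h. (g, h) \<in> R)"
      using that symD[OF symR] transD[OF transR] by blast
    then show ?thesis by (simp add: r_def)
  qed
  have "\<exists>u v. P f (r f) u \<and> r f \<star> v = v \<and> v \<star> f = v \<and> u \<star> v = f \<and> v \<star> u = r f" if f: "f \<in> F" for f
  proof -
    from r[OF f] obtain u where u: "P f (r f) u" "r f \<in> F" by (auto simp: R_def)
    with peirce_inverse[OF mi mi, of f "r f" u] f show ?thesis by (auto simp: P_def)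
  qed
  then obtain u v where uv: "\<And>f. f \<in> F \<Longrightarrow> P f (r f) (u f) \<and> r f \<star> v f = v f \<and> v f \<star> f = v f \<and>
      u f \<star> v f = f \<and> v f \<star> u f = r f" by metis
  define E where "E f g = u f \<star> v g" for f g
  have EE: "E f g \<star> E g h = E f h" if "(f, g) \<in> R" "h \<in> F" for f g h
  proof -
    have "E f g \<star> E g h = u f \<star> (v g \<star> u g) \<star> v h" by (simp add: E_def assoc)
    also have "\<dots> = u f \<star> r f \<star> v h" using uv r_eq[OF that(1)] RF[OF that(1)] by simp
    also have "\<dots> = E f h" using uv[of f] RF[OF that(1)] by (simp add: P_def E_def)
    finally show ?thesis .
  qed
  have Eff: "E f f = f" if "f \<in> F" for f using uv[OF that] by (simp add: E_def)
  have Eside: "f \<star> E f g = E f g" "E f g \<star> g = E f g" if "(f, g) \<in> R" for f g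
    using uv RF[OF that] by (simp_all add: E_def P_def assoc) (simp add: P_def flip: assoc)
  have E0: "E f g \<noteq> 0" if "(f, g) \<in> R" for f g
    using EE[OF that, of f] Eff[of f] RF[OF that] idem by auto
  have EE0: "E f g \<star> E g' h = 0" if "(f, g) \<in> R" "(g', h) \<in> R" "g \<noteq> g'" for f g g' h
  proof -
    have "E f g \<star> E g' h = E f g \<star> (g \<star> g') \<star> E g' h"
      using Eside[OF that(1)] Eside[OF that(2)] by (metis assoc)
    then show ?thesis using orth RF that by simp
  qed
  have finR: "finite R" using fin RF by (intro finite_subset[of R "F \<times> F"]) auto
  have span: "\<exists>c. a = (\<Sum>(f, g)\<in>R. c f g *s E f g)" for a
  proof -
    have "\<exists>c. f \<star> a \<star> g = c *s E f g" if "(f, g) \<in> R" for f g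
      using peirce_dim_1[OF mi mi, of f g "E f g"] RF[OF that] Eside[OF that] E0[OF that] by blast
    then obtain c where c: "\<And>f g. (f, g) \<in> R \<Longrightarrow> f \<star> a \<star> g = c f g *s E f g" by metis
    \<comment> \<open>Two-sided Peirce decomposition; corners outside \<open>R\<close> vanish by
      definition of \<open>R\<close>, and the others are lines spanned by E_fg.\<close>
    have "a = \<Sum>F \<star> a \<star> \<Sum>F" by (simp add: F(2))
    also have "\<dots> = (\<Sum>(f, g)\<in>F \<times> F. f \<star> a \<star> g)"
      unfolding sum.cartesian_product[symmetric] alg_prod_sum_left alg_prod_sum_right by (rule sum.swap)
    also have "\<dots> = (\<Sum>(f, g)\<in>R. f \<star> a \<star> g)"
    proof (rule sum.mono_neutral_right)
      show "\<forall>p\<in>F \<times> F - R. (case p of (f, g) \<Rightarrow> f \<star> a \<star> g) = 0"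
      proof clarify
        fix f g assume fg: "f \<in> F" "g \<in> F" "(f, g) \<notin> R"
        have "f \<star> (f \<star> a \<star> g) = f \<star> a \<star> g" using idem fg by (simp flip: assoc)
        moreover have "f \<star> a \<star> g \<star> g = f \<star> a \<star> g" using idem fg by (simp add: assoc)
        ultimately show "f \<star> a \<star> g = 0" using fg by (auto simp: R_def P_def)
      qed
    qed (use fin RF in auto)
    also have "\<dots> = (\<Sum>(f, g)\<in>R. c f g *s E f g)" using c by (intro sum.cong) auto
    finally show ?thesis by blast
  qed
  have "matrix_units x F R E"
    unfolding matrix_units_def using fin equiv E0 EE EE0 span RF by auto
  then show ?thesis by blast
qed

end

section \<open>Orbits and matrix units\<close>

lemma matrix_vector_mult_scale: "A *v (c *s v) = c *s (A *v (v :: 'a::comm_ring_1^'n))"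
  by (simp add: vec_eq_iff matrix_vector_mult_def sum_distrib_left mult_ac)

lemma matrix_vector_mult_sum: "A *v (\<Sum>s\<in>S. f s) = (\<Sum>s\<in>S. A *v (f s :: 'a::comm_ring_1^'n))"
  by (induction S rule: infinite_finite_induct) (simp_all add: matrix_vector_right_distrib)

lemma matrix_vector_mult_axis: "(A *v axis i 1) $ p = A $ p $ i"
  by (simp add: matrix_vector_mult_def axis_def if_distrib[of "\<lambda>u. _ * u"] cong: if_cong)

lemma alg_prod_transport:
  "alg_prod (transport g h x) a b = g *v alg_prod x (h *v a) (h *v b)"
proof -
  have h: "h *v a = (\<Sum>i\<in>UNIV. a $ i *s (h *v axis i 1))" for a
    by (simp add: basis_expansion flip: matrix_vector_mult_sum matrix_vector_mult_scale)
  have "alg_prod x (h *v a) (h *v b) =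
      (\<Sum>i\<in>UNIV. \<Sum>j\<in>UNIV. (a $ i * b $ j) *s alg_prod x (h *v axis i 1) (h *v axis j 1))"
    by (subst h[of a], subst h[of b])
      (simp only: alg_prod_sum_left alg_prod_scale_left,
        simp only: alg_prod_sum_right alg_prod_scale_right vec_scale_sum vector_smult_assoc)
  then show ?thesis
    unfolding alg_prod_expand[of "transport g h x"]
    by (simp add: transport_def matrix_vector_mult_sum matrix_vector_mult_scale)
qed

lemma tensor_eqI:
  assumes "\<And>a b. alg_prod x a b = alg_prod y a b" shows "x = y"
  using assms by (metis alg_prod_axis vec_eq_iff)

lemma transport_transport: "transport g h (transport g' h' x) = transport (g ** g') (h' ** h) x"
  by (rule tensor_eqI) (simp add: alg_prod_transport matrix_vector_mul_assoc)

lemma transport_id [simp]: "transport (mat 1) (mat 1) x = x"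
  by (rule tensor_eqI) (simp add: alg_prod_transport)

lemma matrix_inv_unique:
  assumes "g ** h = mat 1" "h ** g = mat 1" shows "matrix_inv g = h"
proof -
  have "invertible g" using assms by (auto simp: invertible_def)
  then have "matrix_inv g ** g ** h = h" by (simp add: matrix_inv_mult)
  then show ?thesis by (simp add: assms flip: matrix_mul_assoc)
qed

lemma gl_orbit_iff:
  "y \<in> gl_orbit x \<longleftrightarrow> (\<exists>g h. g ** h = mat 1 \<and> h ** g = mat 1 \<and> y = transport g h x)"
proof
  assume "y \<in> gl_orbit x"
  then show "\<exists>g h. g ** h = mat 1 \<and> h ** g = mat 1 \<and> y = transport g h x"
    by (auto simp: gl_orbit_def gl_act_def intro: matrix_inv_mult)
next
  assume "\<exists>g h. g ** h = mat 1 \<and> h ** g = mat 1 \<and> y = transport g h x"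
  then obtain g h where g: "g ** h = mat 1" "h ** g = mat 1" and y: "y = transport g h x" by blast
  then have "invertible g" "y = gl_act g x"
    by (auto simp: invertible_def gl_act_def matrix_inv_unique[OF g])
  then show "y \<in> gl_orbit x" by (auto simp: gl_orbit_def)
qed

lemma gl_orbit_self: "x \<in> gl_orbit x"
  unfolding gl_orbit_iff by (intro exI[of _ "mat 1"]) simp

lemma gl_orbit_trans:
  assumes "y \<in> gl_orbit x" "z \<in> gl_orbit y" shows "z \<in> gl_orbit x"
proof -
  obtain g h where g: "g ** h = mat 1" "h ** g = mat 1" "y = transport g h x"
    using assms(1) unfolding gl_orbit_iff by blast
  obtain g' h' where g': "g' ** h' = mat 1" "h' ** g' = mat 1" "z = transport g' h' y"
    using assms(2) unfolding gl_orbit_iff by blast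
  have "g' ** g ** (h ** h') = g' ** (g ** h) ** h'" "h ** h' ** (g' ** g) = h ** (h' ** g') ** g"
    by (simp_all add: matrix_mul_assoc)
  then have "g' ** g ** (h ** h') = mat 1" "h ** h' ** (g' ** g) = mat 1" using g g' by simp_all
  then show ?thesis unfolding gl_orbit_iff using g(3) g'(3) transport_transport by metis
qed

lemma gl_orbit_sym:
  assumes "y \<in> gl_orbit x" shows "x \<in> gl_orbit y"
proof -
  obtain g h where g: "g ** h = mat 1" "h ** g = mat 1" "y = transport g h x"
    using assms unfolding gl_orbit_iff by blast
  then have "x = transport h g y" by (simp add: transport_transport)
  then show ?thesis unfolding gl_orbit_iff using g by blast
qed

lemma gl_orbit_eq_iff: "gl_orbit y = gl_orbit x \<longleftrightarrow> y \<in> gl_orbit x"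
  using gl_orbit_self gl_orbit_sym gl_orbit_trans by blast

lemma gl_orbit_alg_points:
  assumes "y \<in> gl_orbit x" "x \<in> alg_points" shows "y \<in> alg_points"
proof -
  obtain g h where g: "g ** h = mat 1" "h ** g = mat 1" "y = transport g h x"
    using assms unfolding gl_orbit_iff by blast
  have "h *v (g *v a) = a" for a by (simp add: matrix_vector_mul_assoc g)
  then show ?thesis
    using assms(2) by (simp add: alg_points_iff_assoc g(3) alg_prod_transport)
qed

text \<open>The trace form is intrinsic, so its Gram matrix changes by congruence with
  \<open>h\<close> and the discriminant by the nonzero factor (det h)^2.\<close>

lemma gl_orbit_separable_locus:
  assumes "y \<in> gl_orbit x" "x \<in> separable_locus" shows "y \<in> separable_locus"
proof -
  obtain g h where g: "g ** h = mat 1" "h ** g = mat 1" "y = transport g h x"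
    using assms unfolding gl_orbit_iff by blast
  have hg: "h *v (g *v a) = a" for a by (simp add: matrix_vector_mul_assoc g)
  interpret separable_algebra x by unfold_locales (rule assms)
  have "left_mult y a = g ** left_mult x (h *v a) ** h" for a
    by (simp add: matrix_eq left_mult_mult g(3) alg_prod_transport flip: matrix_vector_mul_assoc)
  then have tr_y: "trace (left_mult y a) = tr (h *v a)" for a
    using trace_mul_sym[of g "left_mult x (h *v a) ** h"]
    by (simp add: tr_def g flip: matrix_mul_assoc)
  have tr_prod: "tr (c \<star> d) = (\<Sum>p\<in>UNIV. c $ p * (trace_form *v d) $ p)" for c d
  proof -
    have "c = (\<Sum>p\<in>UNIV. c $ p *s axis p 1)" by (simp add: basis_expansion)
    then have "tr (c \<star> d) = tr ((\<Sum>p\<in>UNIV. c $ p *s axis p 1) \<star> d)" by simp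
    also have "\<dots> = (\<Sum>p\<in>UNIV. c $ p * (trace_form *v d) $ p)"
      by (simp add: alg_prod_sum_left alg_prod_scale_left tr_sum tr_scale trace_form_mult)
    finally show ?thesis .
  qed
  have "h *v alg_prod y a b = (h *v a) \<star> (h *v b)" for a b
    by (simp add: g(3) alg_prod_transport hg)
  then have "trace (left_mult y (alg_prod y (axis i 1) (axis j 1))) =
      (Finite_Cartesian_Product.transpose h ** (trace_form ** h)) $ i $ j" for i j
    by (simp only: tr_y tr_prod matrix_vector_mul_assoc matrix_vector_mult_axis)
      (simp add: matrix_matrix_mult_def[of "Finite_Cartesian_Product.transpose h"],
        simp add: Finite_Cartesian_Product.transpose_def)
  then have "(\<chi> i j. trace (left_mult y (alg_prod y (axis i 1) (axis j 1)))) =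
      Finite_Cartesian_Product.transpose h ** (trace_form ** h)"
    unfolding vec_eq_iff by (simp del: alg_prod_axis)
  then have "discriminant y = det h * (det trace_form * det h)"
    by (simp add: discriminant_def det_mul det_transpose del: alg_prod_axis)
  moreover have "det h \<noteq> 0" using g by (metis invertible_def invertible_det_nz)
  ultimately show ?thesis
    using det_trace_form assms gl_orbit_alg_points by (auto simp: separable_locus_def)
qed

lemma isomorphic_imp_gl_orbit:
  fixes x y :: "('k::field, 'n::finite) tensor"
  assumes G: "Vector_Spaces.linear (*s) (*s) G" and H: "Vector_Spaces.linear (*s) (*s) H"
    and GH: "\<And>a. G (H a) = a" "\<And>a. H (G a) = a"
    and hom: "\<And>a b. G (alg_prod x a b) = alg_prod y (G a) (G b)"
  shows "y \<in> gl_orbit x"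
  unfolding gl_orbit_iff
proof (intro exI conjI)
  show "matrix G ** matrix H = mat 1" "matrix H ** matrix G = mat 1"
    by (simp_all add: matrix_eq matrix_works[OF G] matrix_works[OF H] GH flip: matrix_vector_mul_assoc)
  show "y = transport (matrix G) (matrix H) x"
    by (rule tensor_eqI) (simp add: alg_prod_transport matrix_works[OF G] matrix_works[OF H] hom GH)
qed

section \<open>Isomorphism through matrix units\<close>

lemma matrix_units_finite:
  assumes "matrix_units x I R E" shows "finite R"
  using assms equiv_type unfolding matrix_units_def by (metis finite_SigmaI finite_subset)

text \<open>The coordinate at (k, l) is read off from E_kk a E_ll = \<psi>_kl(a) E_kl. As E_kl is
  nonzero, this makes arbitrarily chosen expansion coefficients unique and linear.\<close>

lemma matrix_units_coords:
  assumes mu: "matrix_units x I R E"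
  obtains \<psi> where "\<And>a. a = (\<Sum>(i, j)\<in>R. \<psi> i j a *s E i j)"
    "\<And>i j a b. (i, j) \<in> R \<Longrightarrow> \<psi> i j (a + b) = \<psi> i j a + \<psi> i j b"
    "\<And>i j c a. (i, j) \<in> R \<Longrightarrow> \<psi> i j (c *s a) = c * \<psi> i j a"
    "\<And>i j k l. (i, j) \<in> R \<Longrightarrow> (k, l) \<in> R \<Longrightarrow> \<psi> i j (E k l) = (if i = k \<and> j = l then 1 else 0)"
proof -
  have eq: "equiv I R" and E0: "\<And>i j. (i, j) \<in> R \<Longrightarrow> E i j \<noteq> 0"
    and EE: "\<And>i j k l. (i, j) \<in> R \<Longrightarrow> (k, l) \<in> R \<Longrightarrow> alg_prod x (E i j) (E k l) = (if j = k then E i l else 0)"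
    and span: "\<And>a. \<exists>c. a = (\<Sum>(i, j)\<in>R. c i j *s E i j)"
    using mu unfolding matrix_units_def by blast+
  have finR: "finite R" using mu by (rule matrix_units_finite)
  have rfl: "(i, i) \<in> R" "(j, j) \<in> R" if "(i, j) \<in> R" for i j
    using eq that by (meson equivE refl_onD symD transD)+
  obtain c where c: "\<And>a. a = (\<Sum>(i, j)\<in>R. c a i j *s E i j)" using span by metis
  define \<psi> where "\<psi> i j a = c a i j" for i j a
  have \<psi>: "a = (\<Sum>(i, j)\<in>R. \<psi> i j a *s E i j)" for a unfolding \<psi>_def by (rule c)
  have comp: "alg_prod x (alg_prod x (E k k) a) (E l l) = \<psi> k l a *s E k l" if kl: "(k, l) \<in> R" for k l a
  proof -
    have "alg_prod x (alg_prod x (E k k) a) (E l l) =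
        alg_prod x (alg_prod x (E k k) (\<Sum>(i, j)\<in>R. \<psi> i j a *s E i j)) (E l l)" by (simp flip: \<psi>)
    also have "\<dots> = (\<Sum>p\<in>R. if p = (k, l) then \<psi> k l a *s E k l else 0)"
      unfolding alg_prod_sum_left alg_prod_sum_right
      by (intro sum.cong refl) (use kl rfl[OF kl] in \<open>auto simp: EE alg_prod_scale_left alg_prod_scale_right split: if_splits\<close>)
    also have "\<dots> = \<psi> k l a *s E k l" using kl finR by simp
    finally show ?thesis .
  qed
  show thesis
  proof (rule that[of \<psi>])
    show "a = (\<Sum>(i, j)\<in>R. \<psi> i j a *s E i j)" for a by (rule \<psi>)
    show "\<psi> i j (a + b) = \<psi> i j a + \<psi> i j b" if ij: "(i, j) \<in> R" for i j a b
    proof -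
      have "\<psi> i j (a + b) *s E i j = (\<psi> i j a + \<psi> i j b) *s E i j"
        by (simp add: alg_prod_bilin vec.scale_left_distrib flip: comp[OF ij])
      then show ?thesis using E0[OF ij] by (simp only: vector_mul_rcancel simp_thms)
    qed
    show "\<psi> i j (c *s a) = c * \<psi> i j a" if ij: "(i, j) \<in> R" for i j c a
    proof -
      have "\<psi> i j (c *s a) *s E i j = (c * \<psi> i j a) *s E i j"
        by (simp add: alg_prod_bilin flip: comp[OF ij] vector_smult_assoc)
      then show ?thesis using E0[OF ij] by (simp only: vector_mul_rcancel simp_thms)
    qed
    show "\<psi> i j (E k l) = (if i = k \<and> j = l then 1 else 0)" if ij: "(i, j) \<in> R" "(k, l) \<in> R" for i j k l
    proof -
      have "\<psi> i j (E k l) *s E i j = alg_prod x (alg_prod x (E i i) (E k l)) (E j j)"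
        by (simp only: comp[OF ij(1)])
      also have "\<dots> = (if i = k \<and> j = l then 1 else 0) *s E i j"
        using ij rfl[OF ij(1)] rfl[OF ij(2)] by (auto simp: EE)
      finally show ?thesis using E0[OF ij(1)] by (simp only: vector_mul_rcancel simp_thms)
    qed
  qed
qed

text \<open>The multiplication table depends on \<open>R\<close> alone, so matching matrix units
  with equal indices is an algebra isomorphism, with inverse built from the coordinates of the other
  family.\<close>

lemma matrix_units_imp_gl_orbit:
  fixes x y :: "('k::field, 'n::finite) tensor"
  assumes mu: "matrix_units x I R E" and mu': "matrix_units y I R E'"
  shows "y \<in> gl_orbit x"
proof -
  have EE: "\<And>p q. p \<in> R \<Longrightarrow> q \<in> R \<Longrightarrow>
      alg_prod x (case p of (i, j) \<Rightarrow> E i j) (case q of (i, j) \<Rightarrow> E i j) =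
      (if snd p = fst q then E (fst p) (snd q) else 0)"
    and EE': "\<And>p q. p \<in> R \<Longrightarrow> q \<in> R \<Longrightarrow>
      alg_prod y (case p of (i, j) \<Rightarrow> E' i j) (case q of (i, j) \<Rightarrow> E' i j) =
      (if snd p = fst q then E' (fst p) (snd q) else 0)"
    using mu mu' unfolding matrix_units_def by (auto split: prod.splits)
  have tr: "(fst p, snd q) \<in> R" if "p \<in> R" "q \<in> R" "snd p = fst q" for p q
  proof -
    have "trans R" using mu by (auto simp: matrix_units_def elim: equivE)
    then show ?thesis using that by (metis prod.collapse transD)
  qed
  have finR: "finite R" using mu by (rule matrix_units_finite)
  obtain \<psi> where \<psi>: "\<And>a. a = (\<Sum>(i, j)\<in>R. \<psi> i j a *s E i j)"
    and \<psi>_add: "\<And>i j a b. (i, j) \<in> R \<Longrightarrow> \<psi> i j (a + b) = \<psi> i j a + \<psi> i j b"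
    and \<psi>_scale: "\<And>i j c a. (i, j) \<in> R \<Longrightarrow> \<psi> i j (c *s a) = c * \<psi> i j a"
    and \<psi>_E: "\<And>i j k l. (i, j) \<in> R \<Longrightarrow> (k, l) \<in> R \<Longrightarrow> \<psi> i j (E k l) = (if i = k \<and> j = l then 1 else 0)"
    by (fact matrix_units_coords[OF mu])
  obtain \<psi>' where \<psi>': "\<And>a. a = (\<Sum>(i, j)\<in>R. \<psi>' i j a *s E' i j)"
    and \<psi>'_add: "\<And>i j a b. (i, j) \<in> R \<Longrightarrow> \<psi>' i j (a + b) = \<psi>' i j a + \<psi>' i j b"
    and \<psi>'_scale: "\<And>i j c a. (i, j) \<in> R \<Longrightarrow> \<psi>' i j (c *s a) = c * \<psi>' i j a"
    and \<psi>'_E: "\<And>i j k l. (i, j) \<in> R \<Longrightarrow> (k, l) \<in> R \<Longrightarrow> \<psi>' i j (E' k l) = (if i = k \<and> j = l then 1 else 0)"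
    by (fact matrix_units_coords[OF mu'])
  define G where "G a = (\<Sum>(i, j)\<in>R. \<psi> i j a *s E' i j)" for a
  define H where "H a = (\<Sum>(i, j)\<in>R. \<psi>' i j a *s E i j)" for a
  have G: "Vector_Spaces.linear (*s) (*s) G"
    by unfold_locales
      (auto simp: G_def \<psi>_add \<psi>_scale vec.scale_left_distrib vec_scale_sum vector_smult_assoc
        intro!: sum.cong simp flip: sum.distrib)
  have H: "Vector_Spaces.linear (*s) (*s) H"
    by unfold_locales
      (auto simp: H_def \<psi>'_add \<psi>'_scale vec.scale_left_distrib vec_scale_sum vector_smult_assoc
        intro!: sum.cong simp flip: sum.distrib)
  have GE: "G (E i j) = E' i j" if "(i, j) \<in> R" for i j
  proof -
    have "G (E i j) = (\<Sum>p\<in>R. if p = (i, j) then E' i j else 0)"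
      unfolding G_def by (intro sum.cong refl) (use that in \<open>auto simp: \<psi>_E split: if_splits\<close>)
    then show ?thesis using that finR by simp
  qed
  have HE: "H (E' i j) = E i j" if "(i, j) \<in> R" for i j
  proof -
    have "H (E' i j) = (\<Sum>p\<in>R. if p = (i, j) then E i j else 0)"
      unfolding H_def by (intro sum.cong refl) (use that in \<open>auto simp: \<psi>'_E split: if_splits\<close>)
    then show ?thesis using that finR by simp
  qed
  have G_sum: "G (\<Sum>(i, j)\<in>R. c i j *s E i j) = (\<Sum>(i, j)\<in>R. c i j *s E' i j)" for c
    unfolding vec.linear_sum[OF G]
    by (intro sum.cong refl) (auto simp: vec.linear_scale[OF G] GE)
  have H_sum: "H (\<Sum>(i, j)\<in>R. c i j *s E' i j) = (\<Sum>(i, j)\<in>R. c i j *s E i j)" for c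
    unfolding vec.linear_sum[OF H]
    by (intro sum.cong refl) (auto simp: vec.linear_scale[OF H] HE)
  show ?thesis
  proof (rule isomorphic_imp_gl_orbit[OF G H])
    show "G (H a) = a" for a unfolding H_def G_sum using \<psi>'[of a] by simp
    show "H (G a) = a" for a unfolding G_def H_sum using \<psi>[of a] by simp
    fix a b
    have "G (alg_prod x a b) =
      G (alg_prod x (\<Sum>p\<in>R. case p of (i, j) \<Rightarrow> \<psi> i j a *s E i j) (\<Sum>p\<in>R. case p of (i, j) \<Rightarrow> \<psi> i j b *s E i j))"
      by (simp flip: \<psi>)
    also have "\<dots> = (\<Sum>p\<in>R. \<Sum>q\<in>R. alg_prod y (G (case p of (i, j) \<Rightarrow> \<psi> i j a *s E i j))
        (G (case q of (i, j) \<Rightarrow> \<psi> i j b *s E i j)))"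
      unfolding alg_prod_sum_left alg_prod_sum_right vec.linear_sum[OF G]
    proof (subst sum.swap, intro sum.cong refl)
      fix p q assume "p \<in> R" "q \<in> R"
      then show "G (alg_prod x (case p of (i, j) \<Rightarrow> \<psi> i j a *s E i j) (case q of (i, j) \<Rightarrow> \<psi> i j b *s E i j)) =
          alg_prod y (G (case p of (i, j) \<Rightarrow> \<psi> i j a *s E i j)) (G (case q of (i, j) \<Rightarrow> \<psi> i j b *s E i j))"
        using EE[of p q] EE'[of p q] tr[of p q]
        by (cases p; cases q) (auto simp: alg_prod_bilin vec.linear_scale[OF G] vec.linear_0[OF G] GE)
    qed
    also have "\<dots> = alg_prod y (G (\<Sum>p\<in>R. case p of (i, j) \<Rightarrow> \<psi> i j a *s E i j))
        (G (\<Sum>p\<in>R. case p of (i, j) \<Rightarrow> \<psi> i j b *s E i j))"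
      unfolding vec.linear_sum[OF G] alg_prod_sum_left alg_prod_sum_right by (rule sum.swap)
    also have "\<dots> = alg_prod y (G a) (G b)" by (simp flip: \<psi>)
    finally show "G (alg_prod x a b) = alg_prod y (G a) (G b)" .
  qed
qed

lemma matrix_units_reindex:
  assumes mu: "matrix_units x I' R' E" and \<pi>: "bij_betw \<pi> I I'" and eq: "equiv I R"
    and R: "\<And>i j. i \<in> I \<Longrightarrow> j \<in> I \<Longrightarrow> (i, j) \<in> R \<longleftrightarrow> (\<pi> i, \<pi> j) \<in> R'"
  shows "matrix_units x I R (\<lambda>i j. E (\<pi> i) (\<pi> j))"
proof -
  have RI: "R \<subseteq> I \<times> I" and R'I: "R' \<subseteq> I' \<times> I'"
    using eq mu unfolding matrix_units_def by (auto dest: equiv_type)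
  have inj: "inj_on \<pi> I" and im: "\<pi> ` I = I'" using \<pi> by (auto simp: bij_betw_def)
  have bij: "bij_betw (map_prod \<pi> \<pi>) R R'"
    unfolding bij_betw_def
  proof
    show "inj_on (map_prod \<pi> \<pi>) R" using inj_on_subset[OF map_prod_inj_on[OF inj inj] RI] .
    show "map_prod \<pi> \<pi> ` R = R'"
    proof (intro equalityI subsetI)
      fix p assume "p \<in> R'"
      moreover then obtain i j where "i \<in> I" "j \<in> I" "p = (\<pi> i, \<pi> j)" using R'I im by fast
      ultimately show "p \<in> map_prod \<pi> \<pi> ` R" using R by (auto intro!: image_eqI[of _ _ "(i, j)"])
    qed (use R RI in auto)
  qed
  have fin: "finite I" using mu \<pi> bij_betw_finite unfolding matrix_units_def by blast
  have span: "\<exists>c. a = (\<Sum>(i, j)\<in>R. c i j *s E (\<pi> i) (\<pi> j))" for a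
  proof -
    obtain c where "a = (\<Sum>(i, j)\<in>R'. c i j *s E i j)" using mu unfolding matrix_units_def by blast
    then have "a = (\<Sum>(i, j)\<in>R. c (\<pi> i) (\<pi> j) *s E (\<pi> i) (\<pi> j))"
      unfolding sum.reindex_bij_betw[OF bij, symmetric] by (simp add: case_prod_beta)
    then show ?thesis by (rule exI[of _ "\<lambda>i j. c (\<pi> i) (\<pi> j)"])
  qed
  have \<pi>_eq: "\<pi> i = \<pi> j \<longleftrightarrow> i = j" if "(k, i) \<in> R" "(j, l) \<in> R" for i j k l
    using inj_on_eq_iff[OF inj, of i j] that RI by blast
  have R': "(\<pi> i, \<pi> j) \<in> R'" if "(i, j) \<in> R" for i j using R that RI by blast
  have E0: "E (\<pi> i) (\<pi> j) \<noteq> 0" if "(i, j) \<in> R" for i j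
    using mu R'[OF that] unfolding matrix_units_def by blast
  have "alg_prod x (E (\<pi> i) (\<pi> j)) (E (\<pi> k) (\<pi> l)) = (if j = k then E (\<pi> i) (\<pi> l) else 0)"
    if "(i, j) \<in> R" "(k, l) \<in> R" for i j k l
  proof -
    have "alg_prod x (E (\<pi> i) (\<pi> j)) (E (\<pi> k) (\<pi> l)) = (if \<pi> j = \<pi> k then E (\<pi> i) (\<pi> l) else 0)"
      using mu R'[OF that(1)] R'[OF that(2)] unfolding matrix_units_def by blast
    then show ?thesis by (simp only: \<pi>_eq[OF that])
  qed
  then show ?thesis
    unfolding matrix_units_def using fin eq span E0 by (intro conjI) blast+
qed

lemma matrix_units_transport:
  fixes x :: "('k::field, 'n::finite) tensor"
  assumes mu: "matrix_units x I R E" and g: "g ** h = mat 1" "h ** g = mat 1"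
  shows "matrix_units (transport g h x) I R (\<lambda>i j. g *v E i j)"
proof -
  have gh: "g *v (h *v a) = a" "h *v (g *v a) = a" for a by (simp_all add: matrix_vector_mul_assoc g)
  have span: "\<exists>c. a = (\<Sum>(i, j)\<in>R. c i j *s (g *v E i j))" for a
  proof -
    obtain c where "h *v a = (\<Sum>(i, j)\<in>R. c i j *s E i j)" using mu unfolding matrix_units_def by blast
    then have "g *v (h *v a) = (\<Sum>(i, j)\<in>R. c i j *s (g *v E i j))"
      by (simp add: case_prod_beta matrix_vector_mult_sum matrix_vector_mult_scale)
    then show ?thesis by (auto simp: gh)
  qed
  have EE: "alg_prod x (E i j) (E k l) = (if j = k then E i l else 0)" if "(i, j) \<in> R" "(k, l) \<in> R" for i j k l
    using mu that unfolding matrix_units_def by blast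
  have g0: "g *v a \<noteq> 0" if "a \<noteq> 0" for a using gh(2)[of a] that by auto
  have E0: "g *v E i j \<noteq> 0" if "(i, j) \<in> R" for i j
    using mu that by (intro g0) (auto simp: matrix_units_def)
  have "finite I" "equiv I R" using mu by (simp_all add: matrix_units_def)
  then show ?thesis
    using span E0 unfolding matrix_units_def by (auto simp: alg_prod_transport gh EE)
qed

section \<open>Block sizes and rational invariants\<close>

text \<open>Vandermonde by interpolation: \<open>q\<close> vanishes at every node except c_m, so
  combining the power sums with the coefficients of \<open>q\<close> leaves a_m q(c_m).\<close>

lemma vandermonde_zero:
  fixes a c :: "nat \<Rightarrow> 'k::field"
  assumes S: "finite S" and inj: "inj_on c S" and z: "\<And>k. k \<le> card S \<Longrightarrow> (\<Sum>m\<in>S. a m * c m ^ k) = 0"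
    and m: "m \<in> S"
  shows "a m = 0"
proof -
  define q where "q = (\<Prod>m'\<in>S - {m}. [:- c m', 1:])"
  have deg: "Polynomial.degree q \<le> card S"
    unfolding q_def
    by (rule order_trans[OF degree_prod_sum_le]) (use S in \<open>auto intro: card_mono\<close>)
  have q: "poly q t = (\<Prod>m'\<in>S - {m}. t - c m')" for t by (simp add: q_def poly_prod)
  have "(\<Sum>m'\<in>S. a m' * poly q (c m')) = (\<Sum>m'\<in>S. if m' = m then a m * poly q (c m) else 0)"
    by (intro sum.cong refl) (use S in \<open>auto simp: q\<close>)
  also have "\<dots> = a m * poly q (c m)" using S m by simp
  also have "(\<Sum>m'\<in>S. a m' * poly q (c m')) =
      (\<Sum>k\<le>Polynomial.degree q. Polynomial.coeff q k * (\<Sum>m'\<in>S. a m' * c m' ^ k))"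
    unfolding poly_altdef sum_distrib_left by (subst sum.swap) (simp add: mult_ac)
  also have "\<dots> = 0" using z deg by (intro sum.neutral) auto
  finally have "a m * poly q (c m) = 0" ..
  moreover have "poly q (c m) \<noteq> 0" using S inj m by (auto simp: q inj_on_def)
  ultimately show ?thesis by simp
qed

lemma quotient_eq_class:
  assumes "equiv A r" "C \<in> A // r" "i \<in> C" shows "r `` {i} = C"
  using assms by (auto simp: quotient_def) (meson equivE symD transD)+

text \<open>The elements lying in classes of size m number m times those classes, so equal counts
  give equally many classes of each size. A size-preserving bijection of classes is then filled in
  by bijections within classes.\<close>

lemma equiv_bij_of_card_eq:
  assumes I: "finite I" "equiv I R" and I': "finite I'" "equiv I' R'"
    and c: "\<And>m. card {i \<in> I. card (R `` {i}) = m} = card {i \<in> I'. card (R' `` {i}) = m}"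
  shows "\<exists>\<pi>. bij_betw \<pi> I I' \<and> (\<forall>i\<in>I. \<forall>j\<in>I. (i, j) \<in> R \<longleftrightarrow> (\<pi> i, \<pi> j) \<in> R')"
proof -
  have card_classes: "m * card {C \<in> I // R. card C = m} = card {i \<in> I. card (R `` {i}) = m}"
    if "finite I" "equiv I R" for I :: "'c set" and R m
  proof -
    have "m * card {C \<in> I // R. card C = m} = card (\<Union>{C \<in> I // R. card C = m})"
    proof (rule card_partition)
      show "finite {C \<in> I // R. card C = m}" using that by (simp add: finite_quotient equiv_type)
      show "finite (\<Union>{C \<in> I // R. card C = m})"
        using that by (intro finite_subset[OF _ that(1)]) (auto dest: in_quotient_imp_subset)
    qed (use quotient_disj[OF that(2)] in auto)
    also have "\<Union>{C \<in> I // R. card C = m} = {i \<in> I. card (R `` {i}) = m}"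
    proof (intro equalityI subsetI)
      fix i assume "i \<in> \<Union>{C \<in> I // R. card C = m}"
      then obtain C where C: "C \<in> I // R" "card C = m" "i \<in> C" by blast
      then have "i \<in> I" using in_quotient_imp_subset[OF that(2)] by blast
      moreover have "C = R `` {i}" using quotient_eq_class[OF that(2) C(1,3)] ..
      ultimately show "i \<in> {i \<in> I. card (R `` {i}) = m}" using C by simp
    next
      fix i assume "i \<in> {i \<in> I. card (R `` {i}) = m}"
      then show "i \<in> \<Union>{C \<in> I // R. card C = m}"
        using equiv_class_self[OF that(2)] by (auto simp: quotient_def)
    qed
    finally show ?thesis .
  qed
  have fin: "finite C" if "C \<in> I // R" for C
    using that I in_quotient_imp_subset finite_subset by metis
  have fin': "finite C" if "C \<in> I' // R'" for C
    using that I' in_quotient_imp_subset finite_subset by metis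
  have ne: "C \<noteq> {}" if "C \<in> I // R" for C using that I(2) in_quotient_imp_non_empty by metis
  have ne': "C \<noteq> {}" if "C \<in> I' // R'" for C using that I'(2) in_quotient_imp_non_empty by metis
  have pos: "card C \<noteq> 0" if "C \<in> I // R" for C using fin[OF that] ne[OF that] by simp
  have pos': "card C \<noteq> 0" if "C \<in> I' // R'" for C using fin'[OF that] ne'[OF that] by simp
  have "\<exists>\<beta>. bij_betw \<beta> {C \<in> I // R. card C = m} {C \<in> I' // R'. card C = m}" for m
  proof (rule finite_same_card_bij)
    show "finite {C \<in> I // R. card C = m}" "finite {C \<in> I' // R'. card C = m}"
      using I I' by (simp_all add: finite_quotient equiv_type)
    show "card {C \<in> I // R. card C = m} = card {C \<in> I' // R'. card C = m}"
    \<comment> \<open>Dividing by m fails for m = 0; there both sides are empty, since classes are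
      nonempty and finite.\<close>
    proof (cases "m = 0")
      case True
      have "{C \<in> I // R. card C = m} = {}" "{C \<in> I' // R'. card C = m} = {}"
        using True pos pos' by auto
      then show ?thesis by (simp only: card.empty)
    next
      case False
      have "m * card {C \<in> I // R. card C = m} = m * card {C \<in> I' // R'. card C = m}"
        unfolding card_classes[OF I] card_classes[OF I'] by (rule c)
      then show ?thesis using False by simp
    qed
  qed
  then obtain \<beta> where \<beta>: "\<And>m. bij_betw (\<beta> m) {C \<in> I // R. card C = m} {C \<in> I' // R'. card C = m}"
    by metis
  define b where "b C = \<beta> (card C) C" for C
  have b: "b C \<in> I' // R'" "card (b C) = card C" if "C \<in> I // R" for C
    using bij_betwE[OF \<beta>[of "card C"]] that by (auto simp: b_def)
  have b_inj: "C = D" if "C \<in> I // R" "D \<in> I // R" "b C = b D" for C D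
  proof -
    have "card C = card D" using b that by metis
    then show ?thesis
      using bij_betw_imp_inj_on[OF \<beta>[of "card C"]] that by (auto simp: b_def inj_on_def)
  qed
  have b_surj: "\<exists>C\<in>I // R. b C = D" if "D \<in> I' // R'" for D
  proof -
    have "D \<in> \<beta> (card D) ` {C \<in> I // R. card C = card D}"
      using bij_betw_imp_surj_on[OF \<beta>[of "card D"]] that by simp
    then obtain C where C: "C \<in> I // R" "card C = card D" "\<beta> (card D) C = D" by auto
    have "b C = D" unfolding b_def C(2) by (rule C(3))
    with C(1) show ?thesis by blast
  qed
  have "\<exists>\<gamma>. bij_betw \<gamma> C (b C)" if "C \<in> I // R" for C
    using b[OF that] fin fin' that by (intro finite_same_card_bij) auto
  then obtain \<gamma> where \<gamma>: "\<And>C. C \<in> I // R \<Longrightarrow> bij_betw (\<gamma> C) C (b C)" by metis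
  define \<pi> where "\<pi> i = \<gamma> (R `` {i}) i" for i
  have cl: "R `` {i} \<in> I // R" "i \<in> R `` {i}" if "i \<in> I" for i
    using that equiv_class_self[OF I(2)] by (auto intro: quotientI)
  have \<pi>_in: "\<pi> i \<in> b (R `` {i})" if "i \<in> I" for i
    using bij_betwE[OF \<gamma>[OF cl(1)[OF that]]] cl(2)[OF that] by (simp add: \<pi>_def)
  have in_class: "R' `` {j} = D" if "D \<in> I' // R'" "j \<in> D" for D j
    by (rule quotient_eq_class[OF I'(2) that])
  have \<pi>_cl: "R' `` {\<pi> i} = b (R `` {i})" if "i \<in> I" for i
    using in_class[OF b(1)[OF cl(1)[OF that]] \<pi>_in[OF that]] .
  have \<pi>_I: "\<pi> i \<in> I'" if "i \<in> I" for i
    using \<pi>_in[OF that] b(1)[OF cl(1)[OF that]] in_quotient_imp_subset[OF I'(2)] by blast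
  have rel: "(i, j) \<in> R \<longleftrightarrow> (\<pi> i, \<pi> j) \<in> R'" if ij: "i \<in> I" "j \<in> I" for i j
  proof -
    have "(i, j) \<in> R \<longleftrightarrow> R `` {i} = R `` {j}" using eq_equiv_class_iff[OF I(2)] ij by blast
    also have "\<dots> \<longleftrightarrow> b (R `` {i}) = b (R `` {j})" using b_inj cl(1) ij by metis
    also have "\<dots> \<longleftrightarrow> (\<pi> i, \<pi> j) \<in> R'"
      using eq_equiv_class_iff[OF I'(2)] \<pi>_I ij \<pi>_cl by metis
    finally show ?thesis .
  qed
  have "bij_betw \<pi> I I'"
    unfolding bij_betw_def
  proof
    show "inj_on \<pi> I"
    proof (rule inj_onI)
      fix i j assume ij: "i \<in> I" "j \<in> I" "\<pi> i = \<pi> j"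
      then have "(\<pi> i, \<pi> j) \<in> R'" using I'(2) \<pi>_I by (metis equivE refl_onD)
      then have ijR: "(i, j) \<in> R" using rel ij by blast
      then have e: "R `` {i} = R `` {j}" using equiv_class_eq[OF I(2)] by blast
      have "\<gamma> (R `` {i}) i = \<gamma> (R `` {i}) j" using ij(3) e by (simp add: \<pi>_def)
      moreover have "j \<in> R `` {i}" using ijR by blast
      ultimately show "i = j"
        using bij_betw_imp_inj_on[OF \<gamma>[OF cl(1)[OF ij(1)]]] cl(2)[OF ij(1)] by (auto simp: inj_on_def)
    qed
    show "\<pi> ` I = I'"
    proof (intro equalityI subsetI)
      fix j assume j: "j \<in> I'"
      have "R' `` {j} \<in> I' // R'" using j by (rule quotientI)
      then obtain C where C: "C \<in> I // R" "b C = R' `` {j}" using b_surj by blast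
      have "j \<in> b C" using C(2) equiv_class_self[OF I'(2) j] by simp
      then have "j \<in> \<gamma> C ` C" using bij_betw_imp_surj_on[OF \<gamma>[OF C(1)]] by simp
      then obtain i where i: "i \<in> C" "\<gamma> C i = j" by blast
      have "i \<in> I" using i(1) C(1) in_quotient_imp_subset[OF I(2)] by blast
      moreover have "R `` {i} = C" by (rule quotient_eq_class[OF I(2) C(1) i(1)])
      ultimately show "j \<in> \<pi> ` I" using i(2) by (auto simp: \<pi>_def)
    qed (use \<pi>_I in auto)
  qed
  with rel show ?thesis by blast
qed

section \<open>Power sums that detect block sizes\<close>

context separable_algebra
begin

text \<open>The regular representation of \<open>omega\<close> is multiplication by $d^{-2}$ on a
  block of $d \times d$ matrices.\<close>

definition omega :: "'k^'n" where
  "omega = (\<Sum>i\<in>UNIV. \<Sum>j\<in>UNIV. axis i 1 \<star> axis j 1 \<star> dual i \<star> dual j)"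

definition omega_power :: "nat \<Rightarrow> 'k^'n" where
  "omega_power k = ((\<lambda>a. omega \<star> a) ^^ k) unit"

definition chi :: "nat \<Rightarrow> 'k" where "chi k = tr (omega_power k)"

text \<open>Each of the two Casimir tensors in \<open>omega\<close> is replaced in turn, the other
  being frozen inside the bilinear map.\<close>

lemma omega_change_basis:
  assumes u: "\<And>a. a = (\<Sum>s\<in>S. tr (a \<star> u' s) *s u s)"
  shows "omega = (\<Sum>s\<in>S. \<Sum>t\<in>S. u s \<star> u t \<star> u' s \<star> u' t)"
proof -
  have "is_bilinear (\<lambda>p q. \<Sum>j\<in>UNIV. p \<star> axis j 1 \<star> q \<star> dual j)"
    unfolding is_bilinear_def is_linear_def
    by (intro conjI allI; unfold_locales)
      (simp_all add: alg_prod_add_left alg_prod_add_right alg_prod_scale_left alg_prod_scale_right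
        sum.distrib vec_scale_sum)
  from casimir_change_basis[OF this u]
  have "omega = (\<Sum>s\<in>S. \<Sum>j\<in>UNIV. u s \<star> axis j 1 \<star> u' s \<star> dual j)" by (simp add: omega_def)
  also have "\<dots> = (\<Sum>s\<in>S. \<Sum>t\<in>S. u s \<star> u t \<star> u' s \<star> u' t)"
  proof (rule sum.cong[OF refl])
    fix s
    have "is_bilinear (\<lambda>p q. u s \<star> p \<star> u' s \<star> q)"
      unfolding is_bilinear_def is_linear_def
      by (intro conjI allI; unfold_locales)
        (simp_all add: alg_prod_add_left alg_prod_add_right alg_prod_scale_left alg_prod_scale_right)
    from casimir_change_basis[OF this u]
    show "(\<Sum>j\<in>UNIV. u s \<star> axis j 1 \<star> u' s \<star> dual j) = (\<Sum>t\<in>S. u s \<star> u t \<star> u' s \<star> u' t)" .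
  qed
  finally show ?thesis .
qed

text \<open>The trace is basis independent; this form lets it be computed in the basis of matrix
  units, whose index type differs from that of the standard basis.\<close>

lemma tr_coords:
  assumes \<psi>: "\<And>a. a = (\<Sum>(i, j)\<in>R. \<psi> i j a *s E i j)"
    and add: "\<And>i j a b. (i, j) \<in> R \<Longrightarrow> \<psi> i j (a + b) = \<psi> i j a + \<psi> i j b"
    and scale: "\<And>i j c a. (i, j) \<in> R \<Longrightarrow> \<psi> i j (c *s a) = c * \<psi> i j a"
  shows "tr a = (\<Sum>(i, j)\<in>R. \<psi> i j (a \<star> E i j))"
proof -
  have sum: "\<psi> i j (\<Sum>m\<in>A. f m *s v m) = (\<Sum>m\<in>A. f m * \<psi> i j (v m))" if "(i, j) \<in> R" for i j f v and A :: "'n set"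
  proof (induction A rule: infinite_finite_induct)
    case empty
    then show ?case using scale[OF that, of 0 0] by simp
  next
    case (infinite A)
    then show ?case using scale[OF that, of 0 0] by simp
  qed (simp add: add[OF that] scale[OF that])
  have "(a \<star> axis m 1) $ m = (\<Sum>p\<in>R. (a \<star> E (fst p) (snd p)) $ m * \<psi> (fst p) (snd p) (axis m 1))" for m
  proof -
    have "a \<star> axis m 1 = a \<star> (\<Sum>p\<in>R. \<psi> (fst p) (snd p) (axis m 1) *s E (fst p) (snd p))"
      using \<psi>[of "axis m 1"] by (simp add: case_prod_beta)
    then show ?thesis by (simp add: alg_prod_bilin mult.commute)
  qed
  then have "tr a = (\<Sum>p\<in>R. \<Sum>m\<in>UNIV. (a \<star> E (fst p) (snd p)) $ m * \<psi> (fst p) (snd p) (axis m 1))"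
    unfolding tr_eq by (simp add: sum.swap[of _ UNIV])
  also have "\<dots> = (\<Sum>p\<in>R. \<psi> (fst p) (snd p) (a \<star> E (fst p) (snd p)))"
  proof (rule sum.cong[OF refl])
    fix p assume "p \<in> R"
    then have "(fst p, snd p) \<in> R" by simp
    from sum[OF this, of "\<lambda>m. (a \<star> E (fst p) (snd p)) $ m" "\<lambda>m. axis m 1" UNIV]
    show "(\<Sum>m\<in>UNIV. (a \<star> E (fst p) (snd p)) $ m * \<psi> (fst p) (snd p) (axis m 1)) = \<psi> (fst p) (snd p) (a \<star> E (fst p) (snd p))"
      by (simp add: basis_expansion)
  qed
  finally show ?thesis by (simp add: case_prod_beta)
qed

end

lemma sum_equiv:
  assumes "finite I" "equiv I R"
  shows "(\<Sum>(i, j)\<in>R. f i j) = (\<Sum>i\<in>I. \<Sum>j\<in>R `` {i}. f i j)"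
proof -
  have RI: "R \<subseteq> I \<times> I" using assms(2) by (rule equiv_type)
  then have "R = (SIGMA i:I. R `` {i})" by auto
  moreover have "finite (R `` {i})" for i by (rule finite_subset[of _ I]) (use RI assms(1) in auto)
  ultimately show ?thesis using sum.Sigma[OF assms(1), of "\<lambda>i. R `` {i}" f] by simp
qed

context split_separable_algebra
begin

text \<open>In a block of size d the regular trace of E_kl is d if k = l and 0 otherwise, so E_ji/d
  is dual to E_ij. The interlaced sum then collapses to d^(-2) times the diagonal units. Each row
  index of the block carries d basis vectors, whence the factor d.\<close>

lemma chi_matrix_units:
  assumes mu: "matrix_units x I R E"
  shows "chi k = (\<Sum>i\<in>I. of_nat (card (R `` {i})) * (inverse (of_nat (card (R `` {i}))) ^ 2) ^ k)"
proof -
  define d where "d i = (of_nat (card (R `` {i})) :: 'k)" for i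
  have I: "finite I" "equiv I R" using mu by (simp_all add: matrix_units_def)
  have finR: "finite R" using mu by (rule matrix_units_finite)
  have RI: "R \<subseteq> I \<times> I" using I(2) by (rule equiv_type)
  have rfl: "(i, i) \<in> R" if "i \<in> I" for i using I(2) that by (meson equivE refl_onD)
  have sm: "(j, i) \<in> R" if "(i, j) \<in> R" for i j using I(2) that by (meson equivE symD)
  have tns: "(i, l) \<in> R" if "(i, j) \<in> R" "(j, l) \<in> R" for i j l using I(2) that by (meson equivE transD)
  have inI: "i \<in> I" "j \<in> I" if "(i, j) \<in> R" for i j using that RI by auto
  have EE: "E i j \<star> E k l = (if j = k then E i l else 0)" if "(i, j) \<in> R" "(k, l) \<in> R" for i j k l
    using mu that unfolding matrix_units_def by blast
  have d0: "d i \<noteq> 0" if "i \<in> I" for i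
  proof -
    have "finite (R `` {i})" by (rule finite_subset[of _ I]) (use RI I(1) in auto)
    then show ?thesis using rfl[OF that] by (auto simp: d_def)
  qed
  obtain \<psi> where \<psi>: "\<And>a. a = (\<Sum>(i, j)\<in>R. \<psi> i j a *s E i j)"
    and \<psi>_add: "\<And>i j a b. (i, j) \<in> R \<Longrightarrow> \<psi> i j (a + b) = \<psi> i j a + \<psi> i j b"
    and \<psi>_scale: "\<And>i j c a. (i, j) \<in> R \<Longrightarrow> \<psi> i j (c *s a) = c * \<psi> i j a"
    and \<psi>_E: "\<And>i j k l. (i, j) \<in> R \<Longrightarrow> (k, l) \<in> R \<Longrightarrow> \<psi> i j (E k l) = (if i = k \<and> j = l then 1 else 0)"
    by (fact matrix_units_coords[OF mu])
  have \<psi>_0: "\<psi> i j 0 = 0" if "(i, j) \<in> R" for i j using \<psi>_scale[OF that, of 0 0] by simp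
  have trc: "tr a = (\<Sum>(i, j)\<in>R. \<psi> i j (a \<star> E i j))" for a
    by (rule tr_coords) (fact \<psi> \<psi>_add \<psi>_scale)+
  have tr_E: "tr (E k l) = (if k = l then d k else 0)" if kl: "(k, l) \<in> R" for k l
  proof -
    have "tr (E k l) = (\<Sum>(i, j)\<in>R. if i = k \<and> k = l then 1 else 0)"
      unfolding trc
    proof (intro sum.cong refl, clarify)
      fix i j assume ij: "(i, j) \<in> R"
      show "\<psi> i j (E k l \<star> E i j) = (if i = k \<and> k = l then 1 else 0)"
      proof (cases "l = i")
        case True
        then have kj: "(k, j) \<in> R" using kl ij tns by blast
        have e: "E k l \<star> E i j = E k j" using EE[OF kl ij] True by (simp only: if_True simp_thms)
        have kl_iff: "k = l \<longleftrightarrow> i = k" using True by blast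
        show ?thesis unfolding e \<psi>_E[OF ij kj] kl_iff by (simp only: simp_thms)
      next
        case False
        then have e: "E k l \<star> E i j = 0" using EE[OF kl ij] by (simp only: if_False)
        show ?thesis unfolding e \<psi>_0[OF ij] using False by auto
      qed
    qed
    also have "\<dots> = (\<Sum>i\<in>I. if i = k then (if k = l then d k else 0) else 0)"
      unfolding sum_equiv[OF I] by (intro sum.cong refl) (auto simp: d_def)
    also have "\<dots> = (if k = l then d k else 0)" using I(1) inI(1)[OF kl] by simp
    finally show ?thesis .
  qed
  have tr_dual_E: "tr (a \<star> E j i) = d i * \<psi> i j a" if ij: "(i, j) \<in> R" for i j a
  proof -
    have "tr (a \<star> E j i) = tr ((\<Sum>(k, l)\<in>R. \<psi> k l a *s E k l) \<star> E j i)" by (simp flip: \<psi>)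
    also have "\<dots> = (\<Sum>p\<in>R. if p = (i, j) then d i * \<psi> i j a else 0)"
      unfolding alg_prod_sum_left tr_sum
    proof (intro sum.cong refl)
      fix p assume p: "p \<in> R"
      obtain k l where kl: "p = (k, l)" by (cases p)
      have klR: "(k, l) \<in> R" using p kl by simp
      have "tr (E k l \<star> E j i) = (if k = i \<and> l = j then d i else 0)"
        using tr_E[of k i] tns[OF klR, of i] sm[OF ij] by (auto simp: EE[OF klR sm[OF ij]])
      then show "tr ((case p of (k, l) \<Rightarrow> \<psi> k l a *s E k l) \<star> E j i) = (if p = (i, j) then d i * \<psi> i j a else 0)"
        by (simp add: kl alg_prod_scale_left tr_scale)
    qed
    also have "\<dots> = d i * \<psi> i j a" using finR ij by simp
    finally show ?thesis .
  qed
  define u' where "u' p = inverse (d (fst p)) *s E (snd p) (fst p)" for p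
  have dual: "a = (\<Sum>p\<in>R. tr (a \<star> u' p) *s E (fst p) (snd p))" for a
  proof -
    have "tr (a \<star> u' (i, j)) = \<psi> i j a" if "(i, j) \<in> R" for i j
      using d0[OF inI(1)[OF that]]
      by (simp add: u'_def alg_prod_scale_right tr_scale tr_dual_E[OF that])
    then have "(\<Sum>p\<in>R. tr (a \<star> u' p) *s E (fst p) (snd p)) = (\<Sum>(i, j)\<in>R. \<psi> i j a *s E i j)"
      by (intro sum.cong refl) auto
    then show ?thesis using \<psi>[of a] by simp
  qed
  have omega: "omega = (\<Sum>i\<in>I. inverse (d i) ^ 2 *s E i i)"
  proof -
    have "omega = (\<Sum>p\<in>R. \<Sum>q\<in>R. E (fst p) (snd p) \<star> E (fst q) (snd q) \<star> u' p \<star> u' q)"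
      by (rule omega_change_basis[OF dual])
    also have "\<dots> = (\<Sum>p\<in>R. if fst p = snd p then inverse (d (fst p)) ^ 2 *s E (fst p) (fst p) else 0)"
    proof (rule sum.cong[OF refl])
      fix p assume p: "p \<in> R"
      obtain i j where ij: "p = (i, j)" "(i, j) \<in> R" using p by (cases p) auto
      \<comment> \<open>E_ij E_kl E_ji E_lk survives only for k = l = j = i, so a single q
        contributes, and only when p is diagonal. The two factors 1/d_i come from
        \<open>u' p\<close> and \<open>u' q\<close>.\<close>
      have "(\<Sum>q\<in>R. E (fst p) (snd p) \<star> E (fst q) (snd q) \<star> u' p \<star> u' q) =
        (\<Sum>q\<in>R. if q = (i, i) then (if i = j then inverse (d i) ^ 2 *s E i i else 0) else 0)"
      proof (rule sum.cong[OF refl])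
        fix q assume q: "q \<in> R"
        obtain k l where kl: "q = (k, l)" "(k, l) \<in> R" using q by (cases q) auto
        have "E i j \<star> E k l \<star> E j i \<star> E l k = (if j = k \<and> l = j \<and> i = l then E i i else 0)"
        proof (cases "j = k \<and> l = j")
          case True
          then have "E i j \<star> E k l \<star> E j i = E i i"
            using ij(2) sm[OF ij(2)] rfl inI[OF ij(2)] by (simp add: EE)
          then show ?thesis using True ij(2) kl(2) sm[OF kl(2)] rfl inI[OF ij(2)] by (auto simp: EE)
        next
          case False
          then have "E i j \<star> E k l \<star> E j i = 0"
            using ij(2) kl(2) sm[OF ij(2)] tns[of i j l] by (cases "j = k") (simp_all add: EE)
          then show ?thesis using False by auto
        qed
        then show "E (fst p) (snd p) \<star> E (fst q) (snd q) \<star> u' p \<star> u' q =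
            (if q = (i, i) then (if i = j then inverse (d i) ^ 2 *s E i i else 0) else 0)"
          by (auto simp: ij kl u'_def alg_prod_scale_left alg_prod_scale_right vector_smult_assoc power2_eq_square)
      qed
      also have "\<dots> = (if i = j then inverse (d i) ^ 2 *s E i i else 0)"
        using finR rfl inI[OF ij(2)] by simp
      finally show "(\<Sum>q\<in>R. E (fst p) (snd p) \<star> E (fst q) (snd q) \<star> u' p \<star> u' q) =
          (if fst p = snd p then inverse (d (fst p)) ^ 2 *s E (fst p) (fst p) else 0)"
        by (simp add: ij)
    qed
    also have "\<dots> = (\<Sum>(i, j)\<in>R. if i = j then inverse (d i) ^ 2 *s E i i else 0)"
      by (simp add: case_prod_beta)
    also have "\<dots> = (\<Sum>i\<in>I. inverse (d i) ^ 2 *s E i i)"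
      unfolding sum_equiv[OF I]
    proof (rule sum.cong[OF refl])
      fix i assume i: "i \<in> I"
      have "finite (R `` {i})" by (rule finite_subset[of _ I]) (use RI I(1) in auto)
      then show "(\<Sum>j\<in>R `` {i}. if i = j then inverse (d i) ^ 2 *s E i i else 0) = inverse (d i) ^ 2 *s E i i"
        using rfl[OF i] by simp
    qed
    finally show ?thesis .
  qed
  have omega_E: "omega \<star> E k l = inverse (d k) ^ 2 *s E k l" if kl: "(k, l) \<in> R" for k l
  proof -
    have "omega \<star> E k l = (\<Sum>i\<in>I. if i = k then inverse (d k) ^ 2 *s E k l else 0)"
      unfolding omega alg_prod_sum_left
      by (intro sum.cong refl) (auto simp: alg_prod_scale_left EE[OF rfl kl])
    then show ?thesis using I(1) inI(1)[OF kl] by simp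
  qed
  have power_E: "omega_power k \<star> E i j = (inverse (d i) ^ 2) ^ k *s E i j" if ij: "(i, j) \<in> R" for i j
  proof (induction k)
    case (Suc k)
    have "omega_power (Suc k) \<star> E i j = omega \<star> (omega_power k \<star> E i j)"
      by (simp add: omega_power_def assoc)
    then show ?case by (simp add: Suc alg_prod_scale_right omega_E[OF ij] vector_smult_assoc mult.commute)
  qed (simp add: omega_power_def)
  have "chi k = (\<Sum>(i, j)\<in>R. (inverse (d i) ^ 2) ^ k)"
    unfolding chi_def trc
    by (intro sum.cong refl) (auto simp: power_E \<psi>_scale \<psi>_E)
  also have "\<dots> = (\<Sum>i\<in>I. d i * (inverse (d i) ^ 2) ^ k)"
    unfolding sum_equiv[OF I] by (simp add: d_def)
  finally show ?thesis by (simp add: d_def)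
qed

lemma chi_0: "chi 0 = of_nat CARD('n)"
proof -
  have "left_mult x unit = mat 1" by (simp add: matrix_eq left_mult_mult)
  then show ?thesis by (simp add: chi_def omega_power_def tr_def trace_I)
qed

text \<open>\<open>N m\<close> counts indices, that is, m times the number of blocks of size m.
  Grouping by class size rewrites the invariant over the nodes m^(-2), which are the same for all
  algebras of dimension n.\<close>

lemma chi_block_count:
  assumes mu: "matrix_units x I R E"
  defines "N \<equiv> \<lambda>m. card {i \<in> I. card (R `` {i}) = m}"
  shows "chi k = (\<Sum>m = 1..CARD('n). of_nat (N m * m) * (inverse (of_nat m) ^ 2) ^ k)"
    and "N m \<le> CARD('n)" and "m \<notin> {1..CARD('n)} \<Longrightarrow> N m = 0"
proof -
  have I: "finite I" "equiv I R" using mu by (simp_all add: matrix_units_def)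
  have RI: "R \<subseteq> I \<times> I" using I(2) by (rule equiv_type)
  have pos: "card (R `` {i}) > 0" if "i \<in> I" for i
  proof -
    have "finite (R `` {i})" by (rule finite_subset[of _ I]) (use RI I(1) in auto)
    then show ?thesis using equiv_class_self[OF I(2) that] by (auto simp: card_gt_0_iff)
  qed
  \<comment> \<open>The power 0 gives the trace of the identity: the class sizes, summed over the
    indices, total n. This bounds every class size and the number of indices.\<close>
  have "of_nat (\<Sum>i\<in>I. card (R `` {i})) = (of_nat CARD('n) :: 'k)"
    using chi_matrix_units[OF mu, of 0] by (simp add: chi_0)
  then have sum: "(\<Sum>i\<in>I. card (R `` {i})) = CARD('n)" by (simp only: of_nat_eq_iff)
  have le: "card (R `` {i}) \<le> CARD('n)" if "i \<in> I" for i
    unfolding sum[symmetric] by (rule member_le_sum) (use that I in auto)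
  have "card I \<le> (\<Sum>i\<in>I. card (R `` {i}))"
    using sum_mono[of I "\<lambda>_. 1" "\<lambda>i. card (R `` {i})"] pos by (simp add: Suc_leI)
  then show "N m \<le> CARD('n)"
    using card_mono[OF I(1), of "{i \<in> I. card (R `` {i}) = m}"] unfolding N_def sum by simp
  show "N m = 0" if "m \<notin> {1..CARD('n)}"
  proof -
    have "card (R `` {i}) \<noteq> m" if "i \<in> I" for i
      using pos[OF that] le[OF that] \<open>m \<notin> {1..CARD('n)}\<close> by auto
    then have "{i \<in> I. card (R `` {i}) = m} = {}" by blast
    then show ?thesis unfolding N_def by (simp only: card.empty)
  qed
  let ?f = "\<lambda>m. of_nat m * (inverse (of_nat m) ^ 2) ^ k :: 'k"
  have "chi k = (\<Sum>m = 1..CARD('n). \<Sum>i\<in>{i \<in> I. card (R `` {i}) = m}. ?f (card (R `` {i})))"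
    unfolding chi_matrix_units[OF mu]
    by (rule sum.group[symmetric]) (use I pos le in \<open>auto simp: Suc_le_eq\<close>)
  also have "\<dots> = (\<Sum>m = 1..CARD('n). of_nat (N m * m) * (inverse (of_nat m) ^ 2) ^ k)"
    by (intro sum.cong refl) (simp add: N_def mult.assoc)
  finally show "chi k = (\<Sum>m = 1..CARD('n). of_nat (N m * m) * (inverse (of_nat m) ^ 2) ^ k)" .
qed

end

text \<open>The value is determined by the index counts, and these are functions from {1..n} to
  {0..n}.\<close>

lemma finite_chi_values:
  "finite {separable_algebra.chi (y :: ('k::{alg_closed_field, field_char_0}, 'n::finite) tensor) k | y. y \<in> separable_locus}"
proof (rule finite_subset)
  let ?n = "CARD('n)"
  let ?v = "\<lambda>N. \<Sum>m = 1..?n. of_nat (N m * m) * (inverse (of_nat m) ^ 2) ^ k :: 'k"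
  show "finite (?v ` (PiE {1..?n} (\<lambda>_. {0..?n})))" by (intro finite_imageI finite_PiE) auto
  show "{separable_algebra.chi (y :: ('k, 'n) tensor) k | y. y \<in> separable_locus} \<subseteq> ?v ` (PiE {1..?n} (\<lambda>_. {0..?n}))"
  proof clarify
    fix y :: "('k, 'n) tensor" assume "y \<in> separable_locus"
    then interpret split_separable_algebra y by unfold_locales
    obtain I :: "('k^'n) set" and R E where mu: "matrix_units y I R E" using ex_matrix_units by blast
    \<comment> \<open>Outside 1..n the count function gets the default value, so that it belongs to
      a finite function space.\<close>
    let ?N = "restrict (\<lambda>m. card {i \<in> I. card (R `` {i}) = m}) {1..?n}"
    have "chi k = ?v ?N" unfolding chi_block_count(1)[OF mu] by (intro sum.cong refl) simp
    moreover have "?N \<in> PiE {1..?n} (\<lambda>_. {0..?n})" using chi_block_count(2)[OF mu] by auto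
    ultimately show "chi k \<in> ?v ` (PiE {1..?n} (\<lambda>_. {0..?n}))" by blast
  qed
qed

text \<open>The nodes m^(-2) are distinct in characteristic 0, so equal invariants force equal index
  counts. These give a bijection of the index sets respecting the blocks, and the reindexed matrix
  units of \<open>y\<close> have the same table as those of \<open>x\<close>.\<close>

lemma chi_eq_imp_gl_orbit:
  fixes x y :: "('k::{alg_closed_field, field_char_0}, 'n::finite) tensor"
  assumes x: "x \<in> separable_locus" and y: "y \<in> separable_locus"
    and chi: "\<And>k. k \<le> CARD('n) \<Longrightarrow> separable_algebra.chi x k = separable_algebra.chi y k"
  shows "y \<in> gl_orbit x"
proof -
  interpret X: split_separable_algebra x by unfold_locales (rule x)
  interpret Y: split_separable_algebra y by unfold_locales (rule y)
  obtain I :: "('k^'n) set" and R E where mu: "matrix_units x I R E" using X.ex_matrix_units by blast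
  obtain I' :: "('k^'n) set" and R' E' where mu': "matrix_units y I' R' E'" using Y.ex_matrix_units by blast
  let ?N = "\<lambda>m. card {i \<in> I. card (R `` {i}) = m}" and ?N' = "\<lambda>m. card {i \<in> I'. card (R' `` {i}) = m}"
  have "?N m = ?N' m" for m
  proof (cases "m \<in> {1..CARD('n)}")
    case True
    let ?a = "\<lambda>m. of_nat (?N m * m) - of_nat (?N' m * m) :: 'k"
    have "?a m = 0"
    proof (rule vandermonde_zero[of "{1..CARD('n)}" "\<lambda>m. inverse (of_nat m) ^ 2" ?a])
      show "inj_on (\<lambda>m. inverse (of_nat m :: 'k) ^ 2) {1..CARD('n)}"
      proof (rule inj_onI)
        fix p q assume "inverse (of_nat p :: 'k) ^ 2 = inverse (of_nat q) ^ 2"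
        then have "(of_nat (p ^ 2) :: 'k) = of_nat (q ^ 2)" by (simp add: power_inverse)
        then have "p ^ 2 = q ^ 2" by (simp only: of_nat_eq_iff)
        then show "p = q" by (simp add: power2_eq_iff_nonneg)
      qed
      fix k assume "k \<le> card {1..CARD('n)}"
      then have "X.chi k = Y.chi k" by (intro chi) simp
      then show "(\<Sum>m = 1..CARD('n). ?a m * (inverse (of_nat m) ^ 2) ^ k) = 0"
        unfolding X.chi_block_count(1)[OF mu] Y.chi_block_count(1)[OF mu']
        by (simp add: left_diff_distrib sum_subtractf)
    qed (use True in auto)
    then have "?N m * m = ?N' m * m" by (simp only: right_minus_eq of_nat_eq_iff)
    then show ?thesis using True by simp
  next
    case False
    then show ?thesis using X.chi_block_count(3)[OF mu] Y.chi_block_count(3)[OF mu'] by simp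
  qed
  moreover have "finite I" "equiv I R" "finite I'" "equiv I' R'"
    using mu mu' by (simp_all add: matrix_units_def)
  ultimately obtain \<pi> where "bij_betw \<pi> I I'"
    "\<And>i j. i \<in> I \<Longrightarrow> j \<in> I \<Longrightarrow> (i, j) \<in> R \<longleftrightarrow> (\<pi> i, \<pi> j) \<in> R'"
    using equiv_bij_of_card_eq[of I R I' R'] by blast
  then have "matrix_units y I R (\<lambda>i j. E' (\<pi> i) (\<pi> j))"
    by (rule matrix_units_reindex[OF mu' _ \<open>equiv I R\<close>])
  with mu show ?thesis by (rule matrix_units_imp_gl_orbit)
qed

text \<open>Matrix units are carried along by the group element with the same index data, on which
  alone the invariants depend.\<close>

lemma gl_orbit_imp_chi_eq:
  fixes x y :: "('k::{alg_closed_field, field_char_0}, 'n::finite) tensor"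
  assumes x: "x \<in> separable_locus" and y: "y \<in> gl_orbit x"
  shows "separable_algebra.chi y k = separable_algebra.chi x k"
proof -
  interpret X: split_separable_algebra x by unfold_locales (rule x)
  interpret Y: split_separable_algebra y by unfold_locales (rule gl_orbit_separable_locus[OF y x])
  obtain I :: "('k^'n) set" and R E where mu: "matrix_units x I R E" using X.ex_matrix_units by blast
  obtain g h where g: "g ** h = mat 1" "h ** g = mat 1" "y = transport g h x"
    using y unfolding gl_orbit_iff by blast
  have "matrix_units y I R (\<lambda>i j. g *v E i j)"
    unfolding g(3) using mu g(1,2) by (rule matrix_units_transport)
  from Y.chi_matrix_units[OF this] X.chi_matrix_units[OF mu] show ?thesis by simp
qed

section \<open>Polynomials in the structure constants and openness of orbits\<close>

definition monom_eval :: "('a::comm_ring_1, 'n::finite) tensor \<Rightarrow> ('n \<times> 'n \<times> 'n \<Rightarrow>\<^sub>0 nat) \<Rightarrow> 'a" where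
  "monom_eval x m = (\<Prod>(i, j, k)\<in>UNIV. (x $ i $ j $ k) ^ Poly_Mapping.lookup m (i, j, k))"

definition ring_morphism :: "('a::comm_ring_1 \<Rightarrow> 'b::comm_ring_1) \<Rightarrow> bool" where
  "ring_morphism \<phi> \<longleftrightarrow> \<phi> 1 = 1 \<and> (\<forall>a b. \<phi> (a + b) = \<phi> a + \<phi> b) \<and> (\<forall>a b. \<phi> (a * b) = \<phi> a * \<phi> b)"

lemma
  assumes "ring_morphism \<phi>"
  shows ring_morphism_add: "\<phi> (a + b) = \<phi> a + \<phi> b"
    and ring_morphism_mult: "\<phi> (a * b) = \<phi> a * \<phi> b"
    and ring_morphism_one: "\<phi> 1 = 1"
    and ring_morphism_zero: "\<phi> 0 = 0"
    and ring_morphism_diff: "\<phi> (a - b) = \<phi> a - \<phi> b"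
    and ring_morphism_sum: "\<phi> (\<Sum>s\<in>S. f s) = (\<Sum>s\<in>S. \<phi> (f s))"
    and ring_morphism_prod: "\<phi> (\<Prod>s\<in>S. f s) = (\<Prod>s\<in>S. \<phi> (f s))"
    and ring_morphism_power: "\<phi> (a ^ n) = \<phi> a ^ n"
proof -
  show add: "\<phi> (a + b) = \<phi> a + \<phi> b" for a b using assms by (simp add: ring_morphism_def)
  show mult: "\<phi> (a * b) = \<phi> a * \<phi> b" for a b using assms by (simp add: ring_morphism_def)
  show one: "\<phi> 1 = 1" using assms by (simp add: ring_morphism_def)
  show zero: "\<phi> 0 = 0" using add[of 0 0] by simp
  show "\<phi> (a - b) = \<phi> a - \<phi> b" using add[of "a - b" b] by (simp add: algebra_simps)
  show "\<phi> (\<Sum>s\<in>S. f s) = (\<Sum>s\<in>S. \<phi> (f s))"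
    by (induction S rule: infinite_finite_induct) (simp_all add: zero add)
  show "\<phi> (\<Prod>s\<in>S. f s) = (\<Prod>s\<in>S. \<phi> (f s))"
    by (induction S rule: infinite_finite_induct) (simp_all add: one mult)
  show "\<phi> (a ^ n) = \<phi> a ^ n" by (induction n) (simp_all add: one mult)
qed

lemma ring_morphism_id: "ring_morphism id"
  by (simp add: ring_morphism_def)

lemma monom_eval_zero: "monom_eval x 0 = 1"
  by (simp add: monom_eval_def)

lemma monom_eval_add: "monom_eval x (m + m') = monom_eval x m * monom_eval x m'"
  by (simp add: monom_eval_def lookup_add power_add case_prod_beta flip: prod.distrib)

lemma monom_eval_single: "monom_eval x (Poly_Mapping.single (i, j, k) 1) = x $ i $ j $ k"
proof -
  have "monom_eval x (Poly_Mapping.single (i, j, k) 1) =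
      (\<Prod>p\<in>UNIV. if p = (i, j, k) then x $ i $ j $ k else 1)"
    unfolding monom_eval_def by (intro prod.cong refl) (auto simp: lookup_single when_def split: if_splits)
  then show ?thesis by simp
qed

lemma ring_morphism_monom_eval:
  assumes "ring_morphism \<Phi>"
  shows "\<Phi> (monom_eval x m) = monom_eval (\<chi> i j k. \<Phi> (x $ i $ j $ k)) m"
  by (simp add: monom_eval_def ring_morphism_prod[OF assms] ring_morphism_power[OF assms] case_prod_beta)

lemma poly_eval_eq:
  assumes "ring_morphism \<phi>" "finite S" "Poly_Mapping.keys f \<subseteq> S"
  shows "poly_eval \<phi> x f = (\<Sum>m\<in>S. \<phi> (Poly_Mapping.lookup f m) * monom_eval x m)"
  unfolding poly_eval_def monom_eval_def
  by (rule sum.mono_neutral_left) (use assms in \<open>auto simp: in_keys_iff ring_morphism_zero\<close>)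

lemma poly_eval_single:
  assumes "ring_morphism \<phi>" shows "poly_eval \<phi> x (Poly_Mapping.single m c) = \<phi> c * monom_eval x m"
  by (subst poly_eval_eq[OF assms, of "{m}"]) auto

lemma poly_eval_add:
  assumes "ring_morphism \<phi>" shows "poly_eval \<phi> x (f + g) = poly_eval \<phi> x f + poly_eval \<phi> x g"
proof -
  let ?S = "Poly_Mapping.keys f \<union> Poly_Mapping.keys g"
  have "Poly_Mapping.keys (f + g) \<subseteq> ?S" by (rule Poly_Mapping.keys_add)
  then show ?thesis
    by (simp add: poly_eval_eq[OF assms, of ?S] lookup_add ring_morphism_add[OF assms]
        distrib_right sum.distrib)
qed

lemma poly_eval_sum:
  assumes "ring_morphism \<phi>" shows "poly_eval \<phi> x (\<Sum>s\<in>S. f s) = (\<Sum>s\<in>S. poly_eval \<phi> x (f s))"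
proof -
  have "poly_eval \<phi> x 0 = 0" by (simp add: poly_eval_def)
  then show ?thesis
    by (induction S rule: infinite_finite_induct) (simp_all add: poly_eval_add[OF assms])
qed

lemma poly_mapping_sum_single:
  "(\<Sum>m\<in>Poly_Mapping.keys f. Poly_Mapping.single m (Poly_Mapping.lookup f m)) = f"
  by (rule poly_mapping_eqI) (auto simp: lookup_sum lookup_single when_def in_keys_iff)

lemma poly_eval_mult:
  assumes "ring_morphism \<phi>" shows "poly_eval \<phi> x (f * g) = poly_eval \<phi> x f * poly_eval \<phi> x g"
proof -
  let ?s = "\<lambda>f m. Poly_Mapping.single m (Poly_Mapping.lookup f m)"
  have "f * g = (\<Sum>m\<in>Poly_Mapping.keys f. ?s f m) * (\<Sum>m\<in>Poly_Mapping.keys g. ?s g m)"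
    by (simp add: poly_mapping_sum_single)
  also have "poly_eval \<phi> x \<dots> = (\<Sum>m\<in>Poly_Mapping.keys f. \<Sum>m'\<in>Poly_Mapping.keys g.
      \<phi> (Poly_Mapping.lookup f m) * monom_eval x m * (\<phi> (Poly_Mapping.lookup g m') * monom_eval x m'))"
    by (simp add: sum_product mult_single poly_eval_sum[OF assms] poly_eval_single[OF assms]
        monom_eval_add ring_morphism_mult[OF assms] mult_ac)
  also have "\<dots> = poly_eval \<phi> x f * poly_eval \<phi> x g"
    by (simp add: poly_eval_eq[OF assms, of "Poly_Mapping.keys f" f] poly_eval_eq[OF assms, of "Poly_Mapping.keys g" g] sum_product)
  finally show ?thesis .
qed

lemma poly_eval_const:
  assumes "ring_morphism \<phi>" shows "poly_eval \<phi> x (const_poly c) = \<phi> c"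
  by (simp add: const_poly_def poly_eval_single[OF assms] monom_eval_zero)

lemma const_poly_one: "const_poly 1 = 1"
  by (simp add: const_poly_def)

lemma ring_morphism_const_poly: "ring_morphism const_poly"
  by (simp add: ring_morphism_def const_poly_def single_add mult_single)

lemma ring_morphism_poly_eval:
  assumes "ring_morphism \<phi>" shows "ring_morphism (poly_eval \<phi> x)"
  using poly_eval_const[OF assms, of x 1]
  by (simp add: ring_morphism_def poly_eval_add[OF assms] poly_eval_mult[OF assms] const_poly_one
      ring_morphism_one[OF assms])

lemma poly_eval_generic:
  fixes \<phi> :: "'a::field \<Rightarrow> 'b::comm_ring_1" and x :: "('b, 'c::finite) tensor"
  assumes "ring_morphism \<phi>" shows "poly_eval \<phi> x (generic_tensor $ i $ j $ k) = x $ i $ j $ k"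
proof -
  have "(generic_tensor :: (('a, 'c) coord_poly, 'c) tensor) $ i $ j $ k =
      Poly_Mapping.single (Poly_Mapping.single (i, j, k) 1) 1"
    by (simp add: generic_tensor_def)
  then show ?thesis
    using poly_eval_single[OF assms, of x "Poly_Mapping.single (i, j, k) 1" 1]
    unfolding monom_eval_single ring_morphism_one[OF assms] by simp
qed

lemma monom_eval_generic: "monom_eval generic_tensor m = Poly_Mapping.single m 1"
proof -
  have pow: "(generic_tensor $ i $ j $ k) ^ n = Poly_Mapping.single (Poly_Mapping.single (i, j, k) n) 1" for i j k n
    by (induction n) (simp_all add: generic_tensor_def mult_single single_one flip: single_add)
  have prod: "(\<Prod>p\<in>S. Poly_Mapping.single (f p) 1) = Poly_Mapping.single (\<Sum>p\<in>S. f p) (1::'c::comm_semiring_1)"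
    if "finite S" for S and f :: "'d \<Rightarrow> ('e \<Rightarrow>\<^sub>0 nat)"
    using that by (induction S) (simp_all add: mult_single single_one)
  have "monom_eval generic_tensor m =
      (\<Prod>p\<in>UNIV. Poly_Mapping.single (Poly_Mapping.single p (Poly_Mapping.lookup m p)) 1)"
    unfolding monom_eval_def by (intro prod.cong refl) (simp add: pow case_prod_beta)
  also have "\<dots> = Poly_Mapping.single (\<Sum>p\<in>UNIV. Poly_Mapping.single p (Poly_Mapping.lookup m p)) 1"
    by (rule prod) simp
  also have "(\<Sum>p\<in>UNIV. Poly_Mapping.single p (Poly_Mapping.lookup m p)) = m"
    by (rule poly_mapping_eqI) (simp add: lookup_sum lookup_single when_def)
  finally show ?thesis .
qed

lemma poly_eval_generic_const: "poly_eval const_poly generic_tensor f = f"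
proof -
  have "poly_eval const_poly generic_tensor f =
      (\<Sum>m\<in>Poly_Mapping.keys f. Poly_Mapping.single m (Poly_Mapping.lookup f m))"
    by (simp add: poly_eval_eq[OF ring_morphism_const_poly, of "Poly_Mapping.keys f"] monom_eval_generic
        const_poly_def mult_single)
  then show ?thesis by (simp add: poly_mapping_sum_single)
qed

text \<open>A ring map passes through evaluation, acting separately on coefficients and tensor
  entries; this is how successive substitutions are composed.\<close>

lemma ring_morphism_poly_eval_comp:
  assumes \<Phi>: "ring_morphism \<Phi>" and \<phi>: "ring_morphism \<phi>"
  shows "\<Phi> (poly_eval \<phi> x f) = poly_eval (\<lambda>c. \<Phi> (\<phi> c)) (\<chi> i j k. \<Phi> (x $ i $ j $ k)) f"
proof -
  have "ring_morphism (\<lambda>c. \<Phi> (\<phi> c))" using assms by (simp add: ring_morphism_def)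
  then show ?thesis
    by (simp add: poly_eval_eq[OF \<phi>, of "Poly_Mapping.keys f"] poly_eval_eq[of _ "Poly_Mapping.keys f"]
        ring_morphism_sum[OF \<Phi>] ring_morphism_mult[OF \<Phi>] ring_morphism_monom_eval[OF \<Phi>])
qed

lemma ring_morphism_transport:
  assumes "ring_morphism \<Phi>"
  shows "\<Phi> (transport g h x $ i $ j $ k) =
    transport (\<chi> i j. \<Phi> (g $ i $ j)) (\<chi> i j. \<Phi> (h $ i $ j)) (\<chi> i j k. \<Phi> (x $ i $ j $ k)) $ i $ j $ k"
  by (simp add: transport_nth ring_morphism_sum[OF assms] ring_morphism_mult[OF assms])

lemma ring_morphism_associator:
  assumes "ring_morphism \<Phi>"
  shows "\<Phi> (associator x i j l m) = associator (\<chi> i j k. \<Phi> (x $ i $ j $ k)) i j l m"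
  by (simp add: associator_nth ring_morphism_sum[OF assms] ring_morphism_mult[OF assms]
      ring_morphism_diff[OF assms])

text \<open>Regular functions on \<open>S\<close> with denominators a power of \<open>D\<close>.\<close>

definition localized_fun ::
  "('k::field, 'n::finite) coord_poly \<Rightarrow> ('k, 'n) tensor set \<Rightarrow> (('k, 'n) tensor \<Rightarrow> 'k) \<Rightarrow> bool" where
  "localized_fun D S h \<longleftrightarrow> (\<exists>N f. \<forall>y\<in>S. h y * poly_eval id y D ^ N = poly_eval id y f)"

lemma localized_fun_cong:
  assumes "localized_fun D S h" "\<And>y. y \<in> S \<Longrightarrow> h y = h' y" shows "localized_fun D S h'"
  using assms by (simp add: localized_fun_def)

lemmas poly_eval_id_simps = poly_eval_add[OF ring_morphism_id] poly_eval_mult[OF ring_morphism_id]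
  poly_eval_const[OF ring_morphism_id] poly_eval_generic[OF ring_morphism_id]
  ring_morphism_power[OF ring_morphism_poly_eval[OF ring_morphism_id]]

lemma localized_fun_const [intro]: "localized_fun D S (\<lambda>y. c)"
  unfolding localized_fun_def by (intro exI[of _ 0] exI[of _ "const_poly c"]) (simp add: poly_eval_id_simps)

lemma localized_fun_coord [intro]: "localized_fun D S (\<lambda>y. y $ i $ j $ k)"
  unfolding localized_fun_def by (intro exI[of _ 0] exI[of _ "generic_tensor $ i $ j $ k"]) (simp add: poly_eval_id_simps)

lemma localized_fun_add [intro]:
  assumes "localized_fun D S h" "localized_fun D S h'" shows "localized_fun D S (\<lambda>y. h y + h' y)"
proof -
  obtain N f N' f' where f: "\<And>y. y \<in> S \<Longrightarrow> h y * poly_eval id y D ^ N = poly_eval id y f"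
    and f': "\<And>y. y \<in> S \<Longrightarrow> h' y * poly_eval id y D ^ N' = poly_eval id y f'"
    using assms unfolding localized_fun_def by blast
  have "(h y + h' y) * poly_eval id y D ^ (N + N') = poly_eval id y (f * D ^ N' + f' * D ^ N)" if "y \<in> S" for y
    by (simp add: poly_eval_id_simps power_add algebra_simps flip: f[OF that] f'[OF that])
  then show ?thesis unfolding localized_fun_def by blast
qed

lemma localized_fun_mult [intro]:
  assumes "localized_fun D S h" "localized_fun D S h'" shows "localized_fun D S (\<lambda>y. h y * h' y)"
proof -
  obtain N f N' f' where f: "\<And>y. y \<in> S \<Longrightarrow> h y * poly_eval id y D ^ N = poly_eval id y f"
    and f': "\<And>y. y \<in> S \<Longrightarrow> h' y * poly_eval id y D ^ N' = poly_eval id y f'"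
    using assms unfolding localized_fun_def by blast
  have "(h y * h' y) * poly_eval id y D ^ (N + N') = poly_eval id y (f * f')" if "y \<in> S" for y
    by (simp add: poly_eval_id_simps power_add mult_ac flip: f[OF that] f'[OF that])
  then show ?thesis unfolding localized_fun_def by blast
qed

lemma localized_fun_sum [intro]:
  assumes "\<And>s. s \<in> A \<Longrightarrow> localized_fun D S (h s)" shows "localized_fun D S (\<lambda>y. \<Sum>s\<in>A. h s y)"
  using assms by (induction A rule: infinite_finite_induct) auto

lemma localized_fun_prod [intro]:
  assumes "\<And>s. s \<in> A \<Longrightarrow> localized_fun D S (h s)" shows "localized_fun D S (\<lambda>y. \<Prod>s\<in>A. h s y)"
  using assms by (induction A rule: infinite_finite_induct) auto

lemma localized_fun_det:
  assumes "\<And>i j. localized_fun D S (\<lambda>y. A y $ i $ j)" shows "localized_fun D S (\<lambda>y. det (A y))"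
  unfolding det_def using assms by (intro localized_fun_sum localized_fun_mult localized_fun_prod localized_fun_const)

lemma localized_fun_alg_prod:
  assumes "\<And>i. localized_fun D S (\<lambda>y. a y $ i)" "\<And>i. localized_fun D S (\<lambda>y. b y $ i)"
  shows "localized_fun D S (\<lambda>y. alg_prod y (a y) (b y) $ k)"
  unfolding alg_prod_nth using assms by (intro localized_fun_sum localized_fun_mult localized_fun_coord)

lemma localized_fun_trace:
  assumes "\<And>i. localized_fun D S (\<lambda>y. a y $ i)"
  shows "localized_fun D S (\<lambda>y. trace (left_mult y (a y)))"
  unfolding trace_def left_mult_def matrix_def
  by (simp, intro localized_fun_sum localized_fun_alg_prod assms localized_fun_const)

text \<open>With denominator 1 the functions of \<open>localized_fun\<close> are exactly polynomial
  ones, so the closure rules prove polynomiality too.\<close>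

lemma ex_discriminant_poly:
  "\<exists>D. \<forall>y :: ('k::field, 'n::finite) tensor. poly_eval id y D = discriminant y"
proof -
  have "localized_fun 1 UNIV (discriminant :: ('k, 'n) tensor \<Rightarrow> 'k)"
    unfolding discriminant_def[abs_def]
    by (rule localized_fun_det) (simp, intro localized_fun_trace localized_fun_coord)
  then obtain N f where f: "\<And>y :: ('k, 'n) tensor. discriminant y * poly_eval id y 1 ^ N = poly_eval id y f"
    unfolding localized_fun_def by blast
  have "poly_eval id y f = discriminant y" for y :: "('k, 'n) tensor"
    using f[of y] by (simp add: ring_morphism_one[OF ring_morphism_poly_eval[OF ring_morphism_id]])
  then show ?thesis by blast
qed

section \<open>Rationality of the invariants on the separable locus\<close>

context
  fixes D :: "('k::field, 'n::finite) coord_poly"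
  assumes D: "\<And>y. poly_eval id y D = discriminant y"
begin

lemma localized_fun_inverse_discriminant: "localized_fun D separable_locus (\<lambda>y. inverse (discriminant y))"
  unfolding localized_fun_def
  by (intro exI[of _ 1] exI[of _ "const_poly 1"]) (simp add: poly_eval_id_simps D separable_locus_def)

text \<open>Cramer's rule for the system defining the dual basis: a determinant with one column
  replaced, divided by the discriminant.\<close>

lemma localized_fun_dual: "localized_fun D separable_locus (\<lambda>y. separable_algebra.dual y j $ k)"
proof (rule localized_fun_cong)
  define T where "T y = (\<chi> i j. trace (left_mult y (alg_prod y (axis i 1) (axis j 1))))" for y :: "('k, 'n) tensor"
  have T: "localized_fun D separable_locus (\<lambda>y. T y $ i $ j)" for i j
    unfolding T_def by (simp, intro localized_fun_trace localized_fun_coord)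
  show "localized_fun D separable_locus
      (\<lambda>y. det (\<chi> i l. if l = k then axis j 1 $ i else T y $ i $ l) * inverse (discriminant y))"
  proof (intro localized_fun_mult localized_fun_inverse_discriminant localized_fun_det)
    fix i l
    show "localized_fun D separable_locus (\<lambda>y. (\<chi> i l. if l = k then axis j 1 $ i else T y $ i $ l) $ i $ l)"
      using T by (cases "l = k") auto
  qed
  fix y :: "('k, 'n) tensor" assume "y \<in> separable_locus"
  then interpret separable_algebra y by unfold_locales
  have T: "T y = trace_form" "discriminant y = det trace_form"
    by (simp_all add: T_def trace_form_def tr_def discriminant_def)
  have "trace_form *v dual j = axis j 1"
    by (simp add: dual_def matrix_vector_mul_assoc trace_form_inverse)
  then have "dual j = (\<chi> k. det (\<chi> i l. if l = k then axis j 1 $ i else trace_form $ i $ l) / det trace_form)"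
    using cramer[OF det_trace_form] by blast
  then show "det (\<chi> i l. if l = k then axis j 1 $ i else T y $ i $ l) * inverse (discriminant y) = dual j $ k"
    unfolding T by (simp add: divide_inverse)
qed

lemma localized_fun_chi: "localized_fun D separable_locus (\<lambda>y. separable_algebra.chi y k)"
proof -
  let ?om = "\<lambda>y. \<Sum>i\<in>UNIV. \<Sum>j\<in>UNIV. alg_prod y (alg_prod y (alg_prod y (axis i 1) (axis j 1))
      (separable_algebra.dual y i)) (separable_algebra.dual y j)"
  \<comment> \<open>The unit is obtained by choice and has no visible formula; the Casimir sum
    equals it on the separable locus and is rational.\<close>
  let ?one = "\<lambda>y. \<Sum>i\<in>UNIV. alg_prod y (axis i 1) (separable_algebra.dual y i)"
  have om: "localized_fun D separable_locus (\<lambda>y. ?om y $ i)" for i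
    unfolding sum_component
    by (intro localized_fun_sum localized_fun_alg_prod localized_fun_dual) (auto)
  have one: "localized_fun D separable_locus (\<lambda>y. ?one y $ i)" for i
    unfolding sum_component
    by (intro localized_fun_sum localized_fun_alg_prod localized_fun_dual) (auto)
  have pow: "localized_fun D separable_locus (\<lambda>y. ((\<lambda>a. alg_prod y (?om y) a) ^^ k) (?one y) $ i)" for i
  proof (induction k arbitrary: i)
    case (Suc k)
    have "localized_fun D separable_locus
        (\<lambda>y. alg_prod y (?om y) (((\<lambda>a. alg_prod y (?om y) a) ^^ k) (?one y)) $ i)"
      by (rule localized_fun_alg_prod[OF om Suc])
    then show ?case by simp
  qed (simp add: one del: sum_component)
  have "localized_fun D separable_locus
      (\<lambda>y. trace (left_mult y (((\<lambda>a. alg_prod y (?om y) a) ^^ k) (?one y))))"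
    by (rule localized_fun_trace[OF pow])
  then show ?thesis
  proof (rule localized_fun_cong)
    fix y :: "('k, 'n) tensor" assume "y \<in> separable_locus"
    then interpret separable_algebra y by unfold_locales
    show "trace (left_mult y (((\<lambda>a. alg_prod y (?om y) a) ^^ k) (?one y))) = chi k"
      by (simp add: chi_def tr_def omega_power_def omega_def casimir_unit)
  qed
qed

text \<open>Clearing the denominator leaves a numerator with the same zeros on the separable locus;
  the extra factor \<open>D\<close> confines the open set to that locus.\<close>

lemma openin_localized_fun_nonzero:
  assumes "localized_fun D separable_locus h"
  shows "openin alg_zariski {y \<in> separable_locus. h y \<noteq> 0}"
proof -
  obtain N f where f: "\<And>y. y \<in> separable_locus \<Longrightarrow> h y * discriminant y ^ N = poly_eval id y f"
    using assms by (auto simp: localized_fun_def D)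
  have "{y \<in> separable_locus. h y \<noteq> 0} = {y \<in> alg_points. poly_eval id y (f * D) \<noteq> 0}"
  proof (intro equalityI subsetI)
    fix y :: "('k, 'n) tensor" assume "y \<in> {y \<in> separable_locus. h y \<noteq> 0}"
    then have y: "y \<in> separable_locus" "h y \<noteq> 0" by auto
    then have "y \<in> alg_points" "discriminant y \<noteq> 0" by (auto simp: separable_locus_def)
    with y show "y \<in> {y \<in> alg_points. poly_eval id y (f * D) \<noteq> 0}"
      by (simp add: poly_eval_id_simps D flip: f[OF y(1)])
  next
    fix y :: "('k, 'n) tensor" assume "y \<in> {y \<in> alg_points. poly_eval id y (f * D) \<noteq> 0}"
    then have y: "y \<in> separable_locus" "poly_eval id y f \<noteq> 0"
      by (auto simp: poly_eval_id_simps D separable_locus_def)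
    then show "y \<in> {y \<in> separable_locus. h y \<noteq> 0}" using f[OF y(1)] by auto
  qed
  then show ?thesis
    unfolding alg_zariski_def by (auto intro!: topology_generated_by_Basis)
qed

end

text \<open>Each invariant takes finitely many values, so having the value of \<open>x\<close> means
  that the product of its differences from all other values is nonzero: an open condition. The
  conditions for k \<le> n together cut out the orbit.\<close>

theorem openin_gl_orbit:
  fixes x :: "('k::{alg_closed_field, field_char_0}, 'n::finite) tensor"
  assumes x: "x \<in> separable_locus"
  shows "openin alg_zariski (gl_orbit x)"
proof -
  obtain D where D: "\<And>y :: ('k, 'n) tensor. poly_eval id y D = discriminant y"
    using ex_discriminant_poly by blast
  let ?\<chi> = separable_algebra.chi
  let ?V = "\<lambda>k. {?\<chi> y k | y :: ('k, 'n) tensor. y \<in> separable_locus}"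
  let ?h = "\<lambda>k (y :: ('k, 'n) tensor). \<Prod>v\<in>?V k - {?\<chi> x k}. ?\<chi> y k - v"
  have fin: "finite (?V k - {?\<chi> x k})" for k using finite_chi_values by blast
  have "localized_fun D separable_locus (\<lambda>y. ?\<chi> y k + - v)" for k v
    by (intro localized_fun_add localized_fun_chi D localized_fun_const)
  then have "localized_fun D separable_locus (?h k)" for k
    by (intro localized_fun_prod) simp
  from openin_localized_fun_nonzero[OF D this]
  have "openin alg_zariski {y \<in> separable_locus. ?h k y \<noteq> 0}" for k .
  then have "openin alg_zariski (\<Inter>k\<in>{..CARD('n)}. {y \<in> separable_locus. ?h k y \<noteq> 0})"
    by (intro openin_INT2) auto
  also have "(\<Inter>k\<in>{..CARD('n)}. {y \<in> separable_locus. ?h k y \<noteq> 0}) = gl_orbit x"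
  proof (intro equalityI subsetI)
    fix y assume y: "y \<in> (\<Inter>k\<in>{..CARD('n)}. {y \<in> separable_locus. ?h k y \<noteq> 0})"
    then have ys: "y \<in> separable_locus" and h: "\<And>k. k \<le> CARD('n) \<Longrightarrow> ?h k y \<noteq> 0" by auto
    have "?\<chi> x k = ?\<chi> y k" if "k \<le> CARD('n)" for k
    proof (rule ccontr)
      assume "?\<chi> x k \<noteq> ?\<chi> y k"
      then have "?\<chi> y k \<in> ?V k - {?\<chi> x k}" using ys by auto
      then have "?h k y = 0" using fin by (intro prod_zero) auto
      then show False using h[OF that] by simp
    qed
    then show "y \<in> gl_orbit x" by (rule chi_eq_imp_gl_orbit[OF x ys])
  next
    fix y assume y: "y \<in> gl_orbit x"
    have "?h k y \<noteq> 0" for k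
      unfolding gl_orbit_imp_chi_eq[OF x y] prod_zero_iff[OF fin] by auto
    then show "y \<in> (\<Inter>k\<in>{..CARD('n)}. {y \<in> separable_locus. ?h k y \<noteq> 0})"
      using gl_orbit_separable_locus[OF y x] by simp
  qed
  finally show ?thesis .
qed

text \<open>The preimage of the class is the orbit itself, so the singleton is open in the orbit
  space and hence in every neighbourhood containing it.\<close>

theorem gl_orbit_isolated:
  fixes x :: "('k::{alg_closed_field, field_char_0}, 'n::finite) tensor"
  assumes x: "x \<in> separable_locus"
  shows "isolated_in_nbhds_meeting orbit_space S (gl_orbit x)"
proof -
  have xa: "x \<in> alg_points" using x by (simp add: separable_locus_def)
  have "{y \<in> alg_points. gl_orbit y \<in> {gl_orbit x}} = gl_orbit x"
    using gl_orbit_alg_points[OF _ xa] by (auto simp: gl_orbit_eq_iff)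
  then have op: "openin orbit_space {gl_orbit x}"
    using openin_gl_orbit[OF x] xa by (simp add: openin_orbit_space)
  then have "gl_orbit x \<in> topspace orbit_space" using openin_subset by blast
  moreover have "openin (subtopology orbit_space N) {gl_orbit x}" if "gl_orbit x \<in> N" for N
    using op that unfolding openin_subtopology by (intro exI[of _ "{gl_orbit x}"]) auto
  ultimately show ?thesis by (simp add: isolated_in_nbhds_meeting_def)
qed

section \<open>Invariants of the coordinate ring\<close>

lemma ideal_ring_of_type_algebraI:
  fixes I :: "'a::comm_ring_1 set"
  assumes "0 \<in> I" "\<And>a b. a \<in> I \<Longrightarrow> b \<in> I \<Longrightarrow> a + b \<in> I" "\<And>a b. a \<in> I \<Longrightarrow> b * a \<in> I"
  shows "ideal I ring_of_type_algebra"
proof (rule idealI)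
  interpret R: ring "ring_of_type_algebra :: 'a ring" by (rule ring_from_type_algebra)
  show "ring (ring_of_type_algebra :: 'a ring)" by (rule ring_from_type_algebra)
  show "subgroup I (add_monoid ring_of_type_algebra)"
  proof (rule R.add.subgroupI)
    fix a assume a: "a \<in> I"
    have "\<ominus>\<^bsub>ring_of_type_algebra\<^esub> a = - a"
      by (rule R.minus_equality) (simp_all add: ring_of_type_algebra_def)
    then show "\<ominus>\<^bsub>ring_of_type_algebra\<^esub> a \<in> I" using assms(3)[OF a, of "- 1"] by simp
  qed (use assms in \<open>auto simp: ring_of_type_algebra_def\<close>)
qed (use assms in \<open>auto simp: ring_of_type_algebra_def mult.commute\<close>)

lemma ideal_assoc_ideal: "ideal assoc_ideal ring_of_type_algebra"
  unfolding assoc_ideal_def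
  by (rule ring.genideal_ideal[OF ring_from_type_algebra]) (simp add: ring_of_type_algebra_def)

lemma
  fixes a b :: "('k::field, 'n::finite) coord_poly"
  shows assoc_ideal_zero: "(0 :: ('k, 'n) coord_poly) \<in> assoc_ideal"
    and assoc_ideal_add: "a \<in> assoc_ideal \<Longrightarrow> b \<in> assoc_ideal \<Longrightarrow> a + b \<in> assoc_ideal"
    and assoc_ideal_mult: "a \<in> assoc_ideal \<Longrightarrow> b * a \<in> assoc_ideal"
    and assoc_ideal_diff: "a \<in> assoc_ideal \<Longrightarrow> b \<in> assoc_ideal \<Longrightarrow> a - b \<in> assoc_ideal"
proof -
  interpret ideal "assoc_ideal :: ('k, 'n) coord_poly set" ring_of_type_algebra by (rule ideal_assoc_ideal)
  show "(0 :: ('k, 'n) coord_poly) \<in> assoc_ideal"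
    using additive_subgroup.zero_closed[OF ideal.axioms(1)[OF ideal_assoc_ideal]] by (simp add: ring_of_type_algebra_def)
  show add: "a + b \<in> assoc_ideal" if "a \<in> assoc_ideal" "b \<in> assoc_ideal" for a b :: "('k, 'n) coord_poly"
    using additive_subgroup.a_closed[OF ideal.axioms(1)[OF ideal_assoc_ideal] that] by (simp add: ring_of_type_algebra_def)
  show mult: "b * a \<in> assoc_ideal" if "a \<in> assoc_ideal" for a b :: "('k, 'n) coord_poly"
    using I_l_closed[OF that, of b] by (simp add: ring_of_type_algebra_def)
  show "a - b \<in> assoc_ideal" if "a \<in> assoc_ideal" "b \<in> assoc_ideal" for a b :: "('k, 'n) coord_poly"
    using add[OF that(1) mult[OF that(2), of "- 1"]] by simp
qed

lemma assoc_ideal_sum: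
  assumes "\<And>s. s \<in> S \<Longrightarrow> f s \<in> assoc_ideal" shows "(\<Sum>s\<in>S. f s) \<in> assoc_ideal"
  using assms by (induction S rule: infinite_finite_induct) (simp_all add: assoc_ideal_zero assoc_ideal_add)

lemma associator_in_assoc_ideal: "associator generic_tensor i j l m \<in> assoc_ideal"
  unfolding assoc_ideal_def
  by (rule subsetD[OF ring.genideal_self[OF ring_from_type_algebra]]) (auto simp: ring_of_type_algebra_def)

text \<open>Minimality of the generated ideal as an induction rule; it serves vanishing at points
  and stability under substitution.\<close>

lemma assoc_ideal_induct:
  assumes "f \<in> assoc_ideal" "0 \<in> J" "\<And>a b. a \<in> J \<Longrightarrow> b \<in> J \<Longrightarrow> a + b \<in> J" "\<And>a b. a \<in> J \<Longrightarrow> b * a \<in> J"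
    and "\<And>i j l m. associator generic_tensor i j l m \<in> J"
  shows "f \<in> J"
proof -
  have "assoc_ideal \<subseteq> J"
    unfolding assoc_ideal_def
    by (rule ring.genideal_minimal[OF ring_from_type_algebra]) (use assms in \<open>auto intro: ideal_ring_of_type_algebraI\<close>)
  with assms(1) show ?thesis by blast
qed

lemma assoc_ideal_vanishes:
  assumes x: "x \<in> alg_points" and f: "f \<in> assoc_ideal"
  shows "poly_eval id x f = 0"
proof -
  note m = ring_morphism_poly_eval[OF ring_morphism_id, of x]
  have "(\<chi> i j k. poly_eval id x (generic_tensor $ i $ j $ k)) = x"
    by (simp add: poly_eval_generic[OF ring_morphism_id] vec_eq_iff)
  then have "poly_eval id x (associator generic_tensor i j l m) = 0" for i j l m
    using x by (simp add: ring_morphism_associator[OF m] alg_points_def)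
  then have "f \<in> {f. poly_eval id x f = 0}"
    by (intro assoc_ideal_induct[OF f])
      (simp_all add: ring_morphism_zero[OF m] ring_morphism_add[OF m] ring_morphism_mult[OF m])
  then show ?thesis by simp
qed

section \<open>The group action on polynomials\<close>

definition const_matrix :: "'k::field^'n^'n \<Rightarrow> ('k, 'n::finite) coord_poly^'n^'n" where
  "const_matrix g = (\<chi> i j. const_poly (g $ i $ j))"

lemma const_matrix_mult: "const_matrix g ** const_matrix h = const_matrix (g ** h)"
  by (simp add: const_matrix_def vec_eq_iff matrix_matrix_mult_def
      ring_morphism_sum[OF ring_morphism_const_poly] ring_morphism_mult[OF ring_morphism_const_poly])

lemma const_matrix_one: "const_matrix (mat 1) = mat 1"
  by (simp add: const_matrix_def vec_eq_iff mat_def const_poly_one ring_morphism_zero[OF ring_morphism_const_poly])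

lemma gl_subst_eq:
  "gl_subst g f = poly_eval const_poly (transport (const_matrix g) (const_matrix (matrix_inv g)) generic_tensor) f"
  by (simp add: gl_subst_def const_matrix_def)

lemma ring_morphism_gl_subst: "ring_morphism (gl_subst g)"
  unfolding gl_subst_eq[abs_def] by (rule ring_morphism_poly_eval[OF ring_morphism_const_poly])

lemma gl_subst_const: "gl_subst g (const_poly c) = const_poly c"
  unfolding gl_subst_eq by (rule poly_eval_const[OF ring_morphism_const_poly])

lemma gl_subst_generic:
  "(\<chi> i j k. gl_subst g (generic_tensor $ i $ j $ k)) =
    transport (const_matrix g) (const_matrix (matrix_inv g)) generic_tensor"
  by (simp add: gl_subst_eq poly_eval_generic[OF ring_morphism_const_poly] vec_eq_iff)

text \<open>Substitution is a ring endomorphism fixing constants, hence determined on the generic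
  tensor, where the two transports cancel.\<close>

lemma gl_subst_inverse:
  assumes g: "g ** h = mat 1" "h ** g = mat 1"
  shows "gl_subst g (gl_subst h f) = f"
proof -
  have inv: "matrix_inv g = h" "matrix_inv h = g" using g by (simp_all add: matrix_inv_unique)
  have c: "(\<chi> i j. gl_subst g (const_matrix a $ i $ j)) = const_matrix a" for a
    by (simp add: const_matrix_def gl_subst_const)
  have "(\<chi> i j k. gl_subst g (transport (const_matrix h) (const_matrix g) generic_tensor $ i $ j $ k)) =
      transport (const_matrix h) (const_matrix g) (transport (const_matrix g) (const_matrix h) generic_tensor)"
    unfolding ring_morphism_transport[OF ring_morphism_gl_subst] c gl_subst_generic inv
    by (simp add: vec_eq_iff)
  also have "\<dots> = generic_tensor"
    by (simp add: transport_transport const_matrix_mult g const_matrix_one)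
  finally have "gl_subst g (gl_subst h f) = poly_eval (\<lambda>c. gl_subst g (const_poly c)) generic_tensor f"
    unfolding gl_subst_eq[of h] inv
    by (simp add: ring_morphism_poly_eval_comp[OF ring_morphism_gl_subst ring_morphism_const_poly])
  then show ?thesis by (simp add: gl_subst_const poly_eval_generic_const)
qed

text \<open>The associator of the transported generic tensor is \<open>g\<close> applied to the
  original associator at transformed arguments. By trilinearity this is a combination of the
  generators with polynomial coefficients.\<close>

lemma gl_subst_assoc_ideal:
  fixes g :: "'k::field^'n::finite^'n"
  assumes g: "g ** h = mat 1" "h ** g = mat 1" and f: "f \<in> assoc_ideal"
  shows "gl_subst g f \<in> assoc_ideal"
proof -
  note m = ring_morphism_gl_subst[of g]
  let ?X = "generic_tensor :: (('k, 'n) coord_poly, 'n) tensor"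
  let ?g = "const_matrix g :: ('k, 'n) coord_poly^'n^'n" and ?h = "const_matrix h :: ('k, 'n) coord_poly^'n^'n"
  have inv: "matrix_inv g = h" using g by (rule matrix_inv_unique)
  have hg: "?h *v (?g *v a) = a" for a
    by (simp add: matrix_vector_mul_assoc const_matrix_mult g const_matrix_one)
  have in_ideal: "(alg_prod ?X (alg_prod ?X a b) c - alg_prod ?X a (alg_prod ?X b c)) $ p \<in> assoc_ideal" for a b c p
    unfolding associator_alg_prod
    by (simp, intro assoc_ideal_sum assoc_ideal_mult associator_in_assoc_ideal)
  have "gl_subst g (associator ?X i j l p) \<in> assoc_ideal" for i j l p
  proof -
    let ?Y = "transport ?g ?h ?X"
    have "alg_prod ?Y (alg_prod ?Y a b) c - alg_prod ?Y a (alg_prod ?Y b c) =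
        ?g *v (alg_prod ?X (alg_prod ?X (?h *v a) (?h *v b)) (?h *v c) -
          alg_prod ?X (?h *v a) (alg_prod ?X (?h *v b) (?h *v c)))" for a b c
      by (simp add: alg_prod_transport hg matrix_vector_mult_diff_distrib)
    then have "associator ?Y i j l p \<in> assoc_ideal"
      unfolding associator_def
      by (simp add: matrix_vector_mult_def del: alg_prod_axis vector_minus_component)
        (intro assoc_ideal_sum assoc_ideal_mult in_ideal)
    then show ?thesis
      by (simp add: ring_morphism_associator[OF m] gl_subst_generic inv)
  qed
  then have "f \<in> {f. gl_subst g f \<in> assoc_ideal}"
    by (intro assoc_ideal_induct[OF f])
      (simp_all add: ring_morphism_zero[OF m] ring_morphism_add[OF m] ring_morphism_mult[OF m]
        assoc_ideal_zero assoc_ideal_add assoc_ideal_mult)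
  then show ?thesis by simp
qed

section \<open>Weights of the scalar matrices\<close>

definition monom_degree :: "('n::finite \<times> 'n \<times> 'n \<Rightarrow>\<^sub>0 nat) \<Rightarrow> nat" where
  "monom_degree m = (\<Sum>p\<in>UNIV. Poly_Mapping.lookup m p)"

lemma monom_degree_eq_0: "monom_degree m = 0 \<longleftrightarrow> m = 0"
  by (auto simp: monom_degree_def intro: poly_mapping_eqI)

text \<open>Two arguments scaled by t and one result scaled by 1/t multiply the tensor by t, so a
  monomial is scaled according to its total degree.\<close>

lemma gl_subst_scalar:
  fixes t :: "'k::field" and f :: "('k, 'n::finite) coord_poly"
  assumes t: "t \<noteq> 0"
  shows "Poly_Mapping.lookup (gl_subst (mat (inverse t)) f) m = Poly_Mapping.lookup f m * t ^ monom_degree m"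
proof -
  have mm: "mat a ** mat b = (mat (a * b) :: 'k^'n^'n)" for a b
    by (simp add: vec_eq_iff matrix_matrix_mult_def mat_def mult_delta_left)
  have inv: "matrix_inv (mat (inverse t) :: 'k^'n^'n) = mat t"
    by (rule matrix_inv_unique) (simp_all add: mm t)
  have cm: "const_matrix (mat a :: 'k^'n^'n) = mat (const_poly a)" for a
    by (simp add: const_matrix_def vec_eq_iff mat_def ring_morphism_zero[OF ring_morphism_const_poly])
  have mv: "mat a *v v = a *s v" for a and v :: "('k, 'n) coord_poly^'n"
    by (simp add: vec_eq_iff matrix_vector_mult_def mat_def mult_delta_left)
  have "const_poly (inverse t) * const_poly t = (1 :: ('k, 'n) coord_poly)"
    using t by (simp add: const_poly_one flip: ring_morphism_mult[OF ring_morphism_const_poly])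
  then have tr: "transport (const_matrix (mat (inverse t))) (const_matrix (mat t)) generic_tensor =
      (\<chi> i j. const_poly t *s (generic_tensor :: (('k, 'n) coord_poly, 'n) tensor) $ i $ j)"
    by (simp add: transport_def cm mv alg_prod_scale_left alg_prod_scale_right vec_eq_iff flip: mult.assoc)
  have "monom_eval (\<chi> i j. const_poly t *s generic_tensor $ i $ j) m' =
      Poly_Mapping.single m' (t ^ monom_degree m')" for m' :: "'n \<times> 'n \<times> 'n \<Rightarrow>\<^sub>0 nat"
  proof -
    have "monom_eval (\<chi> i j. const_poly t *s generic_tensor $ i $ j) m' =
        (\<Prod>p\<in>UNIV. const_poly t ^ Poly_Mapping.lookup m' p) * monom_eval generic_tensor m'"
      by (simp add: monom_eval_def power_mult_distrib case_prod_beta prod.distrib)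
    also have "\<dots> = const_poly (t ^ monom_degree m') * Poly_Mapping.single m' 1"
      by (simp add: monom_eval_generic monom_degree_def power_sum ring_morphism_prod[OF ring_morphism_const_poly]
          ring_morphism_power[OF ring_morphism_const_poly])
    finally show ?thesis by (simp add: const_poly_def mult_single)
  qed
  then have "gl_subst (mat (inverse t)) f =
      (\<Sum>m\<in>Poly_Mapping.keys f. Poly_Mapping.single m (Poly_Mapping.lookup f m * t ^ monom_degree m))"
    by (simp add: gl_subst_eq inv tr poly_eval_eq[OF ring_morphism_const_poly, of "Poly_Mapping.keys f"]
        const_poly_def mult_single)
  then show ?thesis by (simp add: lookup_sum lookup_single when_def in_keys_iff)
qed

text \<open>Averaging over the scalars $2^{-j}$ with suitable weights extracts the constant term.\<close>

lemma ex_constant_term_weights: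
  "\<exists>(w :: nat \<Rightarrow> 'k::field_char_0) N. \<forall>d\<le>D. (\<Sum>j\<le>N. w j * (2 ^ j) ^ d) = (if d = 0 then 1 else 0)"
proof -
  \<comment> \<open>\<open>P\<close> takes the value 1 at 1 and 0 at 2^d for 1 \<le> d \<le> D; its
    coefficients are the weights. In characteristic 0 the number 2 is not a root of unity, so the
    denominators 1 - 2^d are nonzero.\<close>
  define P :: "'k poly" where
    "P = (\<Prod>d\<in>{1..D}. Polynomial.smult (inverse (1 - 2 ^ d)) [:- (2 ^ d), 1:])"
  have P: "poly P z = (\<Prod>d\<in>{1..D}. inverse (1 - 2 ^ d) * (z - 2 ^ d))" for z
    by (simp add: P_def poly_prod algebra_simps)
  have ne: "(1 :: 'k) - 2 ^ d \<noteq> 0" if "1 \<le> d" for d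
  proof -
    have "(2 ^ d :: nat) \<noteq> 1" using that by simp
    then have "(of_nat (2 ^ d) :: 'k) \<noteq> of_nat 1" by (simp only: of_nat_eq_iff not_False_eq_True)
    then show ?thesis by simp
  qed
  have "(\<Sum>j\<le>Polynomial.degree P. Polynomial.coeff P j * (2 ^ j) ^ d) = (if d = 0 then 1 else 0)" if "d \<le> D" for d
  proof -
    have "(\<Sum>j\<le>Polynomial.degree P. Polynomial.coeff P j * (2 ^ j) ^ d) = poly P (2 ^ d)"
      by (simp add: poly_altdef mult.commute flip: power_mult)
    also have "\<dots> = (if d = 0 then 1 else 0)"
    proof (cases "d = 0")
      case True
      then show ?thesis unfolding P using ne by (simp add: prod.neutral)
    next
      case False
      then have "d \<in> {1..D}" using that by simp
      then show ?thesis unfolding P using False by (auto intro!: prod_zero)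
    qed
    finally show ?thesis .
  qed
  then show ?thesis by blast
qed

text \<open>Each scalar changes \<open>f\<close> by an element of the ideal. The weighted sum of
  these changes is exactly the constant term minus \<open>f\<close>, as an identity of
  polynomials.\<close>

lemma invariant_mod_assoc_ideal:
  fixes f :: "('k::field_char_0, 'n::finite) coord_poly"
  assumes inv: "\<And>g. invertible g \<Longrightarrow> gl_subst g f - f \<in> assoc_ideal"
  shows "f - const_poly (Poly_Mapping.lookup f 0) \<in> assoc_ideal"
proof -
  define D where "D = Max (insert 0 (monom_degree ` Poly_Mapping.keys f))"
  have D: "monom_degree m \<le> D" if "m \<in> Poly_Mapping.keys f" for m
    using that by (auto simp: D_def intro: Max_ge)
  obtain w :: "nat \<Rightarrow> 'k" and N where w: "\<And>d. d \<le> D \<Longrightarrow> (\<Sum>j\<le>N. w j * (2 ^ j) ^ d) = (if d = 0 then 1 else 0)"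
    using ex_constant_term_weights by blast
  have mm: "mat a ** mat b = (mat (a * b) :: 'k^'n^'n)" for a b
    by (simp add: vec_eq_iff matrix_matrix_mult_def mat_def mult_delta_left)
  have sg: "invertible (mat (inverse t) :: 'k^'n^'n)" if "t \<noteq> 0" for t
    unfolding invertible_def by (rule exI[of _ "mat t"]) (simp add: mm that)
  let ?g = "\<lambda>j. mat (inverse (2 ^ j)) :: 'k^'n^'n"
  have "(\<Sum>j\<le>N. const_poly (w j) * (gl_subst (?g j) f - f)) \<in> assoc_ideal"
    by (intro assoc_ideal_sum assoc_ideal_mult inv sg) simp
  also have "(\<Sum>j\<le>N. const_poly (w j) * (gl_subst (?g j) f - f)) = const_poly (Poly_Mapping.lookup f 0) - f"
  proof (rule poly_mapping_eqI)
    fix m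
    have look: "Poly_Mapping.lookup (const_poly c * p) m = c * Poly_Mapping.lookup p m"
      for c and p :: "('k, 'n) coord_poly"
    proof -
      have "const_poly c * p = (\<Sum>m\<in>Poly_Mapping.keys p. Poly_Mapping.single m (c * Poly_Mapping.lookup p m))"
        by (subst poly_mapping_sum_single[of p, symmetric]) (simp add: const_poly_def mult_single sum_distrib_left)
      then show ?thesis by (simp add: lookup_sum lookup_single when_def in_keys_iff)
    qed
    have "Poly_Mapping.lookup (\<Sum>j\<le>N. const_poly (w j) * (gl_subst (?g j) f - f)) m =
        Poly_Mapping.lookup f m * (\<Sum>j\<le>N. w j * (2 ^ j) ^ monom_degree m) - Poly_Mapping.lookup f m * (\<Sum>j\<le>N. w j * (2 ^ j) ^ 0)"
      by (simp add: lookup_sum look lookup_minus gl_subst_scalar)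
        (simp add: sum_distrib_left sum_subtractf algebra_simps)
    also have "(\<Sum>j\<le>N. w j * (2 ^ j) ^ 0) = 1" using w[of 0] by simp
    also have "Poly_Mapping.lookup f m * (\<Sum>j\<le>N. w j * (2 ^ j) ^ monom_degree m) =
        Poly_Mapping.lookup (const_poly (Poly_Mapping.lookup f 0)) m"
    proof (cases "m \<in> Poly_Mapping.keys f")
      case True
      then show ?thesis
        unfolding w[OF D[OF True]] monom_degree_eq_0 by (auto simp: const_poly_def lookup_single when_def)
    next
      case False
      then show ?thesis by (auto simp: const_poly_def lookup_single when_def in_keys_iff)
    qed
    finally show "Poly_Mapping.lookup (\<Sum>j\<le>N. const_poly (w j) * (gl_subst (?g j) f - f)) m =
        Poly_Mapping.lookup (const_poly (Poly_Mapping.lookup f 0) - f) m"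
      by (simp add: lookup_minus)
  qed
  finally have "const_poly (Poly_Mapping.lookup f 0) - f \<in> assoc_ideal" .
  then have "0 - (const_poly (Poly_Mapping.lookup f 0) - f) \<in> assoc_ideal"
    by (rule assoc_ideal_diff[OF assoc_ideal_zero])
  then show ?thesis by simp
qed

section \<open>The invariant ring and its spectrum\<close>

definition const_coset :: "'k::field \<Rightarrow> ('k, 'n::finite) coord_poly set" where
  "const_coset c = assoc_ideal +>\<^bsub>ring_of_type_algebra\<^esub> const_poly c"

lemma coset_eq: "assoc_ideal +>\<^bsub>ring_of_type_algebra\<^esub> f = {h + f | h. h \<in> assoc_ideal}"
  by (auto simp: a_r_coset_def' ring_of_type_algebra_def)

lemma coset_eq_iff:
  "assoc_ideal +>\<^bsub>ring_of_type_algebra\<^esub> f = assoc_ideal +>\<^bsub>ring_of_type_algebra\<^esub> f' \<longleftrightarrow> f - f' \<in> assoc_ideal"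
proof
  assume "assoc_ideal +>\<^bsub>ring_of_type_algebra\<^esub> f = assoc_ideal +>\<^bsub>ring_of_type_algebra\<^esub> f'"
  moreover have "0 + f \<in> assoc_ideal +>\<^bsub>ring_of_type_algebra\<^esub> f"
    unfolding coset_eq using assoc_ideal_zero by blast
  ultimately obtain h where "0 + f = h + f'" "h \<in> assoc_ideal" unfolding coset_eq by blast
  then show "f - f' \<in> assoc_ideal" by simp
next
  assume f: "f - f' \<in> assoc_ideal"
  show "assoc_ideal +>\<^bsub>ring_of_type_algebra\<^esub> f = assoc_ideal +>\<^bsub>ring_of_type_algebra\<^esub> f'"
    unfolding coset_eq
  proof (intro equalityI subsetI)
    fix p assume "p \<in> {h + f |h. h \<in> assoc_ideal}"
    then obtain h where h: "h \<in> assoc_ideal" "p = h + f" by blast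
    have "p = (h + (f - f')) + f'" by (simp add: h)
    then show "p \<in> {h + f' |h. h \<in> assoc_ideal}" using assoc_ideal_add[OF h(1) f] by blast
  next
    fix p assume "p \<in> {h + f' |h. h \<in> assoc_ideal}"
    then obtain h where h: "h \<in> assoc_ideal" "p = h + f'" by blast
    have "p = (h - (f - f')) + f" by (simp add: h)
    then show "p \<in> {h + f |h. h \<in> assoc_ideal}" using assoc_ideal_diff[OF h(1) f] by blast
  qed
qed

lemma gl_subst_const_coset:
  assumes "invertible g" shows "gl_subst g ` const_coset c = const_coset c"
proof -
  obtain h where g: "g ** h = mat 1" "h ** g = mat 1" using assms by (auto simp: invertible_def)
  have sub: "gl_subst g ` const_coset c \<subseteq> const_coset c" if "g ** h = mat 1" "h ** g = mat 1" for g h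
    unfolding const_coset_def coset_eq
    using gl_subst_assoc_ideal[OF that]
    by (auto simp: ring_morphism_add[OF ring_morphism_gl_subst] gl_subst_const)
  have "const_coset c \<subseteq> gl_subst g ` const_coset c"
  proof
    fix f :: "('a, 'b) coord_poly" assume "f \<in> const_coset c"
    then have "gl_subst h f \<in> const_coset c" using sub[OF g(2,1)] by blast
    then show "f \<in> gl_subst g ` const_coset c" using gl_subst_inverse[OF g, of f] by (metis imageI)
  qed
  with sub[OF g] show ?thesis by blast
qed

text \<open>The scalar matrices already force every invariant to be constant.\<close>

lemma carrier_invariant_ring:
  "carrier (invariant_ring :: ('k::field_char_0, 'n::finite) coord_poly set ring) = range const_coset"
proof (intro equalityI subsetI)
  fix Q :: "('k, 'n) coord_poly set" assume Q: "Q \<in> carrier invariant_ring"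
  then have "Q \<in> carrier coord_ring" and inv: "\<And>g. invertible g \<Longrightarrow> gl_subst g ` Q = Q"
    by (auto simp: invariant_ring_def)
  then obtain f where f: "Q = assoc_ideal +>\<^bsub>ring_of_type_algebra\<^esub> f"
    by (auto simp: coord_ring_def FactRing_def A_RCOSETS_def')
  have "0 + f \<in> Q" unfolding f coset_eq using assoc_ideal_zero by blast
  then have "gl_subst g f \<in> Q" if "invertible g" for g using inv[OF that] by auto
  then have "gl_subst g f - f \<in> assoc_ideal" if "invertible g" for g using that unfolding f coset_eq by force
  then have "Q = const_coset (Poly_Mapping.lookup f 0)"
    unfolding f const_coset_def coset_eq_iff by (rule invariant_mod_assoc_ideal)
  then show "Q \<in> range const_coset" by blast
next
  fix Q :: "('k, 'n) coord_poly set" assume "Q \<in> range const_coset"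
  then obtain c where Q: "Q = const_coset c" by blast
  have "Q \<in> carrier coord_ring"
    by (auto simp: Q const_coset_def coord_ring_def FactRing_def A_RCOSETS_def' ring_of_type_algebra_def)
  then show "Q \<in> carrier invariant_ring"
    by (simp add: invariant_ring_def Q gl_subst_const_coset)
qed

text \<open>Evaluation at a point of \<open>alg_points\<close> kills the ideal but no nonzero
  constant.\<close>

lemma const_coset_eq_iff:
  fixes c c' :: "'k::field"
  assumes "(alg_points :: ('k, 'n::finite) tensor set) \<noteq> {}"
  shows "const_coset c = (const_coset c' :: ('k, 'n) coord_poly set) \<longleftrightarrow> c = c'"
proof
  obtain x :: "('k, 'n) tensor" where x: "x \<in> alg_points" using assms by blast
  assume "const_coset c = (const_coset c' :: ('k, 'n) coord_poly set)"
  then have "const_poly (c - c') \<in> (assoc_ideal :: ('k, 'n) coord_poly set)"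
    unfolding const_coset_def coset_eq_iff by (simp add: ring_morphism_diff[OF ring_morphism_const_poly])
  from assoc_ideal_vanishes[OF x this] show "c = c'" by (simp add: poly_eval_const[OF ring_morphism_id])
qed simp

text \<open>On the coset of c, evaluation at any associative product returns c, so every point gives
  the same maximal ideal, the zero ideal.\<close>

lemma git_point_eq:
  fixes x :: "('k::field_char_0, 'n::finite) tensor"
  assumes x: "x \<in> alg_points" shows "git_point x = {const_coset 0}"
proof -
  have ev: "poly_eval id x f = c" if "f \<in> const_coset c" for f c
    using that assoc_ideal_vanishes[OF x] unfolding const_coset_def coset_eq
    by (auto simp: poly_eval_add[OF ring_morphism_id] poly_eval_const[OF ring_morphism_id])
  have ne: "0 + const_poly c \<in> const_coset c" for c
    unfolding const_coset_def coset_eq using assoc_ideal_zero by blast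
  have "(\<forall>f\<in>const_coset c. poly_eval id x f = 0) \<longleftrightarrow> c = 0" for c
    using ev ne[of c] by metis
  then show ?thesis unfolding git_point_def carrier_invariant_ring by auto
qed

lemma const_coset_hom:
  "const_coset \<in> ring_hom (ring_of_type_algebra :: 'k::field ring) (coord_ring :: ('k, 'n::finite) coord_poly set ring)"
proof -
  interpret ideal "assoc_ideal :: ('k, 'n) coord_poly set" ring_of_type_algebra by (rule ideal_assoc_ideal)
  have "const_poly \<in> ring_hom (ring_of_type_algebra :: 'k ring) (ring_of_type_algebra :: ('k, 'n) coord_poly ring)"
    by (auto simp: ring_hom_def ring_of_type_algebra_def const_poly_one ring_morphism_add[OF ring_morphism_const_poly]
        ring_morphism_mult[OF ring_morphism_const_poly])
  from ring_hom_trans[OF this rcos_ring_hom] show ?thesis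
    unfolding const_coset_def[abs_def] coord_ring_def comp_def .
qed

text \<open>The invariants are the image of the field under a ring homomorphism, hence a subring of
  the coordinate ring.\<close>

lemma cring_invariant_ring: "cring (invariant_ring :: ('k::field_char_0, 'n::finite) coord_poly set ring)"
proof -
  let ?C = "coord_ring :: ('k, 'n) coord_poly set ring"
  interpret C: cring ?C
    unfolding coord_ring_def
    by (rule ideal.quotient_is_cring[OF ideal_assoc_ideal cring_from_type_algebra])
  have K: "ring (ring_of_type_algebra :: 'k ring)" by (rule ring_from_type_algebra)
  interpret h: ring_hom_ring "ring_of_type_algebra :: 'k ring" ?C const_coset
    by (rule ring_hom_ringI2[OF K C.ring_axioms const_coset_hom])
  have "subring (range const_coset) ?C"
    using h.img_is_subring[OF ring.carrier_is_subring[OF K]] by (simp add: ring_of_type_algebra_def)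
  then have "cring (?C\<lparr>carrier := range const_coset\<rparr>)"
    using C.subcringI' C.subcring_iff subringE(1) by metis
  moreover have "invariant_ring = ?C\<lparr>carrier := range const_coset\<rparr>"
    using carrier_invariant_ring[where ?'k = 'k and ?'n = 'n] by (simp add: invariant_ring_def)
  ultimately show ?thesis by (simp only:)
qed

text \<open>The invariant ring is a copy of k, and in a field the zero ideal is the only
  prime.\<close>

lemma prime_spectrum_invariant_ring:
  assumes ne: "(alg_points :: ('k::field_char_0, 'n::finite) tensor set) \<noteq> {}"
  shows "primeideal P (invariant_ring :: ('k, 'n) coord_poly set ring) \<longleftrightarrow> P = {const_coset 0}"
proof -
  let ?S = "invariant_ring :: ('k, 'n) coord_poly set ring"
  interpret S: cring ?S by (rule cring_invariant_ring)
  have mult: "const_coset a \<otimes>\<^bsub>?S\<^esub> const_coset b = const_coset (a * b)" for a b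
    using ring_hom_mult[OF const_coset_hom[where ?'k = 'k and ?'n = 'n], of a b] by (simp add: invariant_ring_def ring_of_type_algebra_def)
  have zero: "\<zero>\<^bsub>?S\<^esub> = const_coset 0"
    by (simp add: invariant_ring_def coord_ring_def FactRing_def const_coset_def coset_eq
        ring_morphism_zero[OF ring_morphism_const_poly])
  have one: "\<one>\<^bsub>?S\<^esub> = const_coset 1"
    using ring_hom_one[OF const_coset_hom[where ?'k = 'k and ?'n = 'n]] by (simp add: invariant_ring_def ring_of_type_algebra_def)
  note iff = const_coset_eq_iff[OF ne]
  show ?thesis
  proof
    assume "primeideal P ?S"
    then interpret P: primeideal P ?S .
    have "c = 0" if c: "const_coset c \<in> P" for c
    proof (rule ccontr)
      assume "c \<noteq> 0"
      then have "const_coset (inverse c) \<otimes>\<^bsub>?S\<^esub> const_coset c = \<one>\<^bsub>?S\<^esub>" by (simp add: mult one)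
      moreover have "const_coset (inverse c) \<otimes>\<^bsub>?S\<^esub> const_coset c \<in> P"
        by (rule P.I_l_closed[OF c]) (simp add: carrier_invariant_ring)
      ultimately show False using P.one_imp_carrier P.I_notcarr by simp
    qed
    moreover have "const_coset 0 \<in> P" using P.zero_closed by (simp add: zero)
    moreover have "P \<subseteq> range const_coset" using P.a_subset carrier_invariant_ring by auto
    ultimately show "P = {const_coset 0}" by blast
  next
    assume P: "P = {const_coset 0}"
    show "primeideal P ?S"
    proof (rule primeidealI)
      show "ideal P ?S" unfolding P zero[symmetric] by (rule S.zeroideal)
      have "const_coset 1 \<in> carrier ?S" "const_coset 1 \<notin> P" by (simp_all add: carrier_invariant_ring P iff)
      then show "carrier ?S \<noteq> P" by blast
      fix a b assume ab: "a \<in> carrier ?S" "b \<in> carrier ?S" "a \<otimes>\<^bsub>?S\<^esub> b \<in> P"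
      then obtain c d where c: "a = const_coset c" "b = const_coset d"
        unfolding carrier_invariant_ring by blast
      have "const_coset (c * d) = (const_coset 0 :: ('k, 'n) coord_poly set)"
        using ab(3) unfolding c mult P by (rule singletonD)
      then have "c * d = 0" unfolding iff .
      then show "a \<in> P \<or> b \<in> P" unfolding c P by auto
    qed (rule S.cring_axioms)
  qed
qed

text \<open>The spectrum is the single point \<open>git_point x\<close>, so every open neighbourhood
  of that point is the point itself.\<close>

theorem git_point_isolated:
  fixes x :: "('k::field_char_0, 'n::finite) tensor"
  assumes x: "x \<in> alg_points"
  shows "isolated_in_nbhds_meeting git_quotient S (git_point x)"
proof -
  let ?G = "git_quotient :: ('k, 'n) coord_poly set set topology"
  have ne: "(alg_points :: ('k, 'n) tensor set) \<noteq> {}" using x by blast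
  have "topspace ?G = {P. primeideal P invariant_ring \<and> (\<exists>f\<in>carrier invariant_ring. f \<notin> P)}"
    by (auto simp: git_quotient_def prime_spectrum_def)
  also have "\<dots> = {{const_coset 0}}"
    unfolding prime_spectrum_invariant_ring[OF ne] carrier_invariant_ring
    using const_coset_eq_iff[OF ne, of 1 0] by auto
  finally have t: "topspace ?G = {git_point x}" by (simp add: git_point_eq[OF x])
  have "openin (subtopology ?G N) {git_point x}" if "openin ?G N" "git_point x \<in> N" for N
  proof -
    have "N = {git_point x}" using openin_subset[OF that(1)] that(2) t by auto
    then show ?thesis using t by (simp add: openin_subtopology_refl)
  qed
  then show ?thesis using t by (simp add: isolated_in_nbhds_meeting_def)
qed

theorem theorem1p7:
  fixes x :: "('k::{alg_closed_field, field_char_0}, 'n::finite) tensor"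
  assumes "x \<in> separable_locus"
  shows "linear_iso (stack_tangent x) (HH2 x) (\<lambda>Q. alg_prod ` Q) \<and>
         carrier (HH2 x) = {\<zero>\<^bsub>HH2 x\<^esub>} \<and>
         carrier (stack_tangent x) = {\<zero>\<^bsub>stack_tangent x\<^esub>} \<and>
         isolated_in_nbhds_meeting git_quotient (git_point ` separable_locus) (git_point x) \<and>
         isolated_in_nbhds_meeting orbit_space (gl_orbit ` separable_locus) (gl_orbit x)"
proof -
  interpret separable_algebra x by unfold_locales (rule assms)
  show ?thesis
    by (intro conjI tangent_and_HH2_vanish git_point_isolated[OF x_in_alg_points] gl_orbit_isolated[OF assms])
qed

end
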